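(* Let $R$ be a commutative ring (with unity) of characteristic $0$ and let $G$ be a group. Let $RG^+$ be the set of symmetric elements of the group ring $RG$ with respect to the classical involution. Then $RG^+$ is Lie metabelian if and only if at least one of the following conditions holds: (1) the subgroup $\langle g\in G : g^2\neq 1\rangle$ of $G$ is abelian; (2) $G$ contains an elementary abelian $2$-subgroup of index $2$; (3) $G$ has an abelian subgroup $B$ of index $2$ and an element $x$ of order $4$ such that $x^{-1}bx=b^{-1}$ for every $b\in B$; (4) the center of $G$ is equal to $\{g\in G : g^2=1\}$ and it has index $4$ in $G$.
   Context: The group $G$ is arbitrary (not necessarily finite). The classical involution on $RG$ is the $R$-linear map $*$ with $g^*=g^{-1}$ for $g\in G$, i.e. $\left(\sum_{g} r_g g\right)^*=\sum_g r_g g^{-1}$, and $RG^+=\{r\in RG : r^*=r\}$. For elements $a,b$ of a ring, $[a,b]=ab-ba$. A subset $X$ of a ring is called Lie metabelian if $[[a,b],[c,d]]=0$ for all $a,b,c,d\in X$. An elementary abelian $2$-group is a group all of whose elements satisfy $g^2=1$. *)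

theory Defs
  imports "HOL-Algebra.Algebra"
begin

definition supp :: "('r, 'm) ring_scheme \<Rightarrow> ('g, 'n) monoid_scheme \<Rightarrow> ('g \<Rightarrow> 'r) \<Rightarrow> 'g set" where
  "supp R G f = {x \<in> carrier G. f x \<noteq> \<zero>\<^bsub>R\<^esub>}"

text \<open>The formal sum of the \<open>r\<^sub>g g\<close> is represented by the coefficient function \<open>g \<mapsto> r\<^sub>g\<close>, which is
  \<^const>\<open>undefined\<close> outside the carrier of \<open>G\<close>, so that equality of ring elements is equality
  of functions.\<close>

definition group_ring :: "('r, 'm) ring_scheme \<Rightarrow> ('g, 'n) monoid_scheme \<Rightarrow> ('g \<Rightarrow> 'r) ring" where
  "group_ring R G =
    \<lparr> carrier = {f \<in> carrier G \<rightarrow>\<^sub>E carrier R. finite (supp R G f)},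
      monoid.mult = (\<lambda>f h. \<lambda>x\<in>carrier G.
        \<Oplus>\<^bsub>R\<^esub>y\<in>supp R G f. f y \<otimes>\<^bsub>R\<^esub> h (inv\<^bsub>G\<^esub> y \<otimes>\<^bsub>G\<^esub> x)),
      one = (\<lambda>x\<in>carrier G. if x = \<one>\<^bsub>G\<^esub> then \<one>\<^bsub>R\<^esub> else \<zero>\<^bsub>R\<^esub>),
      ring.zero = (\<lambda>x\<in>carrier G. \<zero>\<^bsub>R\<^esub>),
      ring.add = (\<lambda>f h. \<lambda>x\<in>carrier G. f x \<oplus>\<^bsub>R\<^esub> h x) \<rparr>"

text \<open>The coefficient of \<open>g\<close> in the image of the sum of the \<open>r\<^sub>g g\<close> under the involution is
  the coefficient of \<open>g\<inverse>\<close> in the original sum.\<close>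

definition classical_involution :: "('g, 'n) monoid_scheme \<Rightarrow> ('g \<Rightarrow> 'r) \<Rightarrow> 'g \<Rightarrow> 'r" where
  "classical_involution G f = (\<lambda>x\<in>carrier G. f (inv\<^bsub>G\<^esub> x))"

definition symmetric_elements ::
  "('r, 'm) ring_scheme \<Rightarrow> ('g, 'n) monoid_scheme \<Rightarrow> ('g \<Rightarrow> 'r) set" where
  "symmetric_elements R G = {f \<in> carrier (group_ring R G). classical_involution G f = f}"

definition char_zero :: "('r, 'm) ring_scheme \<Rightarrow> bool" where
  "char_zero R \<longleftrightarrow> (\<forall>n::nat. n > 0 \<longrightarrow> [n] \<cdot>\<^bsub>R\<^esub> \<one>\<^bsub>R\<^esub> \<noteq> \<zero>\<^bsub>R\<^esub>)"

definition lie_bracket :: "('r, 'm) ring_scheme \<Rightarrow> 'r \<Rightarrow> 'r \<Rightarrow> 'r" where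
  "lie_bracket R a b = a \<otimes>\<^bsub>R\<^esub> b \<ominus>\<^bsub>R\<^esub> b \<otimes>\<^bsub>R\<^esub> a"

definition lie_metabelian :: "('r, 'm) ring_scheme \<Rightarrow> 'r set \<Rightarrow> bool" where
  "lie_metabelian R S \<longleftrightarrow> (\<forall>a\<in>S. \<forall>b\<in>S. \<forall>c\<in>S. \<forall>d\<in>S.
     lie_bracket R (lie_bracket R a b) (lie_bracket R c d) = \<zero>\<^bsub>R\<^esub>)"

text \<open>The index is 0 if there are infinitely many cosets.\<close>

definition subgroup_index :: "('g, 'n) monoid_scheme \<Rightarrow> 'g set \<Rightarrow> nat" where
  "subgroup_index G H = card (rcosets\<^bsub>G\<^esub> H)"

definition center :: "('g, 'n) monoid_scheme \<Rightarrow> 'g set" where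
  "center G = {z \<in> carrier G. \<forall>g\<in>carrier G. z \<otimes>\<^bsub>G\<^esub> g = g \<otimes>\<^bsub>G\<^esub> z}"

definition elementary_abelian_2_subgroup :: "'g set \<Rightarrow> ('g, 'n) monoid_scheme \<Rightarrow> bool" where
  "elementary_abelian_2_subgroup H G \<longleftrightarrow>
     subgroup H G \<and> (\<forall>h\<in>H. h [^]\<^bsub>G\<^esub> (2::nat) = \<one>\<^bsub>G\<^esub>)"

lemma (in abelian_monoid) finsum_swap:
  assumes "finite A" "finite B" "\<And>x y. x \<in> A \<Longrightarrow> y \<in> B \<Longrightarrow> f x y \<in> carrier G"
  shows "(\<Oplus>x\<in>A. \<Oplus>y\<in>B. f x y) = (\<Oplus>y\<in>B. \<Oplus>x\<in>A. f x y)"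
  using assms(1,3)
proof (induction A rule: finite_induct)
  case empty
  then show ?case by (simp add: finsum_zero)
next
  case (insert a A)
  have "(\<Oplus>x\<in>insert a A. \<Oplus>y\<in>B. f x y) = (\<Oplus>y\<in>B. f a y) \<oplus> (\<Oplus>y\<in>B. \<Oplus>x\<in>A. f x y)"
    using insert by (subst finsum_insert) (auto intro!: finsum_closed)
  also have "\<dots> = (\<Oplus>y\<in>B. f a y \<oplus> (\<Oplus>x\<in>A. f x y))"
    using insert by (subst finsum_addf) (auto intro!: finsum_closed)
  also have "\<dots> = (\<Oplus>y\<in>B. \<Oplus>x\<in>insert a A. f x y)"
    using insert by (intro finsum_cong') (auto intro!: finsum_closed simp: finsum_insert)
  finally show ?case .
qed

locale group_ring_setup = R: cring R + G: group G
  for R :: "('r, 'm) ring_scheme" (structure) and G :: "('g, 'n) monoid_scheme"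
begin

abbreviation "RG \<equiv> group_ring R G"

lemma RG_closed: "f \<in> carrier RG \<Longrightarrow> x \<in> carrier G \<Longrightarrow> f x \<in> carrier R"
  by (auto simp: group_ring_def)

lemma RG_finite: "f \<in> carrier RG \<Longrightarrow> finite (supp R G f)"
  by (auto simp: group_ring_def)

lemma RG_ext:
  assumes "f \<in> carrier RG" "h \<in> carrier RG" "\<And>x. x \<in> carrier G \<Longrightarrow> f x = h x"
  shows "f = h"
  using assms unfolding group_ring_def by (auto intro: PiE_ext)

lemma mult_coeff:
  assumes f: "f \<in> carrier RG" and h: "h \<in> carrier RG" and x: "x \<in> carrier G"
    and A: "finite A" "supp R G f \<subseteq> A" "A \<subseteq> carrier G"
  shows "(f \<otimes>\<^bsub>RG\<^esub> h) x = (\<Oplus>y\<in>A. f y \<otimes> h (inv\<^bsub>G\<^esub> y \<otimes>\<^bsub>G\<^esub> x))"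
proof -
  have "(\<Oplus>y\<in>supp R G f. f y \<otimes> h (inv\<^bsub>G\<^esub> y \<otimes>\<^bsub>G\<^esub> x)) = (\<Oplus>y\<in>A. f y \<otimes> h (inv\<^bsub>G\<^esub> y \<otimes>\<^bsub>G\<^esub> x))"
    using A x RG_closed[OF f] RG_closed[OF h]
    by (intro R.add.finprod_mono_neutral_cong_left) (auto simp: supp_def subset_iff)
  then show ?thesis using x by (simp add: group_ring_def)
qed

lemma mult_closed:
  assumes f: "f \<in> carrier RG" and h: "h \<in> carrier RG"
  shows "f \<otimes>\<^bsub>RG\<^esub> h \<in> carrier RG"
proof -
  let ?S = "(\<lambda>(y, z). y \<otimes>\<^bsub>G\<^esub> z) ` (supp R G f \<times> supp R G h)"
  have cl: "(f \<otimes>\<^bsub>RG\<^esub> h) x \<in> carrier R" if "x \<in> carrier G" for x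
    using that RG_closed[OF f] RG_closed[OF h]
    by (auto simp: group_ring_def supp_def intro!: R.finsum_closed)
  have "x \<in> ?S" if x: "x \<in> carrier G" "(f \<otimes>\<^bsub>RG\<^esub> h) x \<noteq> \<zero>" for x
  proof (rule ccontr)
    assume n: "x \<notin> ?S"
    have "f y \<otimes> h (inv\<^bsub>G\<^esub> y \<otimes>\<^bsub>G\<^esub> x) = \<zero>" if y: "y \<in> supp R G f" for y
    proof -
      have yc: "y \<in> carrier G" using y by (simp add: supp_def)
      have "x = y \<otimes>\<^bsub>G\<^esub> (inv\<^bsub>G\<^esub> y \<otimes>\<^bsub>G\<^esub> x)"
        using yc x(1) by (simp add: G.m_assoc[symmetric])
      then have "inv\<^bsub>G\<^esub> y \<otimes>\<^bsub>G\<^esub> x \<notin> supp R G h" using n y by force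
      then show ?thesis using yc x(1) RG_closed[OF f] by (simp add: supp_def)
    qed
    then have "(\<Oplus>y\<in>supp R G f. f y \<otimes> h (inv\<^bsub>G\<^esub> y \<otimes>\<^bsub>G\<^esub> x)) = \<zero>"
      by (intro R.add.finprod_one_eqI) auto
    then show False using x by (simp add: group_ring_def)
  qed
  then have "supp R G (f \<otimes>\<^bsub>RG\<^esub> h) \<subseteq> ?S" by (auto simp: supp_def)
  moreover have "finite ?S" using RG_finite f h by auto
  ultimately have "finite (supp R G (f \<otimes>\<^bsub>RG\<^esub> h))" by (rule finite_subset)
  then show ?thesis using cl by (auto simp: group_ring_def)
qed

lemma add_coeff: "x \<in> carrier G \<Longrightarrow> (f \<oplus>\<^bsub>RG\<^esub> h) x = f x \<oplus> h x"
  by (simp add: group_ring_def)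

lemma zero_coeff: "x \<in> carrier G \<Longrightarrow> \<zero>\<^bsub>RG\<^esub> x = \<zero>"
  by (simp add: group_ring_def)

lemma one_coeff: "x \<in> carrier G \<Longrightarrow> \<one>\<^bsub>RG\<^esub> x = (if x = \<one>\<^bsub>G\<^esub> then \<one> else \<zero>)"
  by (simp add: group_ring_def)

lemma add_closed:
  assumes f: "f \<in> carrier RG" and h: "h \<in> carrier RG"
  shows "f \<oplus>\<^bsub>RG\<^esub> h \<in> carrier RG"
proof -
  have "supp R G (f \<oplus>\<^bsub>RG\<^esub> h) \<subseteq> supp R G f \<union> supp R G h"
    by (auto simp: supp_def add_coeff)
  then have "finite (supp R G (f \<oplus>\<^bsub>RG\<^esub> h))"
    using RG_finite f h by (meson finite_UnI finite_subset)
  then show ?thesis using RG_closed[OF f] RG_closed[OF h] by (auto simp: group_ring_def)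
qed

lemma zero_closed: "\<zero>\<^bsub>RG\<^esub> \<in> carrier RG"
  by (auto simp: group_ring_def supp_def)

lemma supp_one: "supp R G \<one>\<^bsub>RG\<^esub> \<subseteq> {\<one>\<^bsub>G\<^esub>}"
  by (auto simp: supp_def one_coeff split: if_splits)

lemma one_closed: "\<one>\<^bsub>RG\<^esub> \<in> carrier RG"
  using finite_subset[OF supp_one] by (auto simp: group_ring_def)

lemma mult_assoc:
  assumes f: "f \<in> carrier RG" and h: "h \<in> carrier RG" and k: "k \<in> carrier RG"
  shows "(f \<otimes>\<^bsub>RG\<^esub> h) \<otimes>\<^bsub>RG\<^esub> k = f \<otimes>\<^bsub>RG\<^esub> (h \<otimes>\<^bsub>RG\<^esub> k)"
proof (rule RG_ext)
  fix x assume x: "x \<in> carrier G"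
  let ?F = "supp R G f"
  define S where "S = supp R G (f \<otimes>\<^bsub>RG\<^esub> h) \<union> (\<lambda>(y, z). y \<otimes>\<^bsub>G\<^esub> z) ` (?F \<times> supp R G h)"
  have S: "finite S" "S \<subseteq> carrier G"
    using RG_finite f h mult_closed by (auto simp: supp_def S_def)
  have Sc: "s \<in> carrier G" if "s \<in> S" for s using S(2) that by blast
  have F: "finite ?F" "?F \<subseteq> carrier G" using RG_finite[OF f] by (auto simp: supp_def)
  have Fc: "s \<in> carrier G" if "s \<in> ?F" for s using F(2) that by blast
  note cl = RG_closed[OF f] RG_closed[OF h] RG_closed[OF k]
  have inner: "(h \<otimes>\<^bsub>RG\<^esub> k) (inv\<^bsub>G\<^esub> y \<otimes>\<^bsub>G\<^esub> x) =
      (\<Oplus>z\<in>S. h (inv\<^bsub>G\<^esub> y \<otimes>\<^bsub>G\<^esub> z) \<otimes> k (inv\<^bsub>G\<^esub> z \<otimes>\<^bsub>G\<^esub> x))" if y: "y \<in> ?F" for y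
  proof -
    have yc: "y \<in> carrier G" using y Fc by blast
    let ?T = "(\<lambda>z. inv\<^bsub>G\<^esub> y \<otimes>\<^bsub>G\<^esub> z) ` S"
    have T: "finite ?T" "?T \<subseteq> carrier G" using S yc by auto
    have "w \<in> ?T" if w: "w \<in> supp R G h" for w
    proof -
      have wc: "w \<in> carrier G" using w by (simp add: supp_def)
      have "y \<otimes>\<^bsub>G\<^esub> w \<in> S" using w y by (force simp: S_def)
      moreover have "w = inv\<^bsub>G\<^esub> y \<otimes>\<^bsub>G\<^esub> (y \<otimes>\<^bsub>G\<^esub> w)"
        using wc yc by (simp add: G.m_assoc[symmetric])
      ultimately show ?thesis by blast
    qed
    then have sub: "supp R G h \<subseteq> ?T" by blast
    have inj: "inj_on (\<lambda>z. inv\<^bsub>G\<^esub> y \<otimes>\<^bsub>G\<^esub> z) S"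
      using yc Sc by (intro inj_onI) simp
    have "(h \<otimes>\<^bsub>RG\<^esub> k) (inv\<^bsub>G\<^esub> y \<otimes>\<^bsub>G\<^esub> x) =
       (\<Oplus>w\<in>?T. h w \<otimes> k (inv\<^bsub>G\<^esub> w \<otimes>\<^bsub>G\<^esub> (inv\<^bsub>G\<^esub> y \<otimes>\<^bsub>G\<^esub> x)))"
      using h k yc x T sub by (intro mult_coeff) auto
    also have "\<dots> = (\<Oplus>z\<in>S. h (inv\<^bsub>G\<^esub> y \<otimes>\<^bsub>G\<^esub> z) \<otimes>
        k (inv\<^bsub>G\<^esub> (inv\<^bsub>G\<^esub> y \<otimes>\<^bsub>G\<^esub> z) \<otimes>\<^bsub>G\<^esub> (inv\<^bsub>G\<^esub> y \<otimes>\<^bsub>G\<^esub> x)))"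
      using inj cl yc x Sc by (intro R.finsum_reindex) auto
    also have "\<dots> = (\<Oplus>z\<in>S. h (inv\<^bsub>G\<^esub> y \<otimes>\<^bsub>G\<^esub> z) \<otimes> k (inv\<^bsub>G\<^esub> z \<otimes>\<^bsub>G\<^esub> x))"
    proof (rule R.finsum_cong')
      fix z assume z: "z \<in> S"
      have zc: "z \<in> carrier G" using z Sc by blast
      have "y \<otimes>\<^bsub>G\<^esub> (inv\<^bsub>G\<^esub> y \<otimes>\<^bsub>G\<^esub> x) = x"
        using yc x by (simp add: G.m_assoc[symmetric])
      then have "inv\<^bsub>G\<^esub> (inv\<^bsub>G\<^esub> y \<otimes>\<^bsub>G\<^esub> z) \<otimes>\<^bsub>G\<^esub> (inv\<^bsub>G\<^esub> y \<otimes>\<^bsub>G\<^esub> x) = inv\<^bsub>G\<^esub> z \<otimes>\<^bsub>G\<^esub> x"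
        using zc yc x by (simp add: G.inv_mult_group G.m_assoc)
      then show "h (inv\<^bsub>G\<^esub> y \<otimes>\<^bsub>G\<^esub> z) \<otimes>
        k (inv\<^bsub>G\<^esub> (inv\<^bsub>G\<^esub> y \<otimes>\<^bsub>G\<^esub> z) \<otimes>\<^bsub>G\<^esub> (inv\<^bsub>G\<^esub> y \<otimes>\<^bsub>G\<^esub> x)) =
        h (inv\<^bsub>G\<^esub> y \<otimes>\<^bsub>G\<^esub> z) \<otimes> k (inv\<^bsub>G\<^esub> z \<otimes>\<^bsub>G\<^esub> x)"
        using zc yc x by simp
    qed (use cl yc x Sc in auto)
    finally show ?thesis .
  qed
  have "((f \<otimes>\<^bsub>RG\<^esub> h) \<otimes>\<^bsub>RG\<^esub> k) x =
      (\<Oplus>z\<in>S. (f \<otimes>\<^bsub>RG\<^esub> h) z \<otimes> k (inv\<^bsub>G\<^esub> z \<otimes>\<^bsub>G\<^esub> x))"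
    using f h k x S mult_closed by (intro mult_coeff) (auto simp: S_def)
  also have "\<dots> = (\<Oplus>z\<in>S. \<Oplus>y\<in>?F. f y \<otimes> (h (inv\<^bsub>G\<^esub> y \<otimes>\<^bsub>G\<^esub> z) \<otimes> k (inv\<^bsub>G\<^esub> z \<otimes>\<^bsub>G\<^esub> x)))"
  proof (rule R.finsum_cong')
    fix z assume z: "z \<in> S"
    have zc: "z \<in> carrier G" using z Sc by blast
    have "(f \<otimes>\<^bsub>RG\<^esub> h) z \<otimes> k (inv\<^bsub>G\<^esub> z \<otimes>\<^bsub>G\<^esub> x)
      = (\<Oplus>y\<in>?F. f y \<otimes> h (inv\<^bsub>G\<^esub> y \<otimes>\<^bsub>G\<^esub> z)) \<otimes> k (inv\<^bsub>G\<^esub> z \<otimes>\<^bsub>G\<^esub> x)"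
      using mult_coeff[OF f h zc F(1) subset_refl F(2)] by simp
    also have "\<dots> = (\<Oplus>y\<in>?F. (f y \<otimes> h (inv\<^bsub>G\<^esub> y \<otimes>\<^bsub>G\<^esub> z)) \<otimes> k (inv\<^bsub>G\<^esub> z \<otimes>\<^bsub>G\<^esub> x))"
      using F zc x cl Fc by (intro R.finsum_ldistr) auto
    also have "\<dots> = (\<Oplus>y\<in>?F. f y \<otimes> (h (inv\<^bsub>G\<^esub> y \<otimes>\<^bsub>G\<^esub> z) \<otimes> k (inv\<^bsub>G\<^esub> z \<otimes>\<^bsub>G\<^esub> x)))"
      using zc x cl Fc by (intro R.finsum_cong') (auto simp: R.m_assoc)
    finally show "(f \<otimes>\<^bsub>RG\<^esub> h) z \<otimes> k (inv\<^bsub>G\<^esub> z \<otimes>\<^bsub>G\<^esub> x) =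
      (\<Oplus>y\<in>?F. f y \<otimes> (h (inv\<^bsub>G\<^esub> y \<otimes>\<^bsub>G\<^esub> z) \<otimes> k (inv\<^bsub>G\<^esub> z \<otimes>\<^bsub>G\<^esub> x)))" .
  qed (use cl x Sc Fc in \<open>auto intro!: R.finsum_closed\<close>)
  also have "\<dots> = (\<Oplus>y\<in>?F. \<Oplus>z\<in>S. f y \<otimes> (h (inv\<^bsub>G\<^esub> y \<otimes>\<^bsub>G\<^esub> z) \<otimes> k (inv\<^bsub>G\<^esub> z \<otimes>\<^bsub>G\<^esub> x)))"
    using S(1) F(1) cl x Sc Fc by (intro R.finsum_swap) auto
  also have "\<dots> = (\<Oplus>y\<in>?F. f y \<otimes> (h \<otimes>\<^bsub>RG\<^esub> k) (inv\<^bsub>G\<^esub> y \<otimes>\<^bsub>G\<^esub> x))"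
  proof (rule R.finsum_cong')
    fix y assume y: "y \<in> ?F"
    have "(\<Oplus>z\<in>S. f y \<otimes> (h (inv\<^bsub>G\<^esub> y \<otimes>\<^bsub>G\<^esub> z) \<otimes> k (inv\<^bsub>G\<^esub> z \<otimes>\<^bsub>G\<^esub> x)))
      = f y \<otimes> (\<Oplus>z\<in>S. h (inv\<^bsub>G\<^esub> y \<otimes>\<^bsub>G\<^esub> z) \<otimes> k (inv\<^bsub>G\<^esub> z \<otimes>\<^bsub>G\<^esub> x))"
      using S(1) cl x Sc Fc[OF y] by (intro R.finsum_rdistr[symmetric]) auto
    then show "(\<Oplus>z\<in>S. f y \<otimes> (h (inv\<^bsub>G\<^esub> y \<otimes>\<^bsub>G\<^esub> z) \<otimes> k (inv\<^bsub>G\<^esub> z \<otimes>\<^bsub>G\<^esub> x))) =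
      f y \<otimes> (h \<otimes>\<^bsub>RG\<^esub> k) (inv\<^bsub>G\<^esub> y \<otimes>\<^bsub>G\<^esub> x)"
      using inner[OF y] by simp
  qed (use cl x Fc RG_closed[OF mult_closed[OF h k]] in auto)
  also have "\<dots> = (f \<otimes>\<^bsub>RG\<^esub> (h \<otimes>\<^bsub>RG\<^esub> k)) x"
    using mult_coeff[OF f mult_closed[OF h k] x F(1) subset_refl F(2)] by simp
  finally show "((f \<otimes>\<^bsub>RG\<^esub> h) \<otimes>\<^bsub>RG\<^esub> k) x = (f \<otimes>\<^bsub>RG\<^esub> (h \<otimes>\<^bsub>RG\<^esub> k)) x" .
qed (use f h k mult_closed in auto)

lemma one_left:
  assumes f: "f \<in> carrier RG"
  shows "\<one>\<^bsub>RG\<^esub> \<otimes>\<^bsub>RG\<^esub> f = f"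
proof (rule RG_ext)
  fix x assume x: "x \<in> carrier G"
  have "(\<one>\<^bsub>RG\<^esub> \<otimes>\<^bsub>RG\<^esub> f) x = (\<Oplus>y\<in>{\<one>\<^bsub>G\<^esub>}. \<one>\<^bsub>RG\<^esub> y \<otimes> f (inv\<^bsub>G\<^esub> y \<otimes>\<^bsub>G\<^esub> x))"
    using f x one_closed supp_one by (intro mult_coeff) auto
  also have "\<dots> = f x"
    using x RG_closed[OF f] by (simp add: R.finsum_insert one_coeff)
  finally show "(\<one>\<^bsub>RG\<^esub> \<otimes>\<^bsub>RG\<^esub> f) x = f x" .
qed (use f mult_closed one_closed in auto)

lemma one_right:
  assumes f: "f \<in> carrier RG"
  shows "f \<otimes>\<^bsub>RG\<^esub> \<one>\<^bsub>RG\<^esub> = f"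
proof (rule RG_ext)
  fix x assume x: "x \<in> carrier G"
  let ?A = "insert x (supp R G f)"
  have Ac: "y \<in> carrier G" if "y \<in> ?A" for y using that x by (auto simp: supp_def)
  have e: "inv\<^bsub>G\<^esub> y \<otimes>\<^bsub>G\<^esub> x = \<one>\<^bsub>G\<^esub> \<longleftrightarrow> x = y" if "y \<in> carrier G" for y
    using that x by (metis G.inv_closed G.inv_equality G.inv_inv G.l_inv)
  have "(f \<otimes>\<^bsub>RG\<^esub> \<one>\<^bsub>RG\<^esub>) x = (\<Oplus>y\<in>?A. f y \<otimes> \<one>\<^bsub>RG\<^esub> (inv\<^bsub>G\<^esub> y \<otimes>\<^bsub>G\<^esub> x))"
    using f x one_closed RG_finite[OF f] by (intro mult_coeff) (auto simp: supp_def)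
  also have "\<dots> = (\<Oplus>y\<in>?A. if x = y then f y else \<zero>)"
    using RG_closed[OF f] Ac x by (intro R.finsum_cong') (auto simp: one_coeff e)
  also have "\<dots> = f x"
    using RG_closed[OF f] Ac RG_finite[OF f] by (intro R.finsum_singleton) auto
  finally show "(f \<otimes>\<^bsub>RG\<^esub> \<one>\<^bsub>RG\<^esub>) x = f x" .
qed (use f mult_closed one_closed in auto)

lemma distrib_right:
  assumes f: "f \<in> carrier RG" and h: "h \<in> carrier RG" and k: "k \<in> carrier RG"
  shows "(f \<oplus>\<^bsub>RG\<^esub> h) \<otimes>\<^bsub>RG\<^esub> k = f \<otimes>\<^bsub>RG\<^esub> k \<oplus>\<^bsub>RG\<^esub> h \<otimes>\<^bsub>RG\<^esub> k"
proof (rule RG_ext)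
  fix x assume x: "x \<in> carrier G"
  let ?A = "supp R G f \<union> supp R G h"
  have A: "finite ?A" "?A \<subseteq> carrier G" "supp R G (f \<oplus>\<^bsub>RG\<^esub> h) \<subseteq> ?A"
    using RG_finite f h by (auto simp: supp_def add_coeff)
  have Ac: "y \<in> carrier G" if "y \<in> ?A" for y using that A(2) by blast
  note cl = RG_closed[OF f] RG_closed[OF h] RG_closed[OF k]
  have "((f \<oplus>\<^bsub>RG\<^esub> h) \<otimes>\<^bsub>RG\<^esub> k) x = (\<Oplus>y\<in>?A. (f \<oplus>\<^bsub>RG\<^esub> h) y \<otimes> k (inv\<^bsub>G\<^esub> y \<otimes>\<^bsub>G\<^esub> x))"
    using mult_coeff[OF add_closed[OF f h] k x A(1) A(3) A(2)] .
  also have "\<dots> = (\<Oplus>y\<in>?A. f y \<otimes> k (inv\<^bsub>G\<^esub> y \<otimes>\<^bsub>G\<^esub> x) \<oplus> h y \<otimes> k (inv\<^bsub>G\<^esub> y \<otimes>\<^bsub>G\<^esub> x))"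
    using cl x Ac by (intro R.finsum_cong') (auto simp: add_coeff R.l_distr)
  also have "\<dots> = (\<Oplus>y\<in>?A. f y \<otimes> k (inv\<^bsub>G\<^esub> y \<otimes>\<^bsub>G\<^esub> x)) \<oplus> (\<Oplus>y\<in>?A. h y \<otimes> k (inv\<^bsub>G\<^esub> y \<otimes>\<^bsub>G\<^esub> x))"
    using cl x Ac by (intro R.finsum_addf) auto
  also have "\<dots> = (f \<otimes>\<^bsub>RG\<^esub> k \<oplus>\<^bsub>RG\<^esub> h \<otimes>\<^bsub>RG\<^esub> k) x"
    using mult_coeff[OF f k x A(1) _ A(2)] mult_coeff[OF h k x A(1) _ A(2)] x
    by (simp add: add_coeff)
  finally show "((f \<oplus>\<^bsub>RG\<^esub> h) \<otimes>\<^bsub>RG\<^esub> k) x = (f \<otimes>\<^bsub>RG\<^esub> k \<oplus>\<^bsub>RG\<^esub> h \<otimes>\<^bsub>RG\<^esub> k) x" .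
qed (use f h k mult_closed add_closed in auto)

lemma distrib_left:
  assumes f: "f \<in> carrier RG" and h: "h \<in> carrier RG" and k: "k \<in> carrier RG"
  shows "k \<otimes>\<^bsub>RG\<^esub> (f \<oplus>\<^bsub>RG\<^esub> h) = k \<otimes>\<^bsub>RG\<^esub> f \<oplus>\<^bsub>RG\<^esub> k \<otimes>\<^bsub>RG\<^esub> h"
proof (rule RG_ext)
  fix x assume x: "x \<in> carrier G"
  let ?A = "supp R G k"
  have A: "finite ?A" "?A \<subseteq> carrier G"
    using RG_finite k by (auto simp: supp_def)
  have Ac: "y \<in> carrier G" if "y \<in> ?A" for y using that A(2) by blast
  note cl = RG_closed[OF f] RG_closed[OF h] RG_closed[OF k]
  note mc = mult_coeff[OF k _ x A(1) subset_refl A(2)]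
  have "(k \<otimes>\<^bsub>RG\<^esub> (f \<oplus>\<^bsub>RG\<^esub> h)) x = (\<Oplus>y\<in>?A. k y \<otimes> (f \<oplus>\<^bsub>RG\<^esub> h) (inv\<^bsub>G\<^esub> y \<otimes>\<^bsub>G\<^esub> x))"
    using mc[OF add_closed[OF f h]] .
  also have "\<dots> = (\<Oplus>y\<in>?A. k y \<otimes> f (inv\<^bsub>G\<^esub> y \<otimes>\<^bsub>G\<^esub> x) \<oplus> k y \<otimes> h (inv\<^bsub>G\<^esub> y \<otimes>\<^bsub>G\<^esub> x))"
    using cl x Ac by (intro R.finsum_cong') (auto simp: add_coeff R.r_distr)
  also have "\<dots> = (\<Oplus>y\<in>?A. k y \<otimes> f (inv\<^bsub>G\<^esub> y \<otimes>\<^bsub>G\<^esub> x)) \<oplus> (\<Oplus>y\<in>?A. k y \<otimes> h (inv\<^bsub>G\<^esub> y \<otimes>\<^bsub>G\<^esub> x))"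
    using cl x Ac by (intro R.finsum_addf) auto
  also have "\<dots> = (k \<otimes>\<^bsub>RG\<^esub> f \<oplus>\<^bsub>RG\<^esub> k \<otimes>\<^bsub>RG\<^esub> h) x"
    using mc[OF f] mc[OF h] x by (simp add: add_coeff)
  finally show "(k \<otimes>\<^bsub>RG\<^esub> (f \<oplus>\<^bsub>RG\<^esub> h)) x = (k \<otimes>\<^bsub>RG\<^esub> f \<oplus>\<^bsub>RG\<^esub> k \<otimes>\<^bsub>RG\<^esub> h) x" .
qed (use f h k mult_closed add_closed in auto)

theorem ring_group_ring: "ring RG"
proof (rule ringI)
  show "abelian_group RG"
  proof (rule abelian_groupI)
    fix f assume f: "f \<in> carrier RG"
    let ?n = "\<lambda>x\<in>carrier G. \<ominus> f x"
    have "supp R G ?n \<subseteq> supp R G f" using RG_closed[OF f] by (auto simp: supp_def)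
    then have "finite (supp R G ?n)" using RG_finite[OF f] finite_subset by blast
    then have n: "?n \<in> carrier RG" using RG_closed[OF f] by (auto simp: group_ring_def)
    have "?n \<oplus>\<^bsub>RG\<^esub> f = \<zero>\<^bsub>RG\<^esub>"
      using RG_closed[OF f] n f add_closed zero_closed
      by (intro RG_ext) (auto simp: add_coeff zero_coeff R.l_neg)
    then show "\<exists>h\<in>carrier RG. h \<oplus>\<^bsub>RG\<^esub> f = \<zero>\<^bsub>RG\<^esub>" using n by blast
  qed (auto intro!: RG_ext add_closed zero_closed
         simp: add_coeff zero_coeff RG_closed R.a_ac)
  show "monoid RG"
    by (rule monoidI) (auto simp: mult_closed one_closed mult_assoc one_left one_right)
qed (auto simp: distrib_right distrib_left)

lemma involution_closed:
  assumes f: "f \<in> carrier RG"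
  shows "classical_involution G f \<in> carrier RG"
proof -
  have "supp R G (classical_involution G f) \<subseteq> m_inv G ` supp R G f"
  proof
    fix x assume "x \<in> supp R G (classical_involution G f)"
    then have "x = inv\<^bsub>G\<^esub> (inv\<^bsub>G\<^esub> x)" "inv\<^bsub>G\<^esub> x \<in> supp R G f"
      by (auto simp: supp_def classical_involution_def)
    then show "x \<in> m_inv G ` supp R G f" by (rule image_eqI)
  qed
  then have "finite (supp R G (classical_involution G f))"
    using RG_finite[OF f] finite_surj by blast
  then show ?thesis
    using RG_closed[OF f] by (auto simp: group_ring_def classical_involution_def)
qed

end

end

theory Submission
  imports Defs
begin

text \<open>Necessity. The functional \<open>tr f = f(1)\<close> on integral elements of \<open>RG\<close> is a trace, and
  \<open>tr (f f)\<close> is up to sign a sum of squares when \<open>f\<^sup>* = \<plusminus>f\<close>; hence it detects zero. If the symmetric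
  elements are Lie metabelian, computing with this trace shows first that skew elements commute
  with commutators of symmetric elements, then that symmetric elements commute with commutators
  of skew elements, and finally that a product of two skew elements commutes with every symmetric
  element. Applied to \<open>a - a\<^sup>-\<^sup>1\<close>, \<open>b - b\<^sup>-\<^sup>1\<close> and \<open>c + c\<^sup>-\<^sup>1\<close>, this says that \<open>abc\<close> is one of six words,
  unless \<open>a\<close> or \<open>b\<close> is an involution or trivial.

  If some \<open>a\<close> has \<open>a\<^sup>4 \<noteq> 1\<close>, that property makes every element centralize or invert \<open>a\<close>, and the
  centralizer of \<open>a\<close> is an abelian subgroup inverted by its complement, which leads to (1) or (3).
  Otherwise squares are central, and squares and commutators live in the group of central
  involutions, regarded as a vector space over the field with two elements. There the six-term
  property says that each linear functional turns the commutator into an alternating form of rank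
  at most two, and the squares vanish on its radical if the form is nonzero. A noncentral
  involution then leads to (2) and its absence to (3) or (4).

  Sufficiency. In the first three cases, commutators of symmetric elements are supported on an
  abelian subgroup, or are skew and supported off an elementary abelian one, and such elements
  commute; in case (4) their coefficients satisfy relations along the three nontrivial cosets of
  the center. All these identities compare two products coefficientwise by a bijection of \<open>G\<close>.\<close>

section \<open>Subgroups of small index\<close>

text \<open>A general R defeats any positivity argument: it may have zero divisors, and -1 may be a
  sum of squares in it. Necessity therefore tests the hypothesis only on elements with integer
  coefficients. They are closed under products, commutators and the involution, characteristic zero
  embeds the integers in R, and the elements built from single group elements are among them, so
  nothing is lost. On the group side the obstacle is that the six-term property is silent when a or
  b has square 1. This is why fourth powers matter: taking a^-2 as second element relates one a to
  every c, provided that a^-2 has nontrivial square. In exponent four the silence is bypassed by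
  multiplying an element by a suitable other one until its square has the wanted value under a
  functional. G may be infinite, so functionals on the central involutions come from Zorn's
  lemma.\<close>

context group begin

lemma inv_cancel_left [simp]: "x \<in> carrier G \<Longrightarrow> y \<in> carrier G \<Longrightarrow> inv x \<otimes> (x \<otimes> y) = y"
  by (simp add: m_assoc[symmetric])

lemma inv_cancel_right [simp]: "x \<in> carrier G \<Longrightarrow> y \<in> carrier G \<Longrightarrow> x \<otimes> (inv x \<otimes> y) = y"
  by (simp add: m_assoc[symmetric])

lemma commute_inv:
  assumes [simp]: "g \<in> carrier G" "n \<in> carrier G" and gn: "g \<otimes> n = n \<otimes> g"
  shows "inv g \<otimes> n = n \<otimes> inv g"
proof -
  have "inv g \<otimes> n = inv g \<otimes> (n \<otimes> g) \<otimes> inv g" by (simp add: m_assoc)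
  also have "\<dots> = n \<otimes> inv g" unfolding gn[symmetric] by (simp add: m_assoc[symmetric])
  finally show ?thesis .
qed

lemma inv_not_mem:
  assumes B: "subgroup B G" and h: "h \<in> carrier G - B"
  shows "inv h \<in> carrier G - B"
  using subgroup.m_inv_closed[OF B, of "inv h"] h by auto

text \<open>Index two is used below in this coset-free form. Any two cosets other than B coincide,
  so for g and h outside B the cosets of g and h^-1 agree, which puts g h into B. Conversely the
  complement is then the single coset of any t outside B.\<close>

lemma subgroup_index_2_iff:
  assumes B: "subgroup B G"
  shows "subgroup_index G B = 2 \<longleftrightarrow> (\<exists>t\<in>carrier G. t \<notin> B) \<and> (\<forall>g\<in>carrier G - B. \<forall>h\<in>carrier G - B. g \<otimes> h \<in> B)"
proof
  assume i: "subgroup_index G B = 2"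
  then have c2: "card (rcosets B) = 2" by (simp add: subgroup_index_def)
  have BR: "B \<in> rcosets B" using B subgroup.subgroup_in_rcosets is_group by blast
  have "\<exists>t\<in>carrier G. t \<notin> B"
  proof (rule ccontr)
    assume "\<not> ?thesis"
    then have "rcosets B \<subseteq> {B}" using coset_join2 B by (auto simp: RCOSETS_def)
    then have "card (rcosets B) \<le> 1" using card_mono[of "{B}"] by fastforce
    then show False using c2 by simp
  qed
  moreover have "g \<otimes> h \<in> B" if g: "g \<in> carrier G - B" and h: "h \<in> carrier G - B" for g h
  proof -
    from c2 obtain P Q where PQ: "rcosets B = {P, Q}" by (auto simp: card_2_iff)
    have n: "B #> k \<in> rcosets B \<and> B #> k \<noteq> B" if "k \<in> carrier G - B" for k
      using that coset_join1[of B k] rcosetsI[OF subgroup.subset[OF B], of k] B by auto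
    have "inv h \<in> carrier G - B" using inv_not_mem[OF B h] .
    then have "B #> g = B #> inv h" using n[OF g] n[of "inv h"] BR unfolding PQ by blast
    then have "g \<in> B #> inv h" using g B rcos_self by auto
    then obtain b where b: "b \<in> B" "g = b \<otimes> inv h" by (auto simp: r_coset_def)
    then have "g \<otimes> h = b" using h subgroup.mem_carrier[OF B] by (simp add: m_assoc)
    then show ?thesis using b by simp
  qed
  ultimately show "(\<exists>t\<in>carrier G. t \<notin> B) \<and> (\<forall>g\<in>carrier G - B. \<forall>h\<in>carrier G - B. g \<otimes> h \<in> B)" by blast
next
  assume a: "(\<exists>t\<in>carrier G. t \<notin> B) \<and> (\<forall>g\<in>carrier G - B. \<forall>h\<in>carrier G - B. g \<otimes> h \<in> B)"
  then obtain t where t: "t \<in> carrier G" "t \<notin> B" by blast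
  have "rcosets B = {B, B #> t}"
  proof
    show "rcosets B \<subseteq> {B, B #> t}"
    proof
      fix K assume "K \<in> rcosets B"
      then obtain x where x: "x \<in> carrier G" "K = B #> x" by (auto simp: RCOSETS_def)
      show "K \<in> {B, B #> t}"
      proof (cases "x \<in> B")
        case True then show ?thesis using x B coset_join2 by simp
      next
        case False
        have "inv t \<in> carrier G - B" using inv_not_mem[OF B] t by blast
        then have "x \<otimes> inv t \<in> B" using a x False by blast
        moreover have "x = x \<otimes> inv t \<otimes> t" using x t by (simp add: m_assoc)
        ultimately have "x \<in> B #> t" by (auto simp: r_coset_def)
        then show ?thesis using repr_independence[of x B t] x t B by simp
      qed
    qed
    show "{B, B #> t} \<subseteq> rcosets B"
      using subgroup.subgroup_in_rcosets[OF B is_group] rcosetsI[OF subgroup.subset[OF B] t(1)] by simp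
  qed
  moreover have "B \<noteq> B #> t" using t B rcos_self by blast
  ultimately show "subgroup_index G B = 2" by (simp add: subgroup_index_def)
qed

lemma ord_eq_4_iff:
  assumes "x \<in> carrier G"
  shows "ord x = 4 \<longleftrightarrow> x \<otimes> x \<noteq> \<one> \<and> x \<otimes> x \<otimes> (x \<otimes> x) = \<one>"
proof -
  have p: "x [^] (2::nat) = x \<otimes> x" "x [^] (4::nat) = x \<otimes> x \<otimes> (x \<otimes> x)"
    using assms by (simp_all add: numeral_eq_Suc m_assoc)
  \<comment> \<open>Divisibility also covers infinite order, where \<open>ord x\<close> is 0 and
    does not divide 4.\<close>
  have "(ord x = 4) \<longleftrightarrow> \<not> ord x dvd 2 \<and> ord x dvd 4"
  proof
    assume "\<not> ord x dvd 2 \<and> ord x dvd 4"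
    moreover have "n = 1 \<or> n = 2 \<or> n = 4" if "n dvd 4" for n :: nat
    proof -
      have "n = 0 \<or> n = 1 \<or> n = 2 \<or> n = 3 \<or> n = 4" using dvd_imp_le[OF that] by linarith
      then show ?thesis using that by auto
    qed
    ultimately show "ord x = 4" by fastforce
  qed auto
  then show ?thesis using pow_eq_id[OF assms] p by metis
qed

lemma comm_group_subgroupI:
  assumes "subgroup H G" "\<And>x y. x \<in> H \<Longrightarrow> y \<in> H \<Longrightarrow> x \<otimes> y = y \<otimes> x"
  shows "comm_group (G\<lparr>carrier := H\<rparr>)"
  using assms subgroup_imp_group by (intro group.group_comm_groupI) auto

lemma comm_group_subgroupD:
  assumes "comm_group (G\<lparr>carrier := H\<rparr>)" "x \<in> H" "y \<in> H"
  shows "x \<otimes> y = y \<otimes> x"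
  using comm_monoid.m_comm[of "G\<lparr>carrier := H\<rparr>" x y] assms by (simp add: comm_group_def)

text \<open>Double centralizer argument: S lies in its centralizer C(S), a subgroup, hence so does
  the subgroup N generated by S. Thus S lies in C(N), and hence so does N.\<close>

lemma generate_commuting:
  assumes S: "S \<subseteq> carrier G" and c: "\<And>x y. x \<in> S \<Longrightarrow> y \<in> S \<Longrightarrow> x \<otimes> y = y \<otimes> x"
  shows "comm_group (G\<lparr>carrier := generate G S\<rparr>)"
proof -
  have centralizer: "subgroup {g \<in> carrier G. \<forall>n\<in>T. g \<otimes> n = n \<otimes> g} G" if T: "T \<subseteq> carrier G" for T
  proof
    fix g h assume gh: "g \<in> {g \<in> carrier G. \<forall>n\<in>T. g \<otimes> n = n \<otimes> g}" "h \<in> {g \<in> carrier G. \<forall>n\<in>T. g \<otimes> n = n \<otimes> g}"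
    have "g \<otimes> h \<otimes> n = n \<otimes> (g \<otimes> h)" if "n \<in> T" for n
    proof -
      have nc: "n \<in> carrier G" using that T by blast
      have "g \<otimes> h \<otimes> n = g \<otimes> (n \<otimes> h)" using gh that nc by (simp add: m_assoc)
      also have "\<dots> = g \<otimes> n \<otimes> h" using gh nc by (simp add: m_assoc)
      also have "g \<otimes> n = n \<otimes> g" using gh that by blast
      finally show ?thesis using gh nc by (simp add: m_assoc)
    qed
    then show "g \<otimes> h \<in> {g \<in> carrier G. \<forall>n\<in>T. g \<otimes> n = n \<otimes> g}" using gh by auto
  next
    fix g assume g: "g \<in> {g \<in> carrier G. \<forall>n\<in>T. g \<otimes> n = n \<otimes> g}"
    have "inv g \<otimes> n = n \<otimes> inv g" if "n \<in> T" for n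
      using g T that by (intro commute_inv) auto
    then show "inv g \<in> {g \<in> carrier G. \<forall>n\<in>T. g \<otimes> n = n \<otimes> g}" using g by auto
  qed (use T in auto)
  let ?N = "generate G S"
  have Nc: "?N \<subseteq> carrier G" using generate_incl[OF S] .
  have "?N \<subseteq> {g \<in> carrier G. \<forall>n\<in>S. g \<otimes> n = n \<otimes> g}"
    by (rule generate_subgroup_incl[OF _ centralizer[OF S]]) (use S c in auto)
  then have "S \<subseteq> {g \<in> carrier G. \<forall>n\<in>?N. g \<otimes> n = n \<otimes> g}" using S by fastforce
  then have "?N \<subseteq> {g \<in> carrier G. \<forall>n\<in>?N. g \<otimes> n = n \<otimes> g}"
    by (rule generate_subgroup_incl[OF _ centralizer[OF Nc]])
  then show ?thesis using generate_is_subgroup[OF S] by (intro comm_group_subgroupI) auto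
qed

lemma subgroup_center: "subgroup (center G) G"
proof
  fix x y assume xy: "x \<in> center G" "y \<in> center G"
  then have c: "x \<in> carrier G" "y \<in> carrier G" unfolding center_def by blast+
  have "x \<otimes> y \<otimes> g = g \<otimes> (x \<otimes> y)" if g: "g \<in> carrier G" for g
  proof -
    have "x \<otimes> y \<otimes> g = x \<otimes> (y \<otimes> g)" using c g by (simp add: m_assoc)
    also have "y \<otimes> g = g \<otimes> y" using xy g by (simp add: center_def)
    also have "x \<otimes> (g \<otimes> y) = x \<otimes> g \<otimes> y" using c g by (simp add: m_assoc)
    also have "x \<otimes> g = g \<otimes> x" using xy g by (simp add: center_def)
    finally show ?thesis using c g by (simp add: m_assoc)
  qed
  moreover have "x \<otimes> y \<in> carrier G" using c by simp
  ultimately show "x \<otimes> y \<in> center G" unfolding center_def by blast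
next
  fix x assume x: "x \<in> center G"
  have "inv x \<otimes> g = g \<otimes> inv x" if g: "g \<in> carrier G" for g
    using x g unfolding center_def by (intro commute_inv) blast+
  moreover have "inv x \<in> carrier G" using x unfolding center_def by blast
  ultimately show "inv x \<in> center G" unfolding center_def by blast
next
  show "center G \<subseteq> carrier G" unfolding center_def by blast
  show "\<one> \<in> center G" by (simp add: center_def)
qed

lemma pow_2: "x \<in> carrier G \<Longrightarrow> x [^] (2::nat) = x \<otimes> x"
  by (simp add: numeral_eq_Suc)

text \<open>The existence of such a subgroup is equivalent to (1) or (3): B may be the whole group,
  and no element of order four is demanded. One computation thus settles the sufficiency of both
  conditions.\<close>

definition inverting_subgroup where
  "inverting_subgroup B \<longleftrightarrow> subgroup B G \<and> (\<forall>b\<in>B. \<forall>c\<in>B. b \<otimes> c = c \<otimes> b) \<and>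
     (\<forall>g\<in>carrier G - B. \<forall>h\<in>carrier G - B. g \<otimes> h \<in> B) \<and> (\<forall>b\<in>B. \<forall>g\<in>carrier G - B. b \<otimes> g = g \<otimes> inv b)"

lemma inverting_subgroupI:
  assumes "subgroup B G" "\<And>b c. b \<in> B \<Longrightarrow> c \<in> B \<Longrightarrow> b \<otimes> c = c \<otimes> b"
    and "\<And>g h. g \<in> carrier G - B \<Longrightarrow> h \<in> carrier G - B \<Longrightarrow> g \<otimes> h \<in> B"
    and "\<And>b g. b \<in> B \<Longrightarrow> g \<in> carrier G - B \<Longrightarrow> b \<otimes> g = g \<otimes> inv b"
  shows "inverting_subgroup B"
  unfolding inverting_subgroup_def
  by (intro conjI ballI) (fact assms(1), erule (1) assms(2), erule (1) assms(3), erule (1) assms(4))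

lemma inverting_subgroupD:
  assumes "inverting_subgroup B"
  shows "subgroup B G" and "b \<in> B \<Longrightarrow> c \<in> B \<Longrightarrow> b \<otimes> c = c \<otimes> b"
    and "g \<in> carrier G - B \<Longrightarrow> h \<in> carrier G - B \<Longrightarrow> g \<otimes> h \<in> B"
    and "b \<in> B \<Longrightarrow> g \<in> carrier G - B \<Longrightarrow> b \<otimes> g = g \<otimes> inv b"
proof -
  note h = assms[unfolded inverting_subgroup_def]
  note h1 = h[THEN conjunct1] and h2 = h[THEN conjunct2, THEN conjunct1] and h3 = h[THEN conjunct2, THEN conjunct2, THEN conjunct1]
    and h4 = h[THEN conjunct2, THEN conjunct2, THEN conjunct2]
  show "subgroup B G" by (rule h1)
  show "b \<otimes> c = c \<otimes> b" if "b \<in> B" "c \<in> B" by (rule h2[THEN bspec, THEN bspec, OF that])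
  show "g \<otimes> h \<in> B" if "g \<in> carrier G - B" "h \<in> carrier G - B" by (rule h3[THEN bspec, THEN bspec, OF that])
  show "b \<otimes> g = g \<otimes> inv b" if "b \<in> B" "g \<in> carrier G - B" by (rule h4[THEN bspec, THEN bspec, OF that])
qed

lemma mult_mem_iff:
  assumes B: "subgroup B G" and [simp]: "x \<in> carrier G" "y \<in> carrier G"
  shows "x \<in> B \<Longrightarrow> x \<otimes> y \<in> B \<longleftrightarrow> y \<in> B" and "y \<in> B \<Longrightarrow> x \<otimes> y \<in> B \<longleftrightarrow> x \<in> B"
proof -
  show "x \<otimes> y \<in> B \<longleftrightarrow> y \<in> B" if x: "x \<in> B"
    using subgroup.m_closed[OF B x, of y] subgroup.m_closed[OF B subgroup.m_inv_closed[OF B x], of "x \<otimes> y"] by auto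
  show "x \<otimes> y \<in> B \<longleftrightarrow> x \<in> B" if y: "y \<in> B"
  proof -
    have "x \<otimes> y \<otimes> inv y = x" by (simp add: m_assoc)
    then show ?thesis
      using subgroup.m_closed[OF B _ y, of x] subgroup.m_closed[OF B _ subgroup.m_inv_closed[OF B y], of "x \<otimes> y"] by auto
  qed
qed

lemma inv_mem_iff: "subgroup B G \<Longrightarrow> x \<in> carrier G \<Longrightarrow> inv x \<in> B \<longleftrightarrow> x \<in> B"
  using subgroup.m_inv_closed[of B G x] subgroup.m_inv_closed[of B G "inv x"] by auto

lemma inverting_subgroup_conj:
  assumes B: "inverting_subgroup B" and y: "y \<in> B" and x: "x \<in> carrier G - B"
  shows "inv x \<otimes> y \<otimes> x = inv y"
proof -
  have c: "x \<in> carrier G" "y \<in> carrier G" using x subgroup.mem_carrier[OF inverting_subgroupD(1)[OF B] y] by auto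
  have "inv x \<otimes> y \<otimes> x = inv x \<otimes> (y \<otimes> x)" using c by (simp add: m_assoc)
  also have "y \<otimes> x = x \<otimes> inv y" by (rule inverting_subgroupD(4)[OF B y x])
  finally show ?thesis using c by simp
qed

lemma inverting_subgroup_whole:
  assumes "\<And>x y. x \<in> carrier G \<Longrightarrow> y \<in> carrier G \<Longrightarrow> x \<otimes> y = y \<otimes> x"
  shows "inverting_subgroup (carrier G)"
  by (rule inverting_subgroupI[OF subgroup_self assms]) simp_all

text \<open>For b in B and g outside, b g is again outside, so b g and g are their own inverses,
  which reads b g = g b^-1. If g, h and g h were all outside, g h would invert b and also, as a
  product of two inverting elements, commute with b; an element b with nontrivial square forbids
  this.\<close>

lemma inverting_subgroup_of_involutions:
  assumes B: "subgroup B G" and ab: "\<And>b c. b \<in> B \<Longrightarrow> c \<in> B \<Longrightarrow> b \<otimes> c = c \<otimes> b"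
    and out: "\<And>g. g \<in> carrier G - B \<Longrightarrow> g \<otimes> g = \<one>" and n: "\<exists>b\<in>B. b \<otimes> b \<noteq> \<one>"
  shows "inverting_subgroup B"
proof -
  have iv: "b \<otimes> g = g \<otimes> inv b" if b: "b \<in> B" and g: "g \<in> carrier G - B" for b g
  proof -
    have c: "b \<in> carrier G" "g \<in> carrier G" using b g subgroup.mem_carrier[OF B] by auto
    have "b \<otimes> g \<in> carrier G - B" using b g c mult_mem_iff[OF B c] by simp
    then have "b \<otimes> g \<otimes> (b \<otimes> g) = \<one>" by (rule out)
    then have "inv (b \<otimes> g) = b \<otimes> g" using c by (intro inv_equality) auto
    moreover have "inv g = g" using out[OF g] c by (intro inv_equality)
    ultimately show ?thesis using c by (simp add: inv_mult_group)
  qed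
  have i2: "g \<otimes> h \<in> B" if g: "g \<in> carrier G - B" and h: "h \<in> carrier G - B" for g h
  proof (rule ccontr)
    assume gh: "g \<otimes> h \<notin> B"
    obtain b where b: "b \<in> B" "b \<otimes> b \<noteq> \<one>" using n by blast
    have c: "b \<in> carrier G" "g \<in> carrier G" "h \<in> carrier G" using b g h subgroup.mem_carrier[OF B] by auto
    have "g \<otimes> h \<otimes> inv b = b \<otimes> (g \<otimes> h)" using iv[OF b(1), of "g \<otimes> h"] gh c by simp
    also have "\<dots> = b \<otimes> g \<otimes> h" using c by (simp add: m_assoc)
    also have "b \<otimes> g = g \<otimes> inv b" using iv b g by blast
    also have "g \<otimes> inv b \<otimes> h = g \<otimes> (inv b \<otimes> h)" using c by (simp add: m_assoc)
    also have "inv b \<otimes> h = h \<otimes> b" using iv[OF subgroup.m_inv_closed[OF B b(1)] h] c by simp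
    finally have "g \<otimes> h \<otimes> inv b = g \<otimes> h \<otimes> b" using c by (simp add: m_assoc)
    then have "inv b = b" using c l_cancel[of "g \<otimes> h" "inv b" b] by simp
    then have "b \<otimes> b = b \<otimes> inv b" by simp
    then show False using b c by simp
  qed
  show ?thesis by (rule inverting_subgroupI[OF B ab i2 iv])
qed

lemma inverting_subgroup_of_generated:
  assumes "comm_group (G\<lparr>carrier := generate G {g \<in> carrier G. g [^] (2::nat) \<noteq> \<one>}\<rparr>)"
  shows "\<exists>B. inverting_subgroup B"
proof -
  let ?N = "{g \<in> carrier G. g [^] (2::nat) \<noteq> \<one>}"
  show ?thesis
  proof (cases "?N = {}")
    \<comment> \<open>Here the generated subgroup is trivial and may have any index, so the whole
      group is taken instead; it is abelian because every element is its own inverse.\<close>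
    case True
    then have sq: "x \<otimes> x = \<one>" if "x \<in> carrier G" for x using that pow_2 by auto
    have iv: "inv x = x" if "x \<in> carrier G" for x using sq[OF that] that by (intro inv_equality)
    have "x \<otimes> y = y \<otimes> x" if c: "x \<in> carrier G" "y \<in> carrier G" for x y
    proof -
      have "inv (x \<otimes> y) = y \<otimes> x" using inv_mult_group[OF c] iv[OF c(1)] iv[OF c(2)] by simp
      then show ?thesis using iv[of "x \<otimes> y"] c by simp
    qed
    from inverting_subgroup_whole[OF this] show ?thesis by blast
  next
    case False
    then obtain b where b: "b \<in> ?N" by blast
    have "inverting_subgroup (generate G ?N)"
    proof (rule inverting_subgroup_of_involutions)
      show "subgroup (generate G ?N) G" by (rule generate_is_subgroup) blast
      show "b \<otimes> c = c \<otimes> b" if "b \<in> generate G ?N" "c \<in> generate G ?N" for b c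
        using comm_group_subgroupD[OF assms that] .
      show "g \<otimes> g = \<one>" if "g \<in> carrier G - generate G ?N" for g
        using that generate.incl[of g ?N G] pow_2[of g] by auto
      show "\<exists>b\<in>generate G ?N. b \<otimes> b \<noteq> \<one>"
        using b generate.incl[of b ?N G] pow_2[of b] by auto
    qed
    then show ?thesis by blast
  qed
qed

text \<open>Inside the abelian B the element x would equal its own inverse, so order four keeps it
  outside. Any other g outside B is x times an element of B, and hence acts on B as x does.\<close>

lemma inverting_subgroup_of_order_4:
  assumes B: "subgroup B G" and ab: "comm_group (G\<lparr>carrier := B\<rparr>)" and ind: "subgroup_index G B = 2"
    and x: "x \<in> carrier G" "ord x = 4" and iv: "\<forall>b\<in>B. inv x \<otimes> b \<otimes> x = inv b"
  shows "inverting_subgroup B"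
proof -
  note cB = subgroup.mem_carrier[OF B]
  have i2: "g \<otimes> h \<in> B" if "g \<in> carrier G - B" "h \<in> carrier G - B" for g h
    using ind that unfolding subgroup_index_2_iff[OF B] by blast
  have xB: "x \<notin> B"
  proof
    assume "x \<in> B"
    then have "inv x \<otimes> x \<otimes> x = inv x" using iv by blast
    then have "x = inv x" using x by simp
    then have "x \<otimes> x = x \<otimes> inv x" by simp
    then show False using ord_eq_4_iff[OF x(1)] x by simp
  qed
  have ivg: "b \<otimes> g = g \<otimes> inv b" if b: "b \<in> B" and g: "g \<in> carrier G - B" for b g
  proof -
    have c: "b \<in> carrier G" "g \<in> carrier G" using b g cB by auto
    have "inv x \<in> carrier G - B" using xB x inv_mem_iff[OF B] by simp
    then have xg: "inv x \<otimes> g \<in> B" using i2 g by blast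
    have "b \<otimes> g = x \<otimes> (inv x \<otimes> b \<otimes> x) \<otimes> (inv x \<otimes> g)" using x c by (simp add: m_assoc)
    also have "inv x \<otimes> b \<otimes> x = inv b" using iv b by blast
    also have "x \<otimes> inv b \<otimes> (inv x \<otimes> g) = x \<otimes> (inv b \<otimes> (inv x \<otimes> g))" using x c by (simp add: m_assoc)
    also have "inv b \<otimes> (inv x \<otimes> g) = inv x \<otimes> g \<otimes> inv b"
      using comm_group_subgroupD[OF ab subgroup.m_inv_closed[OF B b] xg] .
    also have "x \<otimes> (inv x \<otimes> g \<otimes> inv b) = g \<otimes> inv b" using x c by (simp add: m_assoc)
    finally show ?thesis .
  qed
  show ?thesis by (rule inverting_subgroupI[OF B comm_group_subgroupD[OF ab] i2 ivg])
qed

definition lie_metabelian_type where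
  "lie_metabelian_type \<longleftrightarrow>
      comm_group (G\<lparr>carrier := generate G {g \<in> carrier G. g [^] (2::nat) \<noteq> \<one>}\<rparr>)
    \<or> (\<exists>H. elementary_abelian_2_subgroup H G \<and> subgroup_index G H = 2)
    \<or> (\<exists>B x. subgroup B G \<and> comm_group (G\<lparr>carrier := B\<rparr>) \<and> subgroup_index G B = 2 \<and>
          x \<in> carrier G \<and> ord x = 4 \<and> (\<forall>b\<in>B. inv x \<otimes> b \<otimes> x = inv b))
    \<or> (center G = {g \<in> carrier G. g [^] (2::nat) = \<one>} \<and> subgroup_index G (center G) = 4)"

lemma commuting_nonsquares_type:
  assumes "\<And>x y. x \<in> carrier G \<Longrightarrow> y \<in> carrier G \<Longrightarrow> x \<otimes> x \<noteq> \<one> \<Longrightarrow> y \<otimes> y \<noteq> \<one> \<Longrightarrow> x \<otimes> y = y \<otimes> x"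
  shows "lie_metabelian_type"
proof -
  have "comm_group (G\<lparr>carrier := generate G {g \<in> carrier G. g [^] (2::nat) \<noteq> \<one>}\<rparr>)"
    by (rule generate_commuting) (use assms pow_2 in auto)
  then show ?thesis unfolding lie_metabelian_type_def by blast
qed

text \<open>If the complement of B consists of involutions, all elements with nontrivial square lie
  in the abelian B, and (1) holds. Otherwise take t outside with t^2 nontrivial: t inverts t^2,
  which lies in B, but also commutes with it. Hence t^4 = 1, and t is the element of order four in
  (3).\<close>

lemma inverting_subgroup_type:
  assumes "inverting_subgroup B"
  shows "lie_metabelian_type"
proof -
  note B = inverting_subgroupD(1)[OF assms] and ab = inverting_subgroupD(2)[OF assms]
    and i2 = inverting_subgroupD(3)[OF assms] and iv = inverting_subgroupD(4)[OF assms]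
  show ?thesis
  proof (cases "\<forall>t\<in>carrier G - B. t \<otimes> t = \<one>")
    case True
    then show ?thesis using ab by (intro commuting_nonsquares_type) blast
  next
    case False
    then obtain t where t: "t \<in> carrier G" "t \<notin> B" "t \<otimes> t \<noteq> \<one>" by blast
    have ttB: "t \<otimes> t \<in> B" using i2 t by blast
    then have "t \<otimes> t \<otimes> t = t \<otimes> inv (t \<otimes> t)" using iv t by blast
    then have "t \<otimes> (t \<otimes> t) = t \<otimes> inv (t \<otimes> t)" using t by (simp add: m_assoc)
    then have "t \<otimes> t = inv (t \<otimes> t)" using t l_cancel[of t "t \<otimes> t" "inv (t \<otimes> t)"] by simp
    then have "t \<otimes> t \<otimes> (t \<otimes> t) = t \<otimes> t \<otimes> inv (t \<otimes> t)" by simp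
    then have "t \<otimes> t \<otimes> (t \<otimes> t) = \<one>" using t by simp
    then have "ord t = 4" using ord_eq_4_iff t by blast
    moreover have "inv t \<otimes> b \<otimes> t = inv b" if b: "b \<in> B" for b
    proof -
      have bc: "b \<in> carrier G" using subgroup.mem_carrier[OF B b] .
      have "inv t \<otimes> b \<otimes> t = inv t \<otimes> (b \<otimes> t)" using bc t by (simp add: m_assoc)
      also have "b \<otimes> t = t \<otimes> inv b" using iv b t by blast
      also have "inv t \<otimes> (t \<otimes> inv b) = inv b" using bc t by (metis inv_closed l_inv l_one m_assoc)
      finally show ?thesis .
    qed
    moreover have "subgroup_index G B = 2" using subgroup_index_2_iff[OF B] t i2 by blast
    moreover have "comm_group (G\<lparr>carrier := B\<rparr>)" using comm_group_subgroupI B ab by blast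
    ultimately show ?thesis using B t unfolding lie_metabelian_type_def by blast
  qed
qed

end

section \<open>Groups with the six-term property\<close>

text \<open>The word \<open>abc\<close> occurs in the commutator of \<open>(a - a\<^sup>-\<^sup>1)(b - b\<^sup>-\<^sup>1)\<close> and \<open>c + c\<^sup>-\<^sup>1\<close>; the six words are those
  that can cancel it.\<close>

locale six_group = group +
  assumes six: "\<lbrakk>a \<in> carrier G; b \<in> carrier G; c \<in> carrier G; a \<otimes> a \<noteq> \<one>; b \<otimes> b \<noteq> \<one>\<rbrakk> \<Longrightarrow>
    a \<otimes> b \<otimes> c = c \<otimes> a \<otimes> b \<or> a \<otimes> b \<otimes> c = inv c \<otimes> a \<otimes> b \<or>
    a \<otimes> b \<otimes> c = c \<otimes> inv a \<otimes> inv b \<or> a \<otimes> b \<otimes> c = inv c \<otimes> inv a \<otimes> inv b \<or>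
    a \<otimes> b \<otimes> c = a \<otimes> inv b \<otimes> inv c \<or> a \<otimes> b \<otimes> c = inv a \<otimes> b \<otimes> inv c"
begin

section \<open>Elements with nontrivial fourth power\<close>

definition normalizing where "normalizing a c \<longleftrightarrow> a \<otimes> c = c \<otimes> a \<or> a \<otimes> c = c \<otimes> inv a"

text \<open>The six-term property for \<open>b = a\<^sup>-\<^sup>2\<close>.\<close>

lemma six_inverse_square:
  assumes a: "a \<in> carrier G" and c: "c \<in> carrier G" and a4: "a \<otimes> a \<otimes> a \<otimes> a \<noteq> \<one>"
  shows "normalizing a c \<or> c \<otimes> a \<otimes> c = a \<or> inv a \<otimes> c \<otimes> inv a \<otimes> c = \<one> \<or> c \<otimes> c = a \<otimes> a \<otimes> a \<otimes> a \<or> c \<otimes> c = inv a \<otimes> inv a"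
proof -
  have n: "a \<otimes> a \<noteq> \<one>" using a4 a by (metis m_assoc one_closed r_one)
  let ?b = "inv a \<otimes> inv a"
  have b: "?b \<otimes> ?b \<noteq> \<one>"
  proof
    assume "?b \<otimes> ?b = \<one>"
    then have "inv (?b \<otimes> ?b) = \<one>" by simp
    then show False using a4 a by (simp add: inv_mult_group m_assoc)
  qed
  have e: "a \<otimes> ?b = inv a" "inv a \<otimes> inv ?b = a" "a \<otimes> inv ?b = a \<otimes> a \<otimes> a"
    "inv a \<otimes> ?b = inv a \<otimes> inv a \<otimes> inv a"
    using a by (simp_all add: inv_mult_group m_assoc)
  from six[OF a _ c n b] a c
  have "inv a \<otimes> c = c \<otimes> inv a \<or> inv a \<otimes> c = inv c \<otimes> inv a \<or> inv a \<otimes> c = c \<otimes> a \<or>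
    inv a \<otimes> c = inv c \<otimes> a \<or> inv a \<otimes> c = a \<otimes> a \<otimes> a \<otimes> inv c \<or> inv a \<otimes> c = inv a \<otimes> inv a \<otimes> inv a \<otimes> inv c"
    by (auto simp: m_assoc inv_mult_group)
  then show ?thesis
  proof (elim disjE)
    assume h: "inv a \<otimes> c = c \<otimes> inv a"
    have "a \<otimes> c = a \<otimes> (c \<otimes> inv a) \<otimes> a" using a c by (simp add: m_assoc)
    also have "\<dots> = c \<otimes> a" unfolding h[symmetric] using a c by (simp add: m_assoc)
    finally show ?thesis by (simp add: normalizing_def)
  next
    assume h: "inv a \<otimes> c = inv c \<otimes> inv a"
    have "inv (inv a \<otimes> c) = inv (inv c \<otimes> inv a)" using h by simp
    then have h2: "inv c \<otimes> a = a \<otimes> c" using a c by (simp add: inv_mult_group)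
    have "c \<otimes> a \<otimes> c = c \<otimes> (a \<otimes> c)" using a c by (simp add: m_assoc)
    also have "\<dots> = a" unfolding h2[symmetric] using a c by (simp add: m_assoc)
    finally show ?thesis by simp
  next
    assume h: "inv a \<otimes> c = c \<otimes> a"
    have "a \<otimes> c = a \<otimes> (c \<otimes> a) \<otimes> inv a" using a c by (simp add: m_assoc)
    also have "\<dots> = c \<otimes> inv a" unfolding h[symmetric] using a c by (simp add: m_assoc)
    finally show ?thesis by (simp add: normalizing_def)
  next
    assume h: "inv a \<otimes> c = inv c \<otimes> a"
    have "inv a \<otimes> c \<otimes> inv a \<otimes> c = inv a \<otimes> c \<otimes> (inv a \<otimes> c)" using a c by (simp add: m_assoc)
    also have "\<dots> = inv a \<otimes> c \<otimes> (inv c \<otimes> a)" unfolding h ..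
    also have "\<dots> = \<one>" using a c by (simp add: m_assoc)
    finally show ?thesis by simp
  next
    assume h: "inv a \<otimes> c = a \<otimes> a \<otimes> a \<otimes> inv c"
    have "c \<otimes> c = a \<otimes> (inv a \<otimes> c) \<otimes> c" using a c by (simp add: m_assoc)
    also have "\<dots> = a \<otimes> a \<otimes> a \<otimes> a" unfolding h using a c by (simp add: m_assoc)
    finally show ?thesis by simp
  next
    assume h: "inv a \<otimes> c = inv a \<otimes> inv a \<otimes> inv a \<otimes> inv c"
    have "c \<otimes> c = a \<otimes> (inv a \<otimes> c) \<otimes> c" using a c by (simp add: m_assoc)
    also have "\<dots> = inv a \<otimes> inv a" unfolding h using a c by (simp add: m_assoc)
    finally show ?thesis by simp
  qed
qed

lemma normalizing_mult_right:
  assumes a: "a \<in> carrier G" and c: "c \<in> carrier G" shows "normalizing a (c \<otimes> a) \<longleftrightarrow> normalizing a c"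
proof -
  have "a \<otimes> (c \<otimes> a) = c \<otimes> a \<otimes> a \<longleftrightarrow> a \<otimes> c = c \<otimes> a"
    using a c by (simp add: m_assoc[symmetric])
  moreover have "a \<otimes> (c \<otimes> a) = c \<otimes> a \<otimes> inv a \<longleftrightarrow> a \<otimes> c = c \<otimes> inv a"
  proof -
    have "c \<otimes> a \<otimes> inv a = c \<otimes> inv a \<otimes> a" using a c by (simp add: m_assoc)
    then show ?thesis using a c by (simp add: m_assoc[symmetric])
  qed
  ultimately show ?thesis by (simp add: normalizing_def)
qed

lemma normalizing_mult_left_inv:
  assumes a: "a \<in> carrier G" and c: "c \<in> carrier G" and g: "normalizing a (inv a \<otimes> c)" shows "normalizing a c"
proof -
  from g have "a \<otimes> (a \<otimes> (inv a \<otimes> c)) = a \<otimes> (inv a \<otimes> c \<otimes> a) \<or> a \<otimes> (a \<otimes> (inv a \<otimes> c)) = a \<otimes> (inv a \<otimes> c \<otimes> inv a)"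
    unfolding normalizing_def by auto
  then show ?thesis using a c unfolding normalizing_def by (simp add: m_assoc)
qed

text \<open>When c^2 = 1 the exceptional alternatives of \<open>six_inverse_square\<close> collapse:
  c a c = a says that c and a commute, (a^-1 c)^2 = 1 says that c inverts a, and the two values for
  c^2 would force a^4 = 1.\<close>

lemma normalizing_involution:
  assumes a: "a \<in> carrier G" and c: "c \<in> carrier G" and a4: "a \<otimes> a \<otimes> a \<otimes> a \<noteq> \<one>" and cc: "c \<otimes> c = \<one>"
  shows "normalizing a c"
proof -
  have ccx: "c \<otimes> (c \<otimes> x) = x" if "x \<in> carrier G" for x using that c cc by (simp add: m_assoc[symmetric])
  show ?thesis using six_inverse_square[OF a c a4]
  proof (elim disjE)
    assume h: "c \<otimes> a \<otimes> c = a"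
    have "c \<otimes> (c \<otimes> a \<otimes> c) = a \<otimes> c" using a c ccx by (simp add: m_assoc)
    then show ?thesis unfolding h normalizing_def by simp
  next
    assume h: "inv a \<otimes> c \<otimes> inv a \<otimes> c = \<one>"
    have "a \<otimes> (inv a \<otimes> c \<otimes> inv a \<otimes> c) \<otimes> c = c \<otimes> inv a" using a c cc by (simp add: m_assoc)
    then show ?thesis unfolding h normalizing_def using a c by simp
  next
    assume "c \<otimes> c = inv a \<otimes> inv a"
    then have "inv a \<otimes> inv a = \<one>" using cc by simp
    then have "inv (a \<otimes> a) = \<one>" using a by (simp add: inv_mult_group)
    then have "a \<otimes> a = \<one>" using a by simp
    then show ?thesis using a4 a by simp
  qed (use cc a4 in auto)
qed

text \<open>The alternative c a c = a is removed by applying \<open>six_inverse_square\<close> to c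
  a in place of c. Its square is a^2 here, so each alternative either gives the claim back for c,
  makes c an involution, or forces a^4 = 1.\<close>

lemma normalizing_of_inverted:
  assumes a: "a \<in> carrier G" and c: "c \<in> carrier G" and a4: "a \<otimes> a \<otimes> a \<otimes> a \<noteq> \<one>" and h: "c \<otimes> a \<otimes> c = a"
  shows "normalizing a c"
proof -
  have h': "c \<otimes> (a \<otimes> c) = a" using h a c by (simp add: m_assoc)
  have hx: "c \<otimes> (a \<otimes> (c \<otimes> x)) = a \<otimes> x" if "x \<in> carrier G" for x
    using h a c that by (simp add: m_assoc[symmetric])
  have aa: "c \<otimes> a \<otimes> (c \<otimes> a) = a \<otimes> a" using a c hx by (simp add: m_assoc)
  have ca: "c \<otimes> a \<in> carrier G" using a c by simp
  show ?thesis using six_inverse_square[OF a ca a4]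
  proof (elim disjE)
    assume "normalizing a (c \<otimes> a)" then show ?thesis using normalizing_mult_right a c by blast
  next
    assume "c \<otimes> a \<otimes> a \<otimes> (c \<otimes> a) = a"
    then have "c \<otimes> a \<otimes> a \<otimes> c \<otimes> a = \<one> \<otimes> a" using a c by (simp add: m_assoc)
    then have e: "(c \<otimes> a) \<otimes> (a \<otimes> c) = \<one>" using a c r_cancel[of "c \<otimes> a \<otimes> a \<otimes> c" a "\<one>"] by (simp add: m_assoc)
    then have "(a \<otimes> c) \<otimes> (c \<otimes> a) = \<one>" using a c by (metis inv_equality m_closed r_inv)
    then have "c \<otimes> ((a \<otimes> c) \<otimes> (c \<otimes> a)) \<otimes> c = c \<otimes> c" using a c by simp
    then have "a \<otimes> a = c \<otimes> c" using a c hx h' by (simp add: m_assoc)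
    moreover have "a \<otimes> (c \<otimes> c) \<otimes> a = \<one>" using \<open>(a \<otimes> c) \<otimes> (c \<otimes> a) = \<one>\<close> a c by (simp add: m_assoc)
    ultimately have "a \<otimes> (a \<otimes> a) \<otimes> a = \<one>" by simp
    then show ?thesis using a4 a by (simp add: m_assoc)
  next
    assume "inv a \<otimes> (c \<otimes> a) \<otimes> inv a \<otimes> (c \<otimes> a) = \<one>"
    then have "inv a \<otimes> (c \<otimes> c) \<otimes> a = \<one>" using a c by (simp add: m_assoc)
    then have "a \<otimes> (inv a \<otimes> (c \<otimes> c) \<otimes> a) \<otimes> inv a = \<one>" using a by simp
    then have "c \<otimes> c = \<one>" using a c by (simp add: m_assoc)
    then show ?thesis using normalizing_involution a c a4 by blast
  next
    assume "c \<otimes> a \<otimes> (c \<otimes> a) = a \<otimes> a \<otimes> a \<otimes> a"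
    then have "a \<otimes> a \<otimes> \<one> = a \<otimes> a \<otimes> (a \<otimes> a)" unfolding aa using a by (simp add: m_assoc)
    then have "\<one> = a \<otimes> a" using a l_cancel[of "a \<otimes> a" \<one> "a \<otimes> a"] by simp
    then show ?thesis using a4 a by simp
  next
    assume "c \<otimes> a \<otimes> (c \<otimes> a) = inv a \<otimes> inv a"
    then have "a \<otimes> a \<otimes> (a \<otimes> a) = a \<otimes> a \<otimes> (inv a \<otimes> inv a)" unfolding aa by simp
    then show ?thesis using a4 a by (simp add: m_assoc)
  qed
qed

text \<open>The alternative (a^-1 c)^2 = 1 is reduced to the case of an involution, which leaves two
  possible values for c^2. The same dichotomy for a^-1 gives two more, and only c^2 = a^4 is
  compatible with them.\<close>

lemma not_normalizing_square:
  assumes a: "a \<in> carrier G" and c: "c \<in> carrier G" and a4: "a \<otimes> a \<otimes> a \<otimes> a \<noteq> \<one>" and ng: "\<not> normalizing a c"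
  shows "c \<otimes> c = a \<otimes> a \<otimes> a \<otimes> a"
proof -
  have beta: "inv a \<otimes> c \<otimes> inv a \<otimes> c \<noteq> \<one>" if a: "a \<in> carrier G" and a4: "a \<otimes> a \<otimes> a \<otimes> a \<noteq> \<one>" and ng: "\<not> normalizing a c" for a
  proof
    assume "inv a \<otimes> c \<otimes> inv a \<otimes> c = \<one>"
    then have "(inv a \<otimes> c) \<otimes> (inv a \<otimes> c) = \<one>" using a c by (simp add: m_assoc)
    then have "normalizing a (inv a \<otimes> c)" using normalizing_involution a a4 c by simp
    then show False using ng normalizing_mult_left_inv a c by blast
  qed
  have key: "c \<otimes> c = a \<otimes> a \<otimes> a \<otimes> a \<or> c \<otimes> c = inv a \<otimes> inv a" if a: "a \<in> carrier G" and a4: "a \<otimes> a \<otimes> a \<otimes> a \<noteq> \<one>" and ng: "\<not> normalizing a c" for a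
    using six_inverse_square[OF a c a4] beta[OF that] normalizing_of_inverted[OF a c a4] ng by blast
  have ia: "inv a \<otimes> inv a \<otimes> inv a \<otimes> inv a = inv (a \<otimes> a \<otimes> a \<otimes> a)" using a by (simp add: inv_mult_group m_assoc)
  then have ia4: "inv a \<otimes> inv a \<otimes> inv a \<otimes> inv a \<noteq> \<one>" using a4 a by simp
  have "normalizing a c" if "normalizing (inv a) c"
  proof -
    from that have "a \<otimes> (inv a \<otimes> c) \<otimes> a = a \<otimes> (c \<otimes> inv a) \<otimes> a \<or> a \<otimes> (inv a \<otimes> c) \<otimes> inv a = a \<otimes> (c \<otimes> a) \<otimes> inv a"
      using a unfolding normalizing_def by auto
    then show ?thesis using a c unfolding normalizing_def by (auto simp: m_assoc)
  qed
  then have k2: "c \<otimes> c = inv a \<otimes> inv a \<otimes> inv a \<otimes> inv a \<or> c \<otimes> c = a \<otimes> a"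
    using key[OF inv_closed[OF a] ia4] ng a by auto
  from key[OF a a4 ng] show ?thesis
  proof
    assume h: "c \<otimes> c = inv a \<otimes> inv a"
    from k2 show ?thesis
    proof
      assume "c \<otimes> c = inv a \<otimes> inv a \<otimes> inv a \<otimes> inv a"
      then have "inv a \<otimes> inv a \<otimes> \<one> = inv a \<otimes> inv a \<otimes> (inv a \<otimes> inv a)" using h a by (simp add: m_assoc)
      then have "\<one> = inv a \<otimes> inv a" using a l_cancel[of "inv a \<otimes> inv a" \<one> "inv a \<otimes> inv a"] by simp
      then show ?thesis using ia4 a by simp
    next
      assume "c \<otimes> c = a \<otimes> a"
      then have "a \<otimes> a \<otimes> (a \<otimes> a) = a \<otimes> a \<otimes> (inv a \<otimes> inv a)" using h by simp
      then show ?thesis using a4 a by (simp add: m_assoc)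
    qed
  qed
qed

text \<open>A counterexample c yields a second one, c a. Both have square a^4, so c^2 = (c a)^2,
  that is c = a c a; but then c inverts a.\<close>

lemma fourth_power_normalizing:
  assumes a: "a \<in> carrier G" and c: "c \<in> carrier G" and a4: "a \<otimes> a \<otimes> a \<otimes> a \<noteq> \<one>"
  shows "normalizing a c"
proof (rule ccontr)
  assume ng: "\<not> normalizing a c"
  then have "c \<otimes> c = a \<otimes> a \<otimes> a \<otimes> a" using not_normalizing_square assms by blast
  moreover have "(c \<otimes> a) \<otimes> (c \<otimes> a) = a \<otimes> a \<otimes> a \<otimes> a"
    using ng not_normalizing_square[of a "c \<otimes> a"] normalizing_mult_right assms by simp
  ultimately have "c \<otimes> c = c \<otimes> (a \<otimes> c \<otimes> a)" using a c by (simp add: m_assoc)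
  then have h: "c = a \<otimes> c \<otimes> a" using a c by simp
  have "a \<otimes> c = (a \<otimes> c \<otimes> a) \<otimes> inv a" using a c by (simp add: m_assoc)
  then have "normalizing a c" unfolding h[symmetric] normalizing_def by simp
  then show False using ng by simp
qed

lemma fourth_power_mult:
  assumes "a \<in> carrier G" "b \<in> carrier G" "a \<otimes> b = b \<otimes> a"
  shows "(a \<otimes> b) \<otimes> (a \<otimes> b) \<otimes> (a \<otimes> b) \<otimes> (a \<otimes> b) = (a \<otimes> a \<otimes> a \<otimes> a) \<otimes> (b \<otimes> b \<otimes> b \<otimes> b)"
proof -
  have e: "b \<otimes> (a \<otimes> x) = a \<otimes> (b \<otimes> x)" if "x \<in> carrier G" for x
    using assms that by (simp add: m_assoc[symmetric])
  show ?thesis using assms(1,2) by (simp add: m_assoc e assms(3)[symmetric])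
qed

text \<open>As a commutes with b and c but b and c do not commute, c cannot centralize a b and must
  invert it. Applied to several powers of a in turn, this gives competing expressions for b
  c.\<close>

lemma normalizing_shift:
  assumes a: "a \<in> carrier G" and b: "b \<in> carrier G" and c: "c \<in> carrier G"
    and ab: "a \<otimes> b = b \<otimes> a" and ac: "a \<otimes> c = c \<otimes> a" and g: "normalizing (a \<otimes> b) c" and n: "b \<otimes> c \<noteq> c \<otimes> b"
  shows "b \<otimes> c = inv a \<otimes> inv a \<otimes> c \<otimes> inv b"
proof -
  have "a \<otimes> b \<otimes> c \<noteq> c \<otimes> (a \<otimes> b)"
  proof
    assume "a \<otimes> b \<otimes> c = c \<otimes> (a \<otimes> b)"
    also have "\<dots> = a \<otimes> c \<otimes> b" using ac a b c by (simp add: m_assoc)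
    finally show False using n a b c by (simp add: m_assoc)
  qed
  then have "a \<otimes> b \<otimes> c = c \<otimes> inv (a \<otimes> b)" using g by (simp add: normalizing_def)
  also have "\<dots> = c \<otimes> inv a \<otimes> inv b" using ab a b c by (simp add: inv_mult_group m_assoc)
  also have "c \<otimes> inv a = inv a \<otimes> c" using ac a c by (metis inv_closed inv_solve_left inv_solve_right m_closed m_assoc)
  finally have "inv a \<otimes> (a \<otimes> b \<otimes> c) = inv a \<otimes> (inv a \<otimes> c \<otimes> inv b)" by simp
  then show ?thesis using a b c by (simp add: m_assoc)
qed

text \<open>Suppose b and c do not commute. Whenever a b, a^-1 b or a^2 b has nontrivial fourth
  power, \<open>normalizing_shift\<close> computes b c. If b^4 = 1, the first two apply and
  disagree. If not, c inverts b, and agreement with this rules out the first two, so that a^4 b^4 =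
  1 and a^4 = b^4.\<close>

lemma centralizer_abelian:
  assumes a: "a \<in> carrier G" and b: "b \<in> carrier G" and c: "c \<in> carrier G"
    and a4: "a \<otimes> a \<otimes> a \<otimes> a \<noteq> \<one>" and ab: "a \<otimes> b = b \<otimes> a" and ac: "a \<otimes> c = c \<otimes> a"
  shows "b \<otimes> c = c \<otimes> b"
proof (rule ccontr)
  assume n: "b \<otimes> c \<noteq> c \<otimes> b"
  have iab: "inv a \<otimes> b = b \<otimes> inv a" using ab a b by (metis inv_closed inv_solve_left inv_solve_right m_closed m_assoc)
  have iac: "inv a \<otimes> c = c \<otimes> inv a" using ac a c by (metis inv_closed inv_solve_left inv_solve_right m_closed m_assoc)
  have ia4: "inv a \<otimes> inv a \<otimes> inv a \<otimes> inv a = inv (a \<otimes> a \<otimes> a \<otimes> a)" using a by (simp add: inv_mult_group m_assoc)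
  have s1: "b \<otimes> c = inv a \<otimes> inv a \<otimes> c \<otimes> inv b" if "(a \<otimes> a \<otimes> a \<otimes> a) \<otimes> (b \<otimes> b \<otimes> b \<otimes> b) \<noteq> \<one>"
    using normalizing_shift[OF a b c ab ac fourth_power_normalizing n] fourth_power_mult[OF a b ab] that a b c by simp
  have s2: "b \<otimes> c = a \<otimes> a \<otimes> c \<otimes> inv b" if "inv (a \<otimes> a \<otimes> a \<otimes> a) \<otimes> (b \<otimes> b \<otimes> b \<otimes> b) \<noteq> \<one>"
    using normalizing_shift[OF inv_closed[OF a] b c iab iac fourth_power_normalizing n] fourth_power_mult[OF inv_closed[OF a] b iab] that a b c ia4 by simp
  show False
  proof (cases "b \<otimes> b \<otimes> b \<otimes> b = \<one>")
    case True
    then have "inv a \<otimes> inv a \<otimes> c \<otimes> inv b = a \<otimes> a \<otimes> c \<otimes> inv b"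
      using s1 s2 a4 a by simp
    then have "inv a \<otimes> inv a = a \<otimes> a" using a b c by simp
    then have "a \<otimes> a \<otimes> (a \<otimes> a) = a \<otimes> a \<otimes> (inv a \<otimes> inv a)" by simp
    then show False using a4 a by (simp add: m_assoc)
  next
    case b4: False
    have bc: "b \<otimes> c = c \<otimes> inv b" using fourth_power_normalizing[OF b c b4] n by (simp add: normalizing_def)
    have e1: "(a \<otimes> a \<otimes> a \<otimes> a) \<otimes> (b \<otimes> b \<otimes> b \<otimes> b) = \<one>"
    proof (rule ccontr)
      assume "\<not> ?thesis"
      then have "\<one> \<otimes> c \<otimes> inv b = inv a \<otimes> inv a \<otimes> c \<otimes> inv b" using s1 bc c by simp
      then have "\<one> = inv a \<otimes> inv a" using a b c by (metis inv_closed m_closed r_cancel one_closed)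
      then have "\<one> = inv a \<otimes> inv a \<otimes> (inv a \<otimes> inv a)" using a by simp
      then have "inv (a \<otimes> a \<otimes> a \<otimes> a) = \<one>" using ia4[symmetric] a by (simp add: m_assoc)
      then show False using a4 a by simp
    qed
    have e2: "inv (a \<otimes> a \<otimes> a \<otimes> a) \<otimes> (b \<otimes> b \<otimes> b \<otimes> b) = \<one>"
    proof (rule ccontr)
      assume "\<not> ?thesis"
      then have "\<one> \<otimes> c \<otimes> inv b = a \<otimes> a \<otimes> c \<otimes> inv b" using s2 bc c by simp
      then have "\<one> = a \<otimes> a" using a b c by (metis inv_closed m_closed r_cancel one_closed)
      then show False using a4 a by simp
    qed
    \<comment> \<open>Now a^8 = 1, so a^2 b has the same nontrivial fourth power as b: this is the
      multiple of b to which the shift still applies.\<close>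
    let ?d = "a \<otimes> a"
    have d: "?d \<in> carrier G" "?d \<otimes> b = b \<otimes> ?d" "?d \<otimes> c = c \<otimes> ?d"
      using a b c ab ac by (simp_all add: m_assoc) (simp_all add: m_assoc[symmetric])
    have a8: "?d \<otimes> ?d \<otimes> ?d \<otimes> ?d = \<one>"
    proof -
      have "b \<otimes> b \<otimes> b \<otimes> b = a \<otimes> a \<otimes> a \<otimes> a" using e2 a b by (metis inv_inv inv_closed inv_equality m_closed)
      then show ?thesis using e1 a by (simp add: m_assoc)
    qed
    have "b \<otimes> c = inv ?d \<otimes> inv ?d \<otimes> c \<otimes> inv b"
      using normalizing_shift[OF d(1) b c d(2,3) fourth_power_normalizing n] fourth_power_mult[OF d(1) b d(2)] a8 b4 a b c by simp
    then have "\<one> \<otimes> c \<otimes> inv b = inv ?d \<otimes> inv ?d \<otimes> c \<otimes> inv b" using bc c by simp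
    then have "\<one> = inv ?d \<otimes> inv ?d" using a b c by (metis inv_closed m_closed r_cancel one_closed)
    then have "inv (a \<otimes> a \<otimes> a \<otimes> a) = \<one>" using a by (simp add: inv_mult_group m_assoc)
    then show False using a4 a by simp
  qed
qed

text \<open>When b^4 = 1 nothing is known about b directly, but a b has the fourth power of a. Then
  t inverts both a and a b, and therefore b.\<close>

lemma outside_inverts:
  assumes a: "a \<in> carrier G" and b: "b \<in> carrier G" and t: "t \<in> carrier G"
    and a4: "a \<otimes> a \<otimes> a \<otimes> a \<noteq> \<one>" and ab: "a \<otimes> b = b \<otimes> a" and at: "a \<otimes> t \<noteq> t \<otimes> a"
  shows "b \<otimes> t = t \<otimes> inv b"
proof (cases "b \<otimes> b \<otimes> b \<otimes> b = \<one>")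
  case False
  then show ?thesis using fourth_power_normalizing[OF b t False] centralizer_abelian[OF b a t False] ab at
    by (auto simp: normalizing_def)
next
  case True
  let ?w = "a \<otimes> b"
  have w4: "?w \<otimes> ?w \<otimes> ?w \<otimes> ?w \<noteq> \<one>" using fourth_power_mult[OF a b ab] True a4 a by simp
  have w: "?w \<in> carrier G" using a b by simp
  have wa: "?w \<otimes> a = a \<otimes> ?w" using a b by (simp add: m_assoc ab[symmetric])
  have ai: "a \<otimes> t = t \<otimes> inv a" using fourth_power_normalizing[OF a t a4] at by (simp add: normalizing_def)
  have "?w \<otimes> t \<noteq> t \<otimes> ?w" using centralizer_abelian[OF w a t w4 wa] at by auto
  then have "?w \<otimes> t = t \<otimes> inv ?w" using fourth_power_normalizing[OF w t w4] by (simp add: normalizing_def)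
  moreover have "inv a \<otimes> inv b = inv b \<otimes> inv a" using ab a b by (metis inv_mult_group)
  ultimately have "b \<otimes> t \<otimes> inv a = t \<otimes> inv b \<otimes> inv a"
    using a b t ai by (simp add: ab inv_mult_group m_assoc)
  then show ?thesis using a b t by simp
qed

lemma inverting_subgroup_four:
  assumes a: "a \<in> carrier G" and a4: "a \<otimes> a \<otimes> a \<otimes> a \<noteq> \<one>" and t: "t \<in> carrier G" "a \<otimes> t \<noteq> t \<otimes> a"
  shows "inverting_subgroup {b \<in> carrier G. a \<otimes> b = b \<otimes> a}" (is "inverting_subgroup ?B")
proof -
  have ai: "a \<otimes> g = g \<otimes> inv a" if "g \<in> carrier G - ?B" for g
    using outside_inverts[OF a a _ a4 refl, of g] that by blast
  have "subgroup ?B G"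
  proof
    fix x y assume xy: "x \<in> ?B" "y \<in> ?B"
    then have c: "x \<in> carrier G" "y \<in> carrier G" and ax: "a \<otimes> x = x \<otimes> a" and ay: "a \<otimes> y = y \<otimes> a" by blast+
    have "a \<otimes> (x \<otimes> y) = a \<otimes> x \<otimes> y" using a c by (simp add: m_assoc)
    also have "a \<otimes> x = x \<otimes> a" by (rule ax)
    also have "x \<otimes> a \<otimes> y = x \<otimes> (a \<otimes> y)" using a c by (simp add: m_assoc)
    also have "a \<otimes> y = y \<otimes> a" by (rule ay)
    finally have "a \<otimes> (x \<otimes> y) = x \<otimes> y \<otimes> a" using a c by (simp add: m_assoc)
    then show "x \<otimes> y \<in> ?B" using m_closed[OF c] by blast
  next
    fix x assume "x \<in> ?B"
    then have "x \<in> carrier G" "x \<otimes> a = a \<otimes> x" by auto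
    then have "inv x \<otimes> a = a \<otimes> inv x" using a by (intro commute_inv)
    then show "inv x \<in> ?B" using inv_closed[OF \<open>x \<in> carrier G\<close>] by simp
  next
    show "\<one> \<in> ?B" using a by simp
  qed blast
  moreover have "b \<otimes> c = c \<otimes> b" if "b \<in> ?B" "c \<in> ?B" for b c
    using centralizer_abelian[OF a _ _ a4, of b c] that by blast
  moreover have "g \<otimes> h \<in> ?B" if g: "g \<in> carrier G - ?B" and h: "h \<in> carrier G - ?B" for g h
  proof -
    have c: "g \<in> carrier G" "h \<in> carrier G" using g h by blast+
    have "a \<otimes> (g \<otimes> h) = (a \<otimes> g) \<otimes> h" using a c by (simp add: m_assoc)
    also have "a \<otimes> g = g \<otimes> inv a" using ai[OF g] .
    also have "g \<otimes> inv a \<otimes> h = g \<otimes> inv a \<otimes> (h \<otimes> inv a) \<otimes> a" using a c by (simp add: m_assoc)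
    also have "h \<otimes> inv a = a \<otimes> h" using ai[OF h] by (rule sym)
    finally have "a \<otimes> (g \<otimes> h) = g \<otimes> h \<otimes> a" using a c by (simp add: m_assoc)
    then show ?thesis using m_closed[OF c] by blast
  qed
  moreover have "b \<otimes> g = g \<otimes> inv b" if "b \<in> ?B" "g \<in> carrier G - ?B" for b g
    using outside_inverts[OF a _ _ a4, of b g] that by blast
  ultimately show ?thesis unfolding inverting_subgroup_def using t by blast
qed

section \<open>Squares in groups of exponent four\<close>

lemma sq_central_involution:
  assumes exp4: "\<And>x. x \<in> carrier G \<Longrightarrow> x \<otimes> x \<otimes> (x \<otimes> x) = \<one>"
    and a: "a \<in> carrier G" and c: "c \<in> carrier G" and cc: "c \<otimes> c = \<one>"
  shows "a \<otimes> a \<otimes> c = c \<otimes> (a \<otimes> a)"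
proof (cases "a \<otimes> a = \<one>")
  case False
  have ic: "inv c = c" using c cc by (metis inv_equality)
  have ia: "inv a \<otimes> inv a = a \<otimes> a" using inv_equality[OF exp4[OF a]] inv_mult_group[OF a a] a by simp
  \<comment> \<open>The six-term property is used with b = a: the first four words become c a^2, the
    last two become c.\<close>
  have 2: "a \<otimes> a \<otimes> c \<noteq> c" using False a c by simp
  have 3: "c \<otimes> inv a \<otimes> inv a = c \<otimes> (a \<otimes> a)" "c \<otimes> a \<otimes> a = c \<otimes> (a \<otimes> a)" using ia a c by (simp_all add: m_assoc)
  from six[OF a a c False False] show ?thesis unfolding ic 3 using 2 a c by auto
qed (use c in auto)

lemma sq_central:
  assumes exp4: "\<And>x. x \<in> carrier G \<Longrightarrow> x \<otimes> x \<otimes> (x \<otimes> x) = \<one>"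
    and a: "a \<in> carrier G" and c: "c \<in> carrier G"
  shows "a \<otimes> a \<otimes> c = c \<otimes> (a \<otimes> a)"
proof (cases "a \<otimes> a = \<one>")
  case False
  have ia: "inv a \<otimes> inv a = a \<otimes> a" using inv_equality[OF exp4[OF a]] inv_mult_group[OF a a] a by simp
  have "a \<otimes> a \<otimes> c = c \<otimes> (a \<otimes> a) \<or> a \<otimes> a \<otimes> c = inv c \<otimes> (a \<otimes> a) \<or> a \<otimes> a \<otimes> c = inv c"
  proof -
    have 3: "x \<otimes> inv a \<otimes> inv a = x \<otimes> (a \<otimes> a)" "x \<otimes> a \<otimes> a = x \<otimes> (a \<otimes> a)" if "x \<in> carrier G" for x
      using ia a that by (simp_all add: m_assoc)
    show ?thesis using six[OF a a c False False] unfolding 3[OF c] 3[OF inv_closed[OF c]] using a c by auto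
  qed
  then show ?thesis
  proof (elim disjE)
    assume h: "a \<otimes> a \<otimes> c = inv c"
    have "c \<otimes> (a \<otimes> a) = c \<otimes> (a \<otimes> a \<otimes> c) \<otimes> inv c" using a c by (simp add: m_assoc)
    also have "\<dots> = inv c" unfolding h using c by simp
    finally show ?thesis using h by simp
  next
    assume h: "a \<otimes> a \<otimes> c = inv c \<otimes> (a \<otimes> a)"
    \<comment> \<open>In this case a^2 c has square 1, so it commutes with a^2 by
      \<open>sq_central_involution\<close>, and a^2 can be cancelled.\<close>
    let ?e = "a \<otimes> a \<otimes> c"
    have e: "?e \<in> carrier G" using a c by simp
    have "?e \<otimes> ?e = inv c \<otimes> (a \<otimes> a \<otimes> (a \<otimes> a)) \<otimes> c" using a c by (subst h) (simp add: m_assoc)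
    then have "?e \<otimes> ?e = \<one>" using exp4[OF a] c by simp
    then have "a \<otimes> a \<otimes> ?e = ?e \<otimes> (a \<otimes> a)" using sq_central_involution[OF exp4] a e by blast
    also have "?e \<otimes> (a \<otimes> a) = a \<otimes> a \<otimes> (c \<otimes> (a \<otimes> a))" using a c by (simp add: m_assoc)
    finally have "a \<otimes> a \<otimes> (a \<otimes> a \<otimes> c) = a \<otimes> a \<otimes> (c \<otimes> (a \<otimes> a))" .
    then show ?thesis using a c l_cancel[of "a \<otimes> a" "a \<otimes> a \<otimes> c" "c \<otimes> (a \<otimes> a)"] by simp
  qed
qed (use c in auto)

end

section \<open>Groups of exponent four with central squares\<close>

locale central_square_group = group +
  assumes exp4: "x \<in> carrier G \<Longrightarrow> x \<otimes> x \<otimes> (x \<otimes> x) = \<one>"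
    and sq_central: "x \<in> carrier G \<Longrightarrow> g \<in> carrier G \<Longrightarrow> x \<otimes> x \<otimes> g = g \<otimes> (x \<otimes> x)"
begin

lemma inv_exp4: "x \<in> carrier G \<Longrightarrow> inv x = x \<otimes> (x \<otimes> x)"
  using exp4[of x] by (metis inv_equality m_assoc m_closed)

definition Om where "Om = {z \<in> carrier G. z \<otimes> z = \<one> \<and> (\<forall>g\<in>carrier G. z \<otimes> g = g \<otimes> z)}"

definition com where "com x y = inv x \<otimes> inv y \<otimes> x \<otimes> y"

lemma Om_carrier: "z \<in> Om \<Longrightarrow> z \<in> carrier G" by (simp add: Om_def)
lemma Om_sq: "z \<in> Om \<Longrightarrow> z \<otimes> z = \<one>" by (simp add: Om_def)
lemma Om_comm: "z \<in> Om \<Longrightarrow> g \<in> carrier G \<Longrightarrow> z \<otimes> g = g \<otimes> z" by (simp add: Om_def)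
lemma Om_one: "\<one> \<in> Om" by (simp add: Om_def)
lemma Om_lcomm:
  assumes z: "z \<in> Om" and g: "g \<in> carrier G" and h: "h \<in> carrier G"
  shows "g \<otimes> (z \<otimes> h) = z \<otimes> (g \<otimes> h)"
proof -
  have "g \<otimes> (z \<otimes> h) = (g \<otimes> z) \<otimes> h" using Om_carrier[OF z] g h by (simp add: m_assoc)
  also have "g \<otimes> z = z \<otimes> g" using Om_comm[OF z g] by (rule sym)
  finally show ?thesis using Om_carrier[OF z] g h by (simp add: m_assoc)
qed

lemma Om_cancel: assumes z: "z \<in> Om" and h: "h \<in> carrier G" shows "z \<otimes> (z \<otimes> h) = h"
proof -
  have "z \<otimes> (z \<otimes> h) = (z \<otimes> z) \<otimes> h" using Om_carrier[OF z] h by (simp add: m_assoc)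
  then show ?thesis using Om_sq[OF z] h by simp
qed

lemma Om_mult: assumes z: "z \<in> Om" and w: "w \<in> Om" shows "z \<otimes> w \<in> Om"
proof -
  note c = Om_carrier[OF z] Om_carrier[OF w]
  have "z \<otimes> w \<otimes> (z \<otimes> w) = z \<otimes> (w \<otimes> (z \<otimes> w))" using c by (simp add: m_assoc)
  also have "w \<otimes> (z \<otimes> w) = z \<otimes> (w \<otimes> w)" using z c by (intro Om_lcomm)
  also have "z \<otimes> (z \<otimes> (w \<otimes> w)) = w \<otimes> w" using z c by (intro Om_cancel) auto
  finally have "z \<otimes> w \<otimes> (z \<otimes> w) = \<one>" using Om_sq[OF w] by simp
  moreover have "z \<otimes> w \<otimes> g = g \<otimes> (z \<otimes> w)" if g: "g \<in> carrier G" for g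
  proof -
    have "z \<otimes> w \<otimes> g = z \<otimes> (w \<otimes> g)" using g c by (simp add: m_assoc)
    also have "w \<otimes> g = g \<otimes> w" using w g by (rule Om_comm)
    also have "z \<otimes> (g \<otimes> w) = g \<otimes> (z \<otimes> w)" using Om_lcomm[OF z g c(2)] by (rule sym)
    finally show ?thesis .
  qed
  ultimately show ?thesis unfolding Om_def using m_closed[OF c] by blast
qed

lemma sq_Om: "x \<in> carrier G \<Longrightarrow> x \<otimes> x \<in> Om"
  by (auto simp: Om_def exp4 intro: sq_central)

text \<open>Inverses are cubes here, so after moving the central squares to the front the commutator
  is a product of three squares. This is how it lands in \<open>Om\<close>.\<close>

lemma com_eq:
  assumes [simp]: "x \<in> carrier G" "y \<in> carrier G"
  shows "com x y = (x \<otimes> x) \<otimes> ((y \<otimes> y) \<otimes> (x \<otimes> y \<otimes> (x \<otimes> y)))"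
proof -
  have "com x y = (x \<otimes> x) \<otimes> x \<otimes> ((y \<otimes> y) \<otimes> y) \<otimes> x \<otimes> y"
    unfolding com_def by (simp add: inv_exp4 m_assoc)
  also have "\<dots> = (x \<otimes> x) \<otimes> (x \<otimes> ((y \<otimes> y) \<otimes> (y \<otimes> (x \<otimes> y))))" by (simp add: m_assoc)
  also have "\<dots> = (x \<otimes> x) \<otimes> ((y \<otimes> y) \<otimes> (x \<otimes> (y \<otimes> (x \<otimes> y))))"
    using Om_lcomm[OF sq_Om[of y], of x "y \<otimes> (x \<otimes> y)"] by simp
  finally show ?thesis by (simp add: m_assoc)
qed

lemma com_Om: "x \<in> carrier G \<Longrightarrow> y \<in> carrier G \<Longrightarrow> com x y \<in> Om"
  by (simp add: com_eq Om_mult sq_Om)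

lemma com_closed [simp]: "x \<in> carrier G \<Longrightarrow> y \<in> carrier G \<Longrightarrow> com x y \<in> carrier G"
  by (simp add: com_def)

lemma com_swap: "x \<in> carrier G \<Longrightarrow> y \<in> carrier G \<Longrightarrow> x \<otimes> y = y \<otimes> x \<otimes> com x y"
  by (simp add: com_def m_assoc)

lemma com_one_iff: "x \<in> carrier G \<Longrightarrow> y \<in> carrier G \<Longrightarrow> com x y = \<one> \<longleftrightarrow> x \<otimes> y = y \<otimes> x"
  by (metis com_swap[of x y] com_closed m_closed r_cancel_one' r_one l_cancel one_closed)

text \<open>Commutators are central, so moving w past y and then past x collects both of them.
  Together with \<open>com_sym\<close> this makes \<open>com\<close> a symmetric bilinear map into
  \<open>Om\<close>.\<close>

lemma com_mult_left:
  assumes [simp]: "x \<in> carrier G" "y \<in> carrier G" "w \<in> carrier G"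
  shows "com (x \<otimes> y) w = com x w \<otimes> com y w"
proof -
  have "w \<otimes> (x \<otimes> y) \<otimes> com (x \<otimes> y) w = x \<otimes> (y \<otimes> w)" by (subst com_swap[of "x \<otimes> y" w, symmetric]) (simp_all add: m_assoc)
  also have "\<dots> = (x \<otimes> w) \<otimes> y \<otimes> com y w" by (subst com_swap[of y w]) (simp_all add: m_assoc)
  also have "\<dots> = w \<otimes> x \<otimes> (com x w \<otimes> y) \<otimes> com y w" by (subst com_swap[of x w]) (simp_all add: m_assoc)
  also have "\<dots> = w \<otimes> (x \<otimes> y) \<otimes> (com x w \<otimes> com y w)"
    using Om_comm[OF com_Om[of x w], of y] by (simp add: m_assoc)
  finally show ?thesis by simp
qed

lemma com_sym: assumes [simp]: "x \<in> carrier G" "y \<in> carrier G" shows "com y x = com x y"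
proof -
  have "inv (com x y) = com y x" by (simp add: com_def inv_mult_group m_assoc)
  moreover have "inv (com x y) = com x y" using Om_sq[OF com_Om[of x y]] by (metis assms com_closed inv_equality)
  ultimately show ?thesis by simp
qed

lemma com_mult_right:
  assumes [simp]: "x \<in> carrier G" "y \<in> carrier G" "w \<in> carrier G"
  shows "com w (x \<otimes> y) = com w x \<otimes> com w y"
  using com_mult_left[of x y w] com_sym[of "x \<otimes> y" w] com_sym[of x w] com_sym[of y w] by simp

lemma com_self [simp]: "x \<in> carrier G \<Longrightarrow> com x x = \<one>" by (simp add: com_one_iff)

text \<open>Squaring is a quadratic map into \<open>Om\<close> with polar form
  \<open>com\<close>.\<close>

lemma sq_mult:
  assumes [simp]: "x \<in> carrier G" "y \<in> carrier G"
  shows "x \<otimes> y \<otimes> (x \<otimes> y) = x \<otimes> x \<otimes> (y \<otimes> y) \<otimes> com x y"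
proof -
  have "x \<otimes> y \<otimes> (x \<otimes> y) = x \<otimes> (y \<otimes> x) \<otimes> y" by (simp add: m_assoc)
  also have "\<dots> = x \<otimes> (x \<otimes> y \<otimes> com y x) \<otimes> y" by (subst com_swap[of y x]) simp_all
  also have "\<dots> = x \<otimes> (x \<otimes> y) \<otimes> (com x y \<otimes> y)" by (subst com_sym[of x y]) (simp_all add: m_assoc)
  finally show ?thesis using Om_comm[OF com_Om[of x y], of y] by (simp add: m_assoc)
qed

lemma com_inv_left: "x \<in> carrier G \<Longrightarrow> y \<in> carrier G \<Longrightarrow> com (inv x) y = com x y"
  using Om_sq[OF com_Om[of x y]] by (simp add: inv_exp4 com_mult_left)

lemma com_Om_left: "z \<in> Om \<Longrightarrow> y \<in> carrier G \<Longrightarrow> com z y = \<one>"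
  using Om_comm Om_carrier by (simp add: com_one_iff)

lemma com_Om_right: "z \<in> Om \<Longrightarrow> y \<in> carrier G \<Longrightarrow> com y z = \<one>"
  using com_Om_left[of z y] com_sym[of z y] Om_carrier by simp

end

locale exponent_four_six_group = six_group + central_square_group
begin

text \<open>An inverse is the element times its own central square. Dividing the first four words by
  c a b therefore gives the four values of the commutator, while the last two words collapse to an
  equality of two squares.\<close>

lemma six_com:
  assumes [simp]: "a \<in> carrier G" "b \<in> carrier G" "c \<in> carrier G" and n: "a \<otimes> a \<noteq> \<one>" "b \<otimes> b \<noteq> \<one>"
  shows "com (a \<otimes> b) c = \<one> \<or> com (a \<otimes> b) c = c \<otimes> c \<or> com (a \<otimes> b) c = a \<otimes> a \<otimes> (b \<otimes> b) \<or>
    com (a \<otimes> b) c = c \<otimes> c \<otimes> (a \<otimes> a \<otimes> (b \<otimes> b)) \<or> b \<otimes> b = c \<otimes> c \<or> a \<otimes> a = c \<otimes> c"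
proof -
  let ?z = "com (a \<otimes> b) c"
  let ?A = "a \<otimes> a" let ?B = "b \<otimes> b" let ?C = "c \<otimes> c"
  have ab: "inv a \<otimes> inv b = (a \<otimes> b) \<otimes> (?A \<otimes> ?B)"
  proof -
    have "inv a \<otimes> inv b = a \<otimes> (?A \<otimes> (b \<otimes> ?B))" by (simp add: inv_exp4 m_assoc)
    also have "\<dots> = a \<otimes> (b \<otimes> (?A \<otimes> ?B))" using Om_lcomm[OF sq_Om[of a], of b "?B"] by simp
    finally show ?thesis by (simp add: m_assoc)
  qed
  have k: "a \<otimes> b \<otimes> c = (c \<otimes> (a \<otimes> b)) \<otimes> ?z" by (rule com_swap) simp_all
  have ic: "inv c \<otimes> w = (c \<otimes> w) \<otimes> ?C" if "w \<in> carrier G" for w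
    using that Om_comm[OF sq_Om[of c], of w] by (simp add: inv_exp4 m_assoc)
  have i2: "inv c \<otimes> inv c = ?C" "inv a \<otimes> inv a = ?A" "inv b \<otimes> inv b = ?B"
    using inv_equality[OF exp4] inv_mult_group by simp_all
  from six[of a b c, OF assms(1-3) n] show ?thesis
  proof (elim disjE)
    assume "a \<otimes> b \<otimes> c = c \<otimes> a \<otimes> b"
    then have "(c \<otimes> (a \<otimes> b)) \<otimes> ?z = (c \<otimes> (a \<otimes> b)) \<otimes> \<one>" by (subst k[symmetric]) (simp add: m_assoc)
    then show ?thesis by (subst (asm) l_cancel) auto
  next
    assume "a \<otimes> b \<otimes> c = inv c \<otimes> a \<otimes> b"
    then have "(c \<otimes> (a \<otimes> b)) \<otimes> ?z = (c \<otimes> (a \<otimes> b)) \<otimes> ?C" by (subst k[symmetric], subst ic[symmetric]) (simp_all add: m_assoc)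
    then show ?thesis by (subst (asm) l_cancel) auto
  next
    assume "a \<otimes> b \<otimes> c = c \<otimes> inv a \<otimes> inv b"
    then have "(c \<otimes> (a \<otimes> b)) \<otimes> ?z = c \<otimes> (inv a \<otimes> inv b)" by (subst k[symmetric]) (simp add: m_assoc)
    then have "(c \<otimes> (a \<otimes> b)) \<otimes> ?z = (c \<otimes> (a \<otimes> b)) \<otimes> (?A \<otimes> ?B)" unfolding ab by (simp add: m_assoc)
    then show ?thesis by (subst (asm) l_cancel) auto
  next
    assume "a \<otimes> b \<otimes> c = inv c \<otimes> inv a \<otimes> inv b"
    then have "(c \<otimes> (a \<otimes> b)) \<otimes> ?z = inv c \<otimes> (inv a \<otimes> inv b)" by (subst k[symmetric]) (simp add: m_assoc)
    also have "\<dots> = inv c \<otimes> ((a \<otimes> b) \<otimes> (?A \<otimes> ?B))" unfolding ab ..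
    also have "\<dots> = (inv c \<otimes> (a \<otimes> b)) \<otimes> (?A \<otimes> ?B)" by (simp add: m_assoc)
    also have "\<dots> = (c \<otimes> (a \<otimes> b)) \<otimes> (?C \<otimes> (?A \<otimes> ?B))" by (subst ic) (simp_all add: m_assoc)
    finally show ?thesis by (subst (asm) l_cancel) auto
  next
    assume "a \<otimes> b \<otimes> c = a \<otimes> inv b \<otimes> inv c"
    then have h: "b \<otimes> c = inv b \<otimes> inv c" by (simp add: m_assoc)
    have "?B = b \<otimes> (b \<otimes> c) \<otimes> inv c" by (simp add: m_assoc)
    also have "\<dots> = ?C" unfolding h using i2 by (simp add: m_assoc)
    finally show ?thesis by simp
  next
    assume h: "a \<otimes> b \<otimes> c = inv a \<otimes> b \<otimes> inv c"
    have "?A \<otimes> b = a \<otimes> (a \<otimes> b \<otimes> c) \<otimes> inv c" by (simp add: m_assoc)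
    also have "\<dots> = b \<otimes> ?C" unfolding h using i2 by (simp add: m_assoc)
    finally have "b \<otimes> ?A = b \<otimes> ?C" using Om_comm[OF sq_Om[of a], of b] by simp
    then show ?thesis by simp
  qed
qed

section \<open>Linear functionals on the central involutions\<close>

lemma Om_mult_one_iff: "z \<in> Om \<Longrightarrow> w \<in> Om \<Longrightarrow> z \<otimes> w = \<one> \<longleftrightarrow> z = w"
  using Om_cancel[of z w] Om_carrier[of z] Om_carrier[of w] Om_sq[of z] by auto

text \<open>A homomorphism from \<open>Om\<close> to the group of order two, with truth values as
  its elements and exclusive or as addition, so that linear algebra becomes propositional
  reasoning.\<close>

definition parity where
  "parity \<chi> \<longleftrightarrow> (\<forall>z\<in>Om. \<forall>w\<in>Om. \<chi> (z \<otimes> w) \<longleftrightarrow> \<chi> z \<noteq> \<chi> w)"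

lemma parity_mult: "parity \<chi> \<Longrightarrow> z \<in> Om \<Longrightarrow> w \<in> Om \<Longrightarrow> \<chi> (z \<otimes> w) \<longleftrightarrow> \<chi> z \<noteq> \<chi> w"
  by (simp add: parity_def)

lemma parity_one: "parity \<chi> \<Longrightarrow> \<not> \<chi> \<one>"
  using parity_mult[of \<chi> \<one> \<one>] Om_one by simp

lemma parity_add: "parity \<chi> \<Longrightarrow> parity \<psi> \<Longrightarrow> parity (\<lambda>z. \<chi> z \<noteq> \<psi> z)"
  by (auto simp: parity_def)

text \<open>Take a maximal multiplicatively closed M that contains L and avoids v; inverses are
  automatic since elements of \<open>Om\<close> have square 1. Maximality gives M index two, and the
  functional is nonmembership in M.\<close>

lemma exists_parity:
  assumes L: "L \<subseteq> Om" "\<one> \<in> L" "\<And>z w. z \<in> L \<Longrightarrow> w \<in> L \<Longrightarrow> z \<otimes> w \<in> L" and v: "v \<in> Om" "v \<notin> L"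
  shows "\<exists>\<chi>. parity \<chi> \<and> \<chi> v \<and> (\<forall>z\<in>L. \<not> \<chi> z)"
proof -
  define F where "F = {M. L \<subseteq> M \<and> M \<subseteq> Om \<and> (\<forall>z\<in>M. \<forall>w\<in>M. z \<otimes> w \<in> M) \<and> v \<notin> M}"
  have "L \<in> F" unfolding F_def using L v by blast
  then have ne: "F \<noteq> {}" by blast
  have "\<exists>M\<in>F. \<forall>P\<in>F. M \<subseteq> P \<longrightarrow> P = M"
  proof (rule subset_Zorn_nonempty[OF ne])
    fix C assume C: "C \<noteq> {}" "subset.chain F C"
    have "z \<otimes> w \<in> \<Union>C" if zw: "z \<in> \<Union>C" "w \<in> \<Union>C" for z w
    proof -
      from zw obtain P Y where PY: "P \<in> C" "Y \<in> C" "z \<in> P" "w \<in> Y" by blast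
      then have "P \<subseteq> Y \<or> Y \<subseteq> P" using C(2) by (auto simp: subset.chain_def)
      then obtain W where W: "W \<in> C" "z \<in> W" "w \<in> W" using PY by blast
      then have "W \<in> F" using C(2) unfolding subset.chain_def by blast
      then show ?thesis using W unfolding F_def by blast
    qed
    moreover have CF: "C \<subseteq> F" using C(2) by (simp add: subset.chain_def)
    moreover obtain P where "P \<in> C" using C(1) by blast
    then have "L \<subseteq> \<Union>C" using CF unfolding F_def by blast
    moreover have "\<Union>C \<subseteq> Om" "v \<notin> \<Union>C" using CF unfolding F_def by blast+
    ultimately show "\<Union>C \<in> F" unfolding F_def by blast
  qed
  then obtain M where MF: "M \<in> F" and max: "\<And>P. P \<in> F \<Longrightarrow> M \<subseteq> P \<Longrightarrow> P = M" by blast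
  then have M: "L \<subseteq> M" "M \<subseteq> Om" "\<And>z w. z \<in> M \<Longrightarrow> w \<in> M \<Longrightarrow> z \<otimes> w \<in> M" "v \<notin> M"
    unfolding F_def by blast+
  \<comment> \<open>The union of M and x M would be a larger member of F unless it contains v; and v
    = x m means v x = m.\<close>
  have cov: "v \<otimes> x \<in> M" if x: "x \<in> Om" "x \<notin> M" for x
  proof (rule ccontr)
    assume n: "v \<otimes> x \<notin> M"
    let ?P = "M \<union> (\<lambda>m. x \<otimes> m) ` M"
    have one: "\<one> \<in> M" using L M by blast
    have "x \<otimes> \<one> \<in> ?P" using one by blast
    then have xP: "x \<in> ?P" using x Om_carrier by simp
    have mc: "m \<in> carrier G" if "m \<in> M" for m using that M Om_carrier by blast
    have xc: "x \<in> carrier G" using x Om_carrier by blast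
    have "z \<otimes> w \<in> ?P" if zw: "z \<in> ?P" "w \<in> ?P" for z w
    proof -
      from zw consider "z \<in> M" "w \<in> M" | m where "z = x \<otimes> m" "m \<in> M" "w \<in> M"
        | m where "w = x \<otimes> m" "m \<in> M" "z \<in> M" | m n where "z = x \<otimes> m" "w = x \<otimes> n" "m \<in> M" "n \<in> M"
        by blast
      then show ?thesis
      proof cases
        case 1 then show ?thesis using M by blast
      next
        case (2 m)
        then have "z \<otimes> w = x \<otimes> (m \<otimes> w)" using mc xc by (simp add: m_assoc)
        then show ?thesis using 2 M(3)[of m w] by blast
      next
        case (3 m)
        then have "z \<otimes> w = x \<otimes> (z \<otimes> m)" using Om_lcomm[OF x(1) mc mc, of z m] by simp
        then show ?thesis using 3 M(3)[of z m] by blast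
      next
        case (4 m n)
        have "x \<otimes> m \<otimes> (x \<otimes> n) = x \<otimes> (m \<otimes> (x \<otimes> n))" using 4 mc xc by (simp add: m_assoc)
        also have "m \<otimes> (x \<otimes> n) = x \<otimes> (m \<otimes> n)" using 4 mc x by (intro Om_lcomm) auto
        also have "x \<otimes> (x \<otimes> (m \<otimes> n)) = m \<otimes> n" using 4 mc x by (intro Om_cancel) auto
        finally show ?thesis using 4 M(3)[of m n] by simp
      qed
    qed
    moreover have "v \<notin> ?P"
    proof
      assume "v \<in> ?P"
      then obtain m where m: "m \<in> M" "v = x \<otimes> m" using M by blast
      have "v \<otimes> x = x \<otimes> v" using Om_comm[OF v(1) xc] .
      also have "\<dots> = m" using m mc x Om_cancel by simp
      finally show False using n m by simp
    qed
    moreover have "?P \<subseteq> Om" using M x Om_mult by blast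
    ultimately have "?P \<in> F" unfolding F_def using M(1) by blast
    then have "?P = M" using max by blast
    then show False using xP x by blast
  qed
  have canc: "w \<in> M" if "z \<in> M" "w \<in> Om" "z \<otimes> w \<in> M" for z w
  proof -
    have "z \<otimes> (z \<otimes> w) = w" using Om_cancel that M(2) Om_carrier by blast
    then show ?thesis using M(3)[OF that(1,3)] by simp
  qed
  have "parity (\<lambda>z. z \<notin> M)"
    unfolding parity_def
  proof (intro ballI)
    fix z w assume zw: "z \<in> Om" "w \<in> Om"
    have c: "z \<otimes> w \<in> M" if "z \<notin> M" "w \<notin> M"
    proof -
      have vc: "v \<in> carrier G" "z \<in> carrier G" "w \<in> carrier G" using v zw Om_carrier by auto
      have "(v \<otimes> z) \<otimes> (v \<otimes> w) \<in> M" using cov zw that M(3) by blast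
      moreover have "(v \<otimes> z) \<otimes> (v \<otimes> w) = v \<otimes> (z \<otimes> (v \<otimes> w))" using vc by (simp add: m_assoc)
      moreover have "z \<otimes> (v \<otimes> w) = v \<otimes> (z \<otimes> w)" using v vc by (intro Om_lcomm)
      moreover have "v \<otimes> (v \<otimes> (z \<otimes> w)) = z \<otimes> w" using v vc by (intro Om_cancel) auto
      ultimately show ?thesis by simp
    qed
    have d: "z \<in> M \<Longrightarrow> z \<otimes> w \<in> M \<longleftrightarrow> w \<in> M" using canc M(3) zw by blast
    have "w \<otimes> z = z \<otimes> w" using Om_comm[OF zw(2) Om_carrier[OF zw(1)]] .
    then have e: "w \<in> M \<Longrightarrow> z \<otimes> w \<in> M \<longleftrightarrow> z \<in> M" using canc[of w z] M(3)[of z w] zw by metis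
    show "z \<otimes> w \<notin> M \<longleftrightarrow> (z \<notin> M) \<noteq> (w \<notin> M)" using c d e by blast
  qed
  then show ?thesis using M by blast
qed

text \<open>With these values on the squares, all four commutator values allowed by
  \<open>six_com\<close> are false, and the equalities between squares are excluded.\<close>

lemma six_parity:
  assumes p: "parity \<chi>" and [simp]: "a \<in> carrier G" "b \<in> carrier G" "c \<in> carrier G"
    and h: "\<chi> (a \<otimes> a)" "\<chi> (b \<otimes> b)" "\<not> \<chi> (c \<otimes> c)"
  shows "\<not> \<chi> (com (a \<otimes> b) c)"
proof -
  have "a \<otimes> a \<noteq> \<one>" "b \<otimes> b \<noteq> \<one>" using h parity_one[OF p] by metis+
  from six_com[of a b c, OF _ _ _ this] h show ?thesis
    using parity_one[OF p] by (auto simp: parity_mult[OF p] sq_Om Om_mult)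
qed

lemmas com_simps = com_mult_left com_mult_right com_Om sq_Om Om_mult sq_mult Om_one

text \<open>If r^2 had value true, multiplying u or v by r would flip the value of its square
  without changing any pairing. So b can be chosen with square of value true and c with square of
  value false, and r, b, c contradict \<open>six_parity\<close>.\<close>

lemma square_parity:
  assumes p: "parity \<chi>" and [simp]: "r \<in> carrier G" "u \<in> carrier G" "v \<in> carrier G"
    and h: "\<not> \<chi> (com r u)" "\<not> \<chi> (com r v)" "\<chi> (com u v)"
  shows "\<not> \<chi> (r \<otimes> r)"
proof
  assume r: "\<chi> (r \<otimes> r)"
  note s = parity_mult[OF p] com_simps h r com_sym[of r u] com_sym[of r v] parity_one[OF p]
  have "\<exists>b\<in>{u, u \<otimes> r}. \<chi> (b \<otimes> b)" by (cases "\<chi> (u \<otimes> u)") (simp_all add: s)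
  then obtain b where b: "b \<in> {u, u \<otimes> r}" "\<chi> (b \<otimes> b)" by blast
  have "\<exists>c\<in>{v, v \<otimes> r}. \<not> \<chi> (c \<otimes> c)" by (cases "\<chi> (v \<otimes> v)") (simp_all add: s)
  then obtain c where c: "c \<in> {v, v \<otimes> r}" "\<not> \<chi> (c \<otimes> c)" by blast
  have bc: "b \<in> carrier G" "c \<in> carrier G" using b c by auto
  have "\<chi> (com (r \<otimes> b) c)" using b(1) c(1) by (auto simp: s)
  then show False using six_parity[OF p _ bc r b(2) c(2)] by simp
qed

text \<open>The six-term property is applied with \<open>c\<close> singular for the quadratic form \<open>\<chi> (x\<^sup>2)\<close>.\<close>

lemma rank_parity_aux:
  assumes p: "parity \<chi>" and [simp]: "c \<in> carrier G" "d \<in> carrier G" "r \<in> carrier G" "s \<in> carrier G"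
    and h: "\<chi> (com c d)" "\<chi> (com r s)" "\<not> \<chi> (com r c)" "\<not> \<chi> (com s c)"
  shows "\<chi> (c \<otimes> c)"
proof (rule ccontr)
  assume n: "\<not> \<chi> (c \<otimes> c)"
  note s = parity_mult[OF p] com_simps h n parity_one[OF p] com_sym[of c d]
  have "\<exists>b\<in>{d, c \<otimes> d}. \<chi> (b \<otimes> b)" by (cases "\<chi> (d \<otimes> d)") (simp_all add: s)
  then obtain b where b: "b \<in> {d, c \<otimes> d}" "\<chi> (b \<otimes> b)" by blast
  have "\<exists>a\<in>{r, s, r \<otimes> s}. \<chi> (a \<otimes> a)" by (cases "\<chi> (r \<otimes> r)"; cases "\<chi> (s \<otimes> s)") (simp_all add: s)
  then obtain a where a: "a \<in> {r, s, r \<otimes> s}" "\<chi> (a \<otimes> a)" by blast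
  have ab: "a \<in> carrier G" "b \<in> carrier G" using a b by auto
  have "\<chi> (com (a \<otimes> b) c)" using b(1) a(1) by (auto simp: s)
  then show False using six_parity[OF p ab _ a(2) b(2) n] by simp
qed

text \<open>Given two orthogonal pairs with nonzero pairing, \<open>rank_parity_aux\<close> makes
  the squares of u, v and r all true. Then u r has square of value false, and
  \<open>six_parity\<close> for u, v and u r contradicts the value of the commutator of u v with u
  r.\<close>

lemma rank_parity:
  assumes p: "parity \<chi>" and [simp]: "u \<in> carrier G" "v \<in> carrier G" "r \<in> carrier G" "s \<in> carrier G"
    and h: "\<chi> (com u v)" "\<not> \<chi> (com r u)" "\<not> \<chi> (com r v)" "\<not> \<chi> (com s u)" "\<not> \<chi> (com s v)"
  shows "\<not> \<chi> (com r s)"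
proof
  assume n: "\<chi> (com r s)"
  note s = parity_mult[OF p] com_simps h n parity_one[OF p]
  have u: "\<chi> (u \<otimes> u)" by (rule rank_parity_aux[OF p, of u v r s]) (simp_all add: h n)
  have v: "\<chi> (v \<otimes> v)" by (rule rank_parity_aux[OF p, of v u r s]) (simp_all add: h n com_sym[of u v])
  have r: "\<chi> (r \<otimes> r)" by (rule rank_parity_aux[OF p, of r s u v]) (simp_all add: h n com_sym[of r u] com_sym[of r v])
  have "\<not> \<chi> (u \<otimes> r \<otimes> (u \<otimes> r))" using u r h(2) com_sym[of r u] by (simp add: s)
  then have "\<not> \<chi> (com (u \<otimes> v) (u \<otimes> r))" by (intro six_parity[OF p]) (simp_all add: u v)
  moreover have "\<chi> (com (u \<otimes> v) (u \<otimes> r))" using h com_sym[of u v] com_sym[of r u] com_sym[of r v] by (simp add: s)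
  ultimately show False by simp
qed

lemma parity_separating:
  assumes a: "a \<in> Om" and b: "b \<in> Om" and e: "e \<in> Om" "e \<notin> {\<one>, a, b, a \<otimes> b}"
  shows "\<exists>\<chi>. parity \<chi> \<and> \<chi> e \<and> \<not> \<chi> a \<and> \<not> \<chi> b"
proof -
  let ?L = "{\<one>, a, b, a \<otimes> b}"
  note c = Om_carrier[OF a] Om_carrier[OF b]
  have ba: "b \<otimes> a = a \<otimes> b" using Om_comm[OF b c(1)] .
  have bab: "b \<otimes> (a \<otimes> b) = a"
  proof -
    have "b \<otimes> (a \<otimes> b) = a \<otimes> (b \<otimes> b)" using Om_lcomm[OF a c(2) c(2)] .
    then show ?thesis using Om_sq[OF b] c by simp
  qed
  have "a \<otimes> b \<otimes> a = b" "a \<otimes> b \<otimes> b = a"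
    using ba Om_cancel[OF a c(2)] Om_sq[OF b] c by (simp_all add: m_assoc)
  note s = this ba bab Om_sq[OF a] Om_sq[OF b] Om_sq[OF Om_mult[OF a b]] Om_cancel[OF a c(2)] c
  have "z \<otimes> w \<in> ?L" if "z \<in> ?L" "w \<in> ?L" for z w
    using that by (elim insertE emptyE) (simp_all add: s)
  moreover have "?L \<subseteq> Om" using a b Om_one Om_mult by simp
  ultimately have "\<exists>\<chi>. parity \<chi> \<and> \<chi> e \<and> (\<forall>z\<in>?L. \<not> \<chi> z)"
    using e by (intro exists_parity) simp_all
  then show ?thesis by blast
qed

text \<open>If the functional found for e misses f and the one found for f misses e, their sum hits
  both.\<close>

lemma parity_separating2:
  assumes a: "a \<in> Om" and b: "b \<in> Om" and e: "e \<in> Om" "e \<notin> {\<one>, a, b, a \<otimes> b}" and f: "f \<in> Om" "f \<notin> {\<one>, a, b, a \<otimes> b}"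
  shows "\<exists>\<chi>. parity \<chi> \<and> \<chi> e \<and> \<chi> f \<and> \<not> \<chi> a \<and> \<not> \<chi> b"
proof -
  obtain \<chi> where 1: "parity \<chi>" "\<chi> e" "\<not> \<chi> a" "\<not> \<chi> b" using parity_separating[OF a b e] by blast
  obtain \<psi> where 2: "parity \<psi>" "\<psi> f" "\<not> \<psi> a" "\<not> \<psi> b" using parity_separating[OF a b f] by blast
  show ?thesis
  proof (cases "\<chi> f \<or> \<psi> e")
    case True then show ?thesis using 1 2 by blast
  next
    case False
    then show ?thesis using 1 2 parity_add[of \<chi> \<psi>] by (intro exI[of _ "\<lambda>z. \<chi> z \<noteq> \<psi> z"]) simp
  qed
qed

text \<open>Translates \<open>square_parity\<close> back into the group: if both elements avoided
  the span of the two commutators, one functional would kill the span and be true on both.\<close>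

lemma square_or_commutator_in_span:
  assumes [simp]: "r \<in> carrier G" "u \<in> carrier G" "v \<in> carrier G"
  shows "r \<otimes> r \<in> {\<one>, com r u, com r v, com r u \<otimes> com r v} \<or> com u v \<in> {\<one>, com r u, com r v, com r u \<otimes> com r v}"
proof (rule ccontr)
  assume n: "\<not> ?thesis"
  have "\<exists>\<chi>. parity \<chi> \<and> \<chi> (r \<otimes> r) \<and> \<chi> (com u v) \<and> \<not> \<chi> (com r u) \<and> \<not> \<chi> (com r v)"
    using n by (intro parity_separating2) (simp_all add: com_Om sq_Om)
  then show False using square_parity[of _ r u v] by auto
qed

text \<open>If q failed to commute with s, some functional would be true on both
  \<open>com p t\<close> and \<open>com q s\<close>. Multiplying s by p, t or both makes it
  orthogonal to p and t without changing its pairing with q, and \<open>rank_parity\<close> is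
  violated by the pairs p, t and q, s.\<close>

lemma central_of_commutes_noncommuting:
  assumes [simp]: "p \<in> carrier G" "t \<in> carrier G" "q \<in> carrier G" "s \<in> carrier G"
    and pt: "com p t \<noteq> \<one>" and q: "com q p = \<one>" "com q t = \<one>"
  shows "com q s = \<one>"
proof (rule ccontr)
  assume n: "com q s \<noteq> \<one>"
  have "\<exists>\<chi>. parity \<chi> \<and> \<chi> (com p t) \<and> \<chi> (com q s) \<and> \<not> \<chi> \<one> \<and> \<not> \<chi> \<one>"
    using n pt by (intro parity_separating2) (simp_all add: com_Om Om_one)
  then obtain \<chi> where p: "parity \<chi>" and h: "\<chi> (com p t)" "\<chi> (com q s)" by blast
  note simps = parity_mult[OF p] com_simps h parity_one[OF p] q com_sym[of p t]
  have "\<exists>s'\<in>{s, s \<otimes> p, s \<otimes> t, s \<otimes> p \<otimes> t}. \<not> \<chi> (com s' p) \<and> \<not> \<chi> (com s' t)"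
    by (cases "\<chi> (com s p)"; cases "\<chi> (com s t)") (simp_all add: simps)
  then obtain s' where s': "s' \<in> {s, s \<otimes> p, s \<otimes> t, s \<otimes> p \<otimes> t}" "\<not> \<chi> (com s' p)" "\<not> \<chi> (com s' t)" by blast
  have "s' \<in> carrier G" using s'(1) by auto
  moreover have "\<chi> (com q s')" using s'(1) by (auto simp: simps)
  ultimately show False using rank_parity[OF p, of p t q s'] h s' q parity_one[OF p] by simp
qed

text \<open>If the three commutators were independent, each of the seven nontrivial products \<open>w\<close> of \<open>u\<close>, \<open>v\<close>, \<open>r\<close>
  would have a functional, in terms of the dual basis \<open>\<chi>1\<close>, \<open>\<chi>2\<close>, \<open>\<chi>3\<close>, that kills the commutators of \<open>w\<close> but not all
  three; by \<open>square_parity\<close> it kills \<open>w\<^sup>2\<close>, and these seven conditions are incompatible.\<close>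

lemma dependent_commutators:
  assumes [simp]: "u \<in> carrier G" "v \<in> carrier G" "r \<in> carrier G"
  shows "com u v = \<one> \<or> com u r = \<one> \<or> com v r = \<one> \<or> com u v = com u r \<or> com u v = com v r \<or> com u r = com v r \<or>
    com u v = com u r \<otimes> com v r"
proof (rule ccontr)
  assume n: "\<not> ?thesis"
  let ?e = "com u v" let ?a = "com u r" let ?b = "com v r"
  have O: "?e \<in> Om" "?a \<in> Om" "?b \<in> Om" by (simp_all add: com_Om)
  note cl = O[THEN Om_carrier]
  have ne: "?a \<noteq> ?e \<otimes> ?b"
  proof
    assume "?a = ?e \<otimes> ?b"
    then have "?a \<otimes> ?b = ?e \<otimes> (?b \<otimes> ?b)" using cl by (simp add: m_assoc)
    then show False using n Om_sq[OF O(3)] cl by simp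
  qed
  have nb: "?b \<noteq> ?e \<otimes> ?a"
  proof
    assume "?b = ?e \<otimes> ?a"
    then have "?b \<otimes> ?a = ?e \<otimes> (?a \<otimes> ?a)" using cl by (simp add: m_assoc)
    then have "?a \<otimes> ?b = ?e" using Om_sq[OF O(2)] cl Om_comm[OF O(3) cl(2)] by simp
    then show False using n by simp
  qed
  obtain \<chi>1 where 1: "parity \<chi>1" "\<chi>1 ?e" "\<not> \<chi>1 ?a" "\<not> \<chi>1 ?b"
    using parity_separating[OF O(2) O(3) O(1)] n by auto
  obtain \<chi>2 where 2: "parity \<chi>2" "\<chi>2 ?a" "\<not> \<chi>2 ?e" "\<not> \<chi>2 ?b"
    using parity_separating[OF O(1) O(3) O(2)] n ne by auto
  obtain \<chi>3 where 3: "parity \<chi>3" "\<chi>3 ?b" "\<not> \<chi>3 ?e" "\<not> \<chi>3 ?a"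
    using parity_separating[OF O(1) O(2) O(3)] n nb by auto
  note sm = parity_mult[OF 1(1)] parity_mult[OF 2(1)] parity_mult[OF 3(1)] 1 2 3 com_simps
    com_sym[of u v] com_sym[of u r] com_sym[of v r]
    parity_one[OF 1(1)] parity_one[OF 2(1)] parity_one[OF 3(1)]
  have "\<not> \<chi>3 (u \<otimes> u)" by (rule square_parity[OF 3(1), of u v r]) (simp_all add: sm)
  moreover have "\<not> \<chi>2 (v \<otimes> v)" by (rule square_parity[OF 2(1), of v u r]) (simp_all add: sm)
  moreover have "\<not> \<chi>1 (r \<otimes> r)" by (rule square_parity[OF 1(1), of r u v]) (simp_all add: sm)
  moreover have "\<not> (\<chi>2 (u \<otimes> v \<otimes> (u \<otimes> v)) \<noteq> \<chi>3 (u \<otimes> v \<otimes> (u \<otimes> v)))"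
    by (rule square_parity[OF parity_add[OF 2(1) 3(1)], of "u \<otimes> v" u r]) (simp_all add: sm)
  moreover have "\<not> (\<chi>1 (u \<otimes> r \<otimes> (u \<otimes> r)) \<noteq> \<chi>3 (u \<otimes> r \<otimes> (u \<otimes> r)))"
    by (rule square_parity[OF parity_add[OF 1(1) 3(1)], of "u \<otimes> r" u v]) (simp_all add: sm)
  moreover have "\<not> (\<chi>1 (v \<otimes> r \<otimes> (v \<otimes> r)) \<noteq> \<chi>2 (v \<otimes> r \<otimes> (v \<otimes> r)))"
    by (rule square_parity[OF parity_add[OF 1(1) 2(1)], of "v \<otimes> r" v u]) (simp_all add: sm)
  moreover have "\<not> ((\<chi>1 (u \<otimes> v \<otimes> r \<otimes> (u \<otimes> v \<otimes> r)) \<noteq> \<chi>2 (u \<otimes> v \<otimes> r \<otimes> (u \<otimes> v \<otimes> r))) \<noteq> \<chi>3 (u \<otimes> v \<otimes> r \<otimes> (u \<otimes> v \<otimes> r)))"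
    by (rule square_parity[OF parity_add[OF parity_add[OF 1(1) 2(1)] 3(1)], of "u \<otimes> v \<otimes> r" u v]) (simp_all add: sm)
  ultimately show False by (simp add: sm) blast
qed

text \<open>Functionals separate the points of \<open>Om\<close>, so identities between products of
  squares and commutators reduce to propositional tautologies.\<close>

lemma Om_eqI:
  assumes z: "z \<in> Om" and w: "w \<in> Om" and eq: "\<And>\<chi>. parity \<chi> \<Longrightarrow> \<chi> z \<longleftrightarrow> \<chi> w"
  shows "z = w"
proof (rule ccontr)
  assume "z \<noteq> w"
  then have "z \<otimes> w \<notin> {\<one>, \<one>, \<one>, \<one> \<otimes> \<one>}" using Om_mult_one_iff z w by simp
  then obtain \<chi> where "parity \<chi>" "\<chi> (z \<otimes> w)" using parity_separating[OF Om_one Om_one Om_mult[OF z w]] by blast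
  then show False using parity_mult[of \<chi> z w] z w eq by blast
qed

text \<open>If n commutes with c, then \<open>six_com\<close> for k, n, c gives
  \<open>com k c\<close> = k^2 n^2 for every k with nontrivial square that does not commute with c.
  This makes the square of k c equal to n^2, and the same formula for k c then gives a trivial
  commutator. One of g and g c can serve as k.\<close>

lemma not_commute_noncentral_involution:
  assumes [simp]: "c \<in> carrier G" "g \<in> carrier G" "n \<in> carrier G"
    and cc: "c \<otimes> c = \<one>" and gc: "com g c \<noteq> \<one>" and nn: "n \<otimes> n \<noteq> \<one>"
  shows "com n c \<noteq> \<one>"
proof
  assume nc: "com n c = \<one>"
  have step: "com k c = k \<otimes> k \<otimes> (n \<otimes> n)" if k: "k \<in> carrier G" "k \<otimes> k \<noteq> \<one>" "com k c \<noteq> \<one>" for k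
    using six_com[of k n c] k nc nn by (simp add: cc com_mult_left Om_mult[THEN Om_carrier] sq_Om)
  have "\<exists>k\<in>{g, g \<otimes> c}. k \<otimes> k \<noteq> \<one> \<and> com k c \<noteq> \<one>"
    using gc by (cases "g \<otimes> g = \<one>") (simp_all add: sq_mult com_mult_left cc)
  then obtain k where k: "k \<in> {g, g \<otimes> c}" "k \<otimes> k \<noteq> \<one>" "com k c \<noteq> \<one>" by blast
  have [simp]: "k \<in> carrier G" using k by auto
  have e1: "com k c = k \<otimes> k \<otimes> (n \<otimes> n)" using step k by simp
  have e2: "k \<otimes> c \<otimes> (k \<otimes> c) = n \<otimes> n"
  proof -
    have "k \<otimes> c \<otimes> (k \<otimes> c) = k \<otimes> k \<otimes> (k \<otimes> k \<otimes> (n \<otimes> n))" by (subst sq_mult) (simp_all add: cc e1)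
    then show ?thesis using Om_cancel[OF sq_Om[of k], of "n \<otimes> n"] by simp
  qed
  have "com (k \<otimes> c) c = com k c" by (simp add: com_mult_left)
  then have "com k c = n \<otimes> n \<otimes> (n \<otimes> n)" using step[of "k \<otimes> c"] k e2 nn by simp
  then show False using k exp4[of n] by simp
qed

text \<open>If x y commutes with c, the preceding lemma for x y suffices. Otherwise
  \<open>six_com\<close> is evaluated with third element c for the pairs (x, y), (x c, y) and (x y
  c, x); comparing the outcomes gives x^2 y^2 = \<open>com x y\<close>, which is the claim.\<close>

lemma noncentral_involution:
  assumes [simp]: "c \<in> carrier G" "g \<in> carrier G" "x \<in> carrier G" "y \<in> carrier G"
    and cc: "c \<otimes> c = \<one>" and gc: "com g c \<noteq> \<one>" and xx: "x \<otimes> x \<noteq> \<one>" and yy: "y \<otimes> y \<noteq> \<one>" and xy: "com x y \<noteq> \<one>"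
  shows "x \<otimes> y \<otimes> (x \<otimes> y) = \<one>"
proof (cases "com (x \<otimes> y) c = \<one>")
  case True
  then show ?thesis using not_commute_noncentral_involution[OF _ _ _ cc gc, of "x \<otimes> y"] by auto
next
  case False
  note nc = not_commute_noncentral_involution[OF _ _ _ cc gc]
  note sc = Om_mult[THEN Om_carrier] sq_Om com_Om
  have 1: "com (x \<otimes> y) c = x \<otimes> x \<otimes> (y \<otimes> y)"
    using six_com[of x y c] False xx yy by (simp add: cc sc)
  have 2: "com x c = x \<otimes> x"
  proof (rule ccontr)
    assume n: "com x c \<noteq> x \<otimes> x"
    have s: "x \<otimes> c \<otimes> (x \<otimes> c) = x \<otimes> x \<otimes> com x c" by (subst sq_mult) (simp_all add: cc)
    then have "x \<otimes> c \<otimes> (x \<otimes> c) \<noteq> \<one>" using n Om_mult_one_iff sq_Om com_Om by simp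
    moreover have e: "com (x \<otimes> c \<otimes> y) c = com (x \<otimes> y) c" by (simp add: com_mult_left)
    ultimately have "com (x \<otimes> y) c = x \<otimes> x \<otimes> com x c \<otimes> (y \<otimes> y)"
      using six_com[of "x \<otimes> c" y c] False yy by (simp add: cc sc s)
    then have "x \<otimes> x \<otimes> com x c \<otimes> (y \<otimes> y) = x \<otimes> x \<otimes> \<one> \<otimes> (y \<otimes> y)" using 1 by simp
    then have "x \<otimes> x \<otimes> com x c = x \<otimes> x \<otimes> \<one>"
      using r_cancel[of "x \<otimes> x \<otimes> com x c" "y \<otimes> y" "x \<otimes> x \<otimes> \<one>"] by simp
    then have "com x c = \<one>" using l_cancel[of "x \<otimes> x" "com x c" \<one>] by simp
    then show False using nc[of x] xx by simp
  qed
  \<comment> \<open>The squares of x and y drop out of w^2, and w x pairs with c exactly as y does;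
    so \<open>six_com\<close> for w and x expresses \<open>com y c\<close> through
    \<open>com x y\<close>.\<close>
  let ?w = "x \<otimes> y \<otimes> c"
  have w: "?w \<otimes> ?w = com x y"
  proof (rule Om_eqI)
    fix \<chi> assume p: "parity \<chi>"
    have "\<chi> (com (x \<otimes> y) c) = \<chi> (x \<otimes> x \<otimes> (y \<otimes> y))" using 1 by simp
    then show "\<chi> (?w \<otimes> ?w) = \<chi> (com x y)"
      by (auto simp: parity_mult[OF p] com_simps parity_one[OF p] cc)
  qed (simp_all add: com_simps)
  have "com (?w \<otimes> x) c = com y c"
    by (rule Om_eqI) (auto simp: com_simps parity_mult parity_one)
  then have 3: "com y c = com x y \<otimes> (x \<otimes> x)"
    using six_com[of ?w x c] w xy xx nc[of y] yy by (simp add: cc sc)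
  show ?thesis
  proof (rule Om_eqI)
    fix \<chi> assume p: "parity \<chi>"
    have "\<chi> (com (x \<otimes> y) c) = \<chi> (x \<otimes> x \<otimes> (y \<otimes> y))" "\<chi> (com y c) = \<chi> (com x y \<otimes> (x \<otimes> x))" using 1 3 by simp_all
    then show "\<chi> (x \<otimes> y \<otimes> (x \<otimes> y)) = \<chi> \<one>"
      by (auto simp: parity_mult[OF p] com_simps parity_one[OF p] 2)
  qed (simp_all add: com_simps)
qed

text \<open>The witness is k = x y, a noncentral involution, so its centralizer has exponent two.
  That \<open>com h k\<close> has only one nontrivial value follows from \<open>six_com\<close> for
  (l, x, k) and (l, y, k), where l is h or h k with nontrivial square: another value would force x^2
  = y^2, but then (x y)^2 would be the nontrivial \<open>com x y\<close>.\<close>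

lemma elementary_abelian_centralizer:
  assumes [simp]: "c \<in> carrier G" "g \<in> carrier G" "x \<in> carrier G" "y \<in> carrier G"
    and cc: "c \<otimes> c = \<one>" and gc: "com g c \<noteq> \<one>" and xx: "x \<otimes> x \<noteq> \<one>" and yy: "y \<otimes> y \<noteq> \<one>" and xy: "com x y \<noteq> \<one>"
  shows "\<exists>k\<in>carrier G. (\<forall>h\<in>carrier G. com h k = \<one> \<longrightarrow> h \<otimes> h = \<one>) \<and> com x k \<noteq> \<one> \<and>
    (\<forall>h\<in>carrier G. com h k \<noteq> \<one> \<longrightarrow> com h k = com x k)"
proof -
  let ?k = "x \<otimes> y"
  have kk: "?k \<otimes> ?k = \<one>" using noncentral_involution[OF assms] .
  have xk: "com x ?k = com x y" and yk: "com y ?k = com x y"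
    by (simp_all add: com_mult_right com_sym[of x y])
  have ne: "x \<otimes> x \<noteq> y \<otimes> y"
  proof
    assume "x \<otimes> x = y \<otimes> y"
    then have "?k \<otimes> ?k = com x y" using exp4[of y] by (simp add: sq_mult[of x y])
    then show False using kk xy by simp
  qed
  have "com h ?k = com x ?k" if [simp]: "h \<in> carrier G" and hk: "com h ?k \<noteq> \<one>" for h
  proof -
    have "\<exists>l\<in>{h, h \<otimes> ?k}. l \<otimes> l \<noteq> \<one> \<and> com l ?k = com h ?k"
      using hk by (cases "h \<otimes> h = \<one>") (simp_all add: sq_mult[of h ?k] com_mult_left[of h ?k ?k] kk)
    then obtain l where l: "l \<in> {h, h \<otimes> ?k}" "l \<otimes> l \<noteq> \<one>" "com l ?k = com h ?k" by blast
    have [simp]: "l \<in> carrier G" using l by auto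
    note sc = Om_mult[THEN Om_carrier] sq_Om com_Om
    have z: "com (l \<otimes> x) ?k = com h ?k \<otimes> com x y" "com (l \<otimes> y) ?k = com h ?k \<otimes> com x y"
      using l xk yk by (simp_all add: com_mult_left[of l _ ?k])
    have "com h ?k \<otimes> com x y = \<one>"
    proof (rule ccontr)
      assume n: "com h ?k \<otimes> com x y \<noteq> \<one>"
      have "com h ?k \<otimes> com x y = l \<otimes> l \<otimes> (x \<otimes> x)"
        using six_com[of l x ?k] n l xx z by (simp add: kk sc)
      moreover have "com h ?k \<otimes> com x y = l \<otimes> l \<otimes> (y \<otimes> y)"
        using six_com[of l y ?k] n l yy z by (simp add: kk sc)
      ultimately have "l \<otimes> l \<otimes> (x \<otimes> x) = l \<otimes> l \<otimes> (y \<otimes> y)" by simp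
      then show False using ne l_cancel[of "l \<otimes> l" "x \<otimes> x" "y \<otimes> y"] by simp
    qed
    then show ?thesis using Om_mult_one_iff com_Om xk by simp
  qed
  moreover have "h \<otimes> h = \<one>" if "h \<in> carrier G" "com h ?k = \<one>" for h
    using not_commute_noncentral_involution[of ?k x h] kk xk xy that by auto
  ultimately show ?thesis using xk xy by (intro bexI[of _ ?k]) auto
qed

text \<open>As x and y do not commute, the conditions on w make x, y and w independent modulo the
  center. The dependence among their commutators then yields commuting p and q, still independent
  modulo the center, and B is the centralizer of p.\<close>

lemma inverting_centralizer:
  assumes inv_central: "\<And>c g. c \<in> carrier G \<Longrightarrow> g \<in> carrier G \<Longrightarrow> c \<otimes> c = \<one> \<Longrightarrow> com c g = \<one>"
    and [simp]: "x \<in> carrier G" "y \<in> carrier G" "w \<in> carrier G" and xy: "com x y \<noteq> \<one>"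
    and nw: "w \<notin> center G" "x \<otimes> w \<notin> center G" "y \<otimes> w \<notin> center G" "x \<otimes> y \<otimes> w \<notin> center G"
  shows "\<exists>B. inverting_subgroup B"
proof -
  have cent: "z \<in> center G \<longleftrightarrow> (\<forall>g\<in>carrier G. com z g = \<one>)" if "z \<in> carrier G" for z
    using that by (auto simp: center_def com_one_iff)
  have nc: "z \<in> center G" if "p \<in> carrier G" "t \<in> carrier G" "z \<in> carrier G" "com p t \<noteq> \<one>" "com z p = \<one>" "com z t = \<one>" for p t z
    using central_of_commutes_noncommuting[of p t z] that cent by blast
  have sq: "z \<otimes> z = \<one>" if "z \<in> carrier G" "z \<in> center G" for z
    using square_or_commutator_in_span[of z x y] that xy cent by simp
  have sq': "z \<otimes> z \<noteq> \<one>" if "z \<in> carrier G" "z \<notin> center G" for z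
    using inv_central that cent by blast
  have noncent: "a \<notin> center G" if "a \<in> carrier G" "h \<in> carrier G" "com a h \<noteq> \<one>" for a h
    using that cent by blast
  have n1: "x \<notin> center G" "y \<notin> center G" "x \<otimes> y \<notin> center G"
    using noncent[of x y] noncent[of y x] noncent[of "x \<otimes> y" y] xy com_sym[of x y] by (simp_all add: com_mult_left)
  have n2: "(x \<otimes> w) \<otimes> (y \<otimes> w) \<notin> center G"
  proof
    assume a: "(x \<otimes> w) \<otimes> (y \<otimes> w) \<in> center G"
    have "com (x \<otimes> y) h = com ((x \<otimes> w) \<otimes> (y \<otimes> w)) h" if [simp]: "h \<in> carrier G" for h
      by (rule Om_eqI) (auto simp: com_simps parity_mult parity_one)
    then show False using a n1(3) cent by simp
  qed
  \<comment> \<open>Each relation left open by \<open>dependent_commutators\<close> says that two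
    particular products of x, y and w commute; independence modulo the center survives the change of
    elements.\<close>
  have "\<exists>p\<in>carrier G. \<exists>q\<in>carrier G. com p q = \<one> \<and> p \<notin> center G \<and> q \<notin> center G \<and> p \<otimes> q \<notin> center G"
  proof -
    have nw': "x \<otimes> (y \<otimes> w) \<notin> center G" using nw by (simp add: m_assoc)
    have ny: "y \<otimes> (x \<otimes> w) \<notin> center G"
    proof
      assume a: "y \<otimes> (x \<otimes> w) \<in> center G"
      have "com (x \<otimes> y \<otimes> w) h = com (y \<otimes> (x \<otimes> w)) h" if [simp]: "h \<in> carrier G" for h
        by (rule Om_eqI) (auto simp: com_simps parity_mult parity_one)
      then show False using a nw(4) cent by simp
    qed
    consider "com x w = \<one>" | "com y w = \<one>" | "com x (y \<otimes> w) = \<one>" | "com y (x \<otimes> w) = \<one>" | "com (x \<otimes> y) w = \<one>" | "com (x \<otimes> w) (y \<otimes> w) = \<one>"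
    proof -
      have O: "com x y \<in> Om" "com x w \<in> Om" "com y w \<in> Om" by (simp_all add: com_Om)
      have "com x y = com x w \<Longrightarrow> com x (y \<otimes> w) = \<one>" using Om_sq[OF O(2)] by (simp add: com_mult_right)
      moreover have "com x y = com y w \<Longrightarrow> com y (x \<otimes> w) = \<one>" using Om_sq[OF O(3)] by (simp add: com_mult_right com_sym[of x y])
      moreover have "com x w = com y w \<Longrightarrow> com (x \<otimes> y) w = \<one>" using Om_sq[OF O(3)] by (simp add: com_mult_left)
      moreover have "com (x \<otimes> w) (y \<otimes> w) = \<one>" if h: "com x y = com x w \<otimes> com y w"
      proof (rule Om_eqI)
        fix \<chi> assume p: "parity \<chi>"
        have "\<chi> (com x y) = \<chi> (com x w \<otimes> com y w)" using h by simp
        then show "\<chi> (com (x \<otimes> w) (y \<otimes> w)) = \<chi> \<one>" by (auto simp: com_simps parity_mult[OF p] parity_one[OF p] com_sym[of y w])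
      qed (simp_all add: com_simps)
      ultimately show ?thesis using dependent_commutators[OF assms(2-4)] xy that by blast
    qed
    then show ?thesis
    proof cases
      case 1 then show ?thesis using n1 nw by (intro bexI[of _ x] bexI[of _ w]) simp_all
    next
      case 2 then show ?thesis using n1 nw by (intro bexI[of _ y] bexI[of _ w]) simp_all
    next
      case 3 then show ?thesis using n1 nw nw' by (intro bexI[of _ x] bexI[of _ "y \<otimes> w"]) simp_all
    next
      case 4 then show ?thesis using n1 nw ny by (intro bexI[of _ y] bexI[of _ "x \<otimes> w"]) simp_all
    next
      case 5 then show ?thesis using n1 nw by (intro bexI[of _ "x \<otimes> y"] bexI[of _ w]) simp_all
    next
      case 6 then show ?thesis using n1 nw n2 by (intro bexI[of _ "x \<otimes> w"] bexI[of _ "y \<otimes> w"]) simp_all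
    qed
  qed
  then obtain p q where [simp]: "p \<in> carrier G" "q \<in> carrier G" and pq: "com p q = \<one>"
    and npq: "p \<notin> center G" "q \<notin> center G" "p \<otimes> q \<notin> center G" by blast
  have qp: "com q p = \<one>" using pq com_sym[of p q] by simp
  have q1: "com q g \<noteq> \<one>" and q2: "com q g \<noteq> com p g" if [simp]: "g \<in> carrier G" and g: "com p g \<noteq> \<one>" for g
  proof -
    show "com q g \<noteq> \<one>" using nc[of p g q] g qp npq by auto
    show "com q g \<noteq> com p g"
    proof
      assume "com q g = com p g"
      then have "com (p \<otimes> q) g = \<one>" using Om_sq[OF com_Om[of p g]] by (simp add: com_mult_left)
      then show False using nc[of p g "p \<otimes> q"] g qp npq by (simp add: com_mult_left)
    qed
  qed
  \<comment> \<open>In \<open>square_or_commutator_in_span\<close> for p, q and g, the commutator of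
    p and q is trivial, p^2 is not, and \<open>q1\<close> and \<open>q2\<close> exclude the
    alternative on \<open>com q g\<close>. What is left says that g inverts p.\<close>
  have pp: "com p g = p \<otimes> p" if [simp]: "g \<in> carrier G" and g: "com p g \<noteq> \<one>" for g
    using square_or_commutator_in_span[of p q g] sq'[of p] npq q1[of g] q2[of g] pq g by auto
  define B where "B = {b \<in> carrier G. com b p = \<one>}"
  have outside: "g \<in> carrier G - B \<longleftrightarrow> g \<in> carrier G \<and> com p g \<noteq> \<one>" for g
    using com_sym[of p g] by (auto simp: B_def)
  have Bc: "b \<in> B \<Longrightarrow> b \<in> carrier G" "b \<in> B \<Longrightarrow> com b p = \<one>" "b \<in> B \<Longrightarrow> com p b = \<one>" for b
    using com_sym[of b p] by (auto simp: B_def)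
  have "subgroup B G"
  proof
    fix b assume b: "b \<in> B"
    then have "com (inv b) p = \<one>" using Bc by (simp add: inv_exp4 com_mult_left)
    then show "inv b \<in> B" using b by (simp add: B_def)
  qed (auto simp: B_def com_mult_left com_one_iff)
  moreover have ab: "b \<otimes> c = c \<otimes> b" if "b \<in> B" "c \<in> B" for b c
  proof (rule ccontr)
    assume "b \<otimes> c \<noteq> c \<otimes> b"
    then have "com b c \<noteq> \<one>" using com_one_iff[of b c] that Bc(1) by blast
    then have "p \<in> center G" by (intro nc[of b c p]) (use that Bc in simp_all)
    then show False using npq by blast
  qed
  moreover have "g \<otimes> h \<in> B" if "g \<in> carrier G - B" "h \<in> carrier G - B" for g h
  proof -
    have "com (g \<otimes> h) p = com p g \<otimes> com p h" using that com_sym[of p g] com_sym[of p h] by (simp add: com_mult_left)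
    also have "com p g = p \<otimes> p" using that outside by (intro pp) blast+
    also have "com p h = p \<otimes> p" using that outside by (intro pp) blast+
    also have "p \<otimes> p \<otimes> (p \<otimes> p) = \<one>" using exp4 by simp
    finally show ?thesis using that by (simp add: B_def)
  qed
  moreover have "b \<otimes> g = g \<otimes> inv b" if b: "b \<in> B" and g: "g \<in> carrier G - B" for b g
  proof -
    have [simp]: "b \<in> carrier G" "g \<in> carrier G" using b g Bc by auto
    have pg: "com p g \<noteq> \<one>" using g outside by blast
    have "com b g = b \<otimes> b"
    proof (cases "b \<in> center G")
      case True then show ?thesis using sq[of b] cent[of b] by simp
    next
      case nb: False
      \<comment> \<open>The argument for p is repeated for b, with c in the role of q. If b p and b
        q were both central, so would be p q.\<close>
      have "\<exists>c\<in>{p, q}. b \<otimes> c \<notin> center G"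
      proof (rule ccontr)
        assume "\<not> ?thesis"
        then have a: "b \<otimes> p \<in> center G" "b \<otimes> q \<in> center G" by auto
        have "com (p \<otimes> q) h = com (b \<otimes> p) h \<otimes> com (b \<otimes> q) h" if [simp]: "h \<in> carrier G" for h
          by (rule Om_eqI) (auto simp: com_simps parity_mult parity_one)
        then show False using a npq(3) cent by simp
      qed
      then obtain c where c: "c \<in> {p, q}" "b \<otimes> c \<notin> center G" by blast
      have [simp]: "c \<in> carrier G" using c by auto
      have cB: "c \<in> B" using c qp by (auto simp: B_def)
      have cg: "com c g \<noteq> \<one>" using c pg q1[of g] by auto
      have "com c g \<noteq> com b g"
      proof
        assume "com c g = com b g"
        then have "com (b \<otimes> c) g = \<one>" using Om_sq[OF com_Om[of b g]] by (simp add: com_mult_left)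
        moreover have "com (b \<otimes> c) p = \<one>" using b cB Bc by (simp add: com_mult_left)
        ultimately show False using nc[of p g "b \<otimes> c"] pg c by simp
      qed
      moreover have "com b c = \<one>" using ab[OF b cB] com_one_iff by simp
      ultimately show ?thesis using square_or_commutator_in_span[of b c g] sq'[of b] nb cg by auto
    qed
    then have "b \<otimes> g = g \<otimes> b \<otimes> (b \<otimes> b)" by (metis com_swap \<open>b \<in> carrier G\<close> \<open>g \<in> carrier G\<close>)
    then show ?thesis by (simp add: inv_exp4 m_assoc)
  qed
  ultimately have "inverting_subgroup B" unfolding inverting_subgroup_def by blast
  then show ?thesis ..
qed

section \<open>Reaching conditions (2) and (4)\<close>

lemma center_iff: "z \<in> carrier G \<Longrightarrow> z \<in> center G \<longleftrightarrow> (\<forall>g\<in>carrier G. com z g = \<one>)"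
  by (auto simp: center_def com_one_iff)

lemma elementary_abelian_type:
  assumes k: "k \<in> carrier G" and el: "\<And>h. h \<in> carrier G \<Longrightarrow> com h k = \<one> \<Longrightarrow> h \<otimes> h = \<one>"
    and x: "x \<in> carrier G" "com x k \<noteq> \<one>" and one: "\<And>h. h \<in> carrier G \<Longrightarrow> com h k \<noteq> \<one> \<Longrightarrow> com h k = com x k"
  shows lie_metabelian_type
proof -
  let ?H = "{h \<in> carrier G. com h k = \<one>}"
  have H: "subgroup ?H G"
  proof
    show "inv h \<in> ?H" if "h \<in> ?H" for h
      using that k by (simp add: inv_exp4 com_mult_left)
  qed (use k in \<open>simp_all add: com_mult_left com_one_iff subset_iff\<close>)
  have "elementary_abelian_2_subgroup ?H G"
    unfolding elementary_abelian_2_subgroup_def using H el by (simp add: pow_2)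
  moreover have "g \<otimes> h \<in> ?H" if "g \<in> carrier G - ?H" "h \<in> carrier G - ?H" for g h
  proof -
    have "com g k = com x k" "com h k = com x k" using one that by blast+
    then show ?thesis using that k x Om_sq[OF com_Om[of x k]] by (simp add: com_mult_left)
  qed
  moreover have "x \<notin> ?H" using x by simp
  ultimately show ?thesis unfolding lie_metabelian_type_def using subgroup_index_2_iff[OF H] x by blast
qed

lemma center_index_4:
  assumes [simp]: "x \<in> carrier G" "y \<in> carrier G" and xy: "com x y \<noteq> \<one>"
    and all: "\<And>w. w \<in> carrier G \<Longrightarrow> w \<in> center G \<or> x \<otimes> w \<in> center G \<or> y \<otimes> w \<in> center G \<or> x \<otimes> y \<otimes> w \<in> center G"
  shows "subgroup_index G (center G) = 4"
proof -
  let ?Z = "center G"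
  note Z = subgroup_center
  note Zs = subgroup.subset[OF Z]
  \<comment> \<open>Since k^-2 is central, a central k w puts w = (k w k^-2) k into the coset of
    k.\<close>
  have eq: "?Z #> w = ?Z #> k" if [simp]: "k \<in> carrier G" "w \<in> carrier G" and kw: "k \<otimes> w \<in> ?Z" for k w
  proof -
    have kk: "inv k \<otimes> inv k \<in> ?Z" using sq_Om[of "inv k"] unfolding Om_def center_def by simp
    have "w = inv k \<otimes> (k \<otimes> w)" by simp
    also have "\<dots> = k \<otimes> w \<otimes> inv k" using kw inv_closed[OF that(1)] unfolding center_def by simp
    also have "\<dots> = k \<otimes> w \<otimes> (inv k \<otimes> inv k) \<otimes> k" by (simp add: m_assoc)
    finally have "w = k \<otimes> w \<otimes> (inv k \<otimes> inv k) \<otimes> k" .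
    moreover have "k \<otimes> w \<otimes> (inv k \<otimes> inv k) \<in> ?Z" using subgroup.m_closed[OF Z kw kk] .
    ultimately have "w \<in> ?Z #> k" unfolding r_coset_def by blast
    then show ?thesis using repr_independence[of w ?Z k] Z by simp
  qed
  have neq: "?Z #> a \<noteq> ?Z #> b" if [simp]: "a \<in> carrier G" "b \<in> carrier G" "h \<in> carrier G" and ne: "com a h \<noteq> com b h" for a b h
  proof
    assume "?Z #> a = ?Z #> b"
    then have "a \<in> ?Z #> b" using rcos_self[of a ?Z] Z by simp
    then obtain z where z: "z \<in> ?Z" "a = z \<otimes> b" unfolding r_coset_def by blast
    then have zc: "z \<in> carrier G" using Zs by blast
    then have "com z h = \<one>" using z center_iff by simp
    then have "com a h = com b h" using z zc by (simp add: com_mult_left)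
    then show False using ne by simp
  qed
  have yx: "com y x = com x y" by (rule com_sym) simp_all
  have o: "com \<one> h = \<one>" if "h \<in> carrier G" for h using that by (simp add: com_one_iff)
  have "rcosets ?Z = {?Z #> \<one>, ?Z #> x, ?Z #> y, ?Z #> (x \<otimes> y)}"
  proof
    show "rcosets ?Z \<subseteq> {?Z #> \<one>, ?Z #> x, ?Z #> y, ?Z #> (x \<otimes> y)}"
    proof
      fix K assume "K \<in> rcosets ?Z"
      then obtain w where w: "w \<in> carrier G" "K = ?Z #> w" by (auto simp: RCOSETS_def)
      have "w \<in> ?Z \<Longrightarrow> \<one> \<otimes> w \<in> ?Z" using w by simp
      then show "K \<in> {?Z #> \<one>, ?Z #> x, ?Z #> y, ?Z #> (x \<otimes> y)}"
        using all[OF w(1)] eq[of \<one> w] eq[of x w] eq[of y w] eq[of "x \<otimes> y" w] w by auto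
    qed
    show "{?Z #> \<one>, ?Z #> x, ?Z #> y, ?Z #> (x \<otimes> y)} \<subseteq> rcosets ?Z"
      using rcosetsI[OF Zs] by simp
  qed
  moreover have "?Z #> \<one> \<noteq> ?Z #> x" by (rule neq[of _ _ y]) (simp_all add: o xy xy[symmetric])
  moreover have "?Z #> \<one> \<noteq> ?Z #> y" by (rule neq[of _ _ x]) (simp_all add: o xy yx xy[symmetric])
  moreover have "?Z #> \<one> \<noteq> ?Z #> (x \<otimes> y)" by (rule neq[of _ _ x]) (simp_all add: o xy yx com_mult_left xy[symmetric])
  moreover have "?Z #> x \<noteq> ?Z #> y" by (rule neq[of _ _ y]) (simp_all add: o xy)
  moreover have "?Z #> x \<noteq> ?Z #> (x \<otimes> y)" by (rule neq[of _ _ x]) (simp_all add: o xy yx com_mult_left xy[symmetric])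
  moreover have "?Z #> y \<noteq> ?Z #> (x \<otimes> y)" by (rule neq[of _ _ y]) (simp_all add: o xy yx com_mult_left xy[symmetric])
  ultimately show ?thesis by (simp add: subgroup_index_def)
qed

lemma exponent_four_type: lie_metabelian_type
proof (cases "\<exists>x\<in>carrier G. \<exists>y\<in>carrier G. x \<otimes> x \<noteq> \<one> \<and> y \<otimes> y \<noteq> \<one> \<and> com x y \<noteq> \<one>")
  case False
  then show ?thesis using com_one_iff by (intro commuting_nonsquares_type) metis
next
  case True
  then obtain x y where [simp]: "x \<in> carrier G" "y \<in> carrier G"
    and n: "x \<otimes> x \<noteq> \<one>" "y \<otimes> y \<noteq> \<one>" and xy: "com x y \<noteq> \<one>" by blast
  show ?thesis
  proof (cases "\<exists>c\<in>carrier G. \<exists>g\<in>carrier G. c \<otimes> c = \<one> \<and> com g c \<noteq> \<one>")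
    case True
    then obtain c g where cg: "c \<in> carrier G" "g \<in> carrier G" "c \<otimes> c = \<one>" "com g c \<noteq> \<one>" by blast
    obtain k where k: "k \<in> carrier G" "\<And>h. h \<in> carrier G \<Longrightarrow> com h k = \<one> \<Longrightarrow> h \<otimes> h = \<one>" "com x k \<noteq> \<one>"
      "\<And>h. h \<in> carrier G \<Longrightarrow> com h k \<noteq> \<one> \<Longrightarrow> com h k = com x k"
      using elementary_abelian_centralizer[OF cg(1,2) _ _ cg(3,4) n xy] by auto
    show ?thesis by (rule elementary_abelian_type[OF k(1,2) _ k(3,4)]) simp_all
  next
    case False
    then have ic: "com c g = \<one>" if "c \<in> carrier G" "g \<in> carrier G" "c \<otimes> c = \<one>" for c g
      using that com_sym[of g c] by auto
    show ?thesis
    proof (cases "\<exists>w\<in>carrier G. w \<notin> center G \<and> x \<otimes> w \<notin> center G \<and> y \<otimes> w \<notin> center G \<and> x \<otimes> y \<otimes> w \<notin> center G")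
      case True
      then obtain w where w: "w \<in> carrier G" "w \<notin> center G" "x \<otimes> w \<notin> center G" "y \<otimes> w \<notin> center G" "x \<otimes> y \<otimes> w \<notin> center G"
        by blast
      obtain B where "inverting_subgroup B"
        using inverting_centralizer[OF ic \<open>x \<in> carrier G\<close> \<open>y \<in> carrier G\<close> w(1) xy w(2-5)] by metis
      then show ?thesis by (rule inverting_subgroup_type)
    next
      case False
      then have i4: "subgroup_index G (center G) = 4" by (intro center_index_4[OF \<open>x \<in> carrier G\<close> \<open>y \<in> carrier G\<close> xy]) blast
      have "z \<in> center G \<longleftrightarrow> z \<otimes> z = \<one>" if "z \<in> carrier G" for z
      proof
        assume "z \<in> center G"
        then have "com z x = \<one>" "com z y = \<one>" using center_iff[OF that] by simp_all
        then show "z \<otimes> z = \<one>" using square_or_commutator_in_span[of z x y] that xy by simp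
      next
        assume "z \<otimes> z = \<one>"
        then show "z \<in> center G" using center_iff[OF that] ic[OF that] by simp
      qed
      then have "center G = {g \<in> carrier G. g [^] (2::nat) = \<one>}"
        using subgroup.subset[OF subgroup_center] by (auto simp: pow_2)
      then show ?thesis using i4 unfolding lie_metabelian_type_def by blast
    qed
  qed
qed

end

lemma (in six_group) six_group_type: lie_metabelian_type
proof (cases "\<exists>a\<in>carrier G. a \<otimes> a \<otimes> (a \<otimes> a) \<noteq> \<one>")
  case False
  then have exp4: "\<And>x. x \<in> carrier G \<Longrightarrow> x \<otimes> x \<otimes> (x \<otimes> x) = \<one>" by blast
  interpret exponent_four_six_group G
    by unfold_locales (fact exp4, rule sq_central[OF exp4])
  show ?thesis by (rule exponent_four_type)
next
  case True
  then obtain a where a: "a \<in> carrier G" "a \<otimes> a \<otimes> a \<otimes> a \<noteq> \<one>" by (auto simp: m_assoc)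
  show ?thesis
  proof (cases "\<exists>t\<in>carrier G. a \<otimes> t \<noteq> t \<otimes> a")
    case True
    then show ?thesis using inverting_subgroup_four[OF a] inverting_subgroup_type by blast
  next
    case False
    then show ?thesis using centralizer_abelian[OF a(1) _ _ a(2)] by (intro commuting_nonsquares_type) blast
  qed
qed

section \<open>Commutators and integers in rings\<close>

lemma (in ring) minus_swap:
  assumes "a \<in> carrier R" "b \<in> carrier R"
  shows "b \<ominus> a = \<ominus> (a \<ominus> b)"
  using assms by algebra

lemma (in ring) add_commutators:
  assumes "x \<in> carrier R" "y \<in> carrier R" "z \<in> carrier R"
  shows "lie_bracket R x y \<oplus> lie_bracket R z y = lie_bracket R (x \<oplus> z) y"
  unfolding lie_bracket_def using assms by algebra

lemma (in ring) lie_bracket_closed [simp, intro]: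
  "x \<in> carrier R \<Longrightarrow> y \<in> carrier R \<Longrightarrow> lie_bracket R x y \<in> carrier R"
  by (simp add: lie_bracket_def)

lemma (in ring) lie_bracket_jacobi:
  assumes "s \<in> carrier R" "t \<in> carrier R" "k \<in> carrier R"
  shows "lie_bracket R (lie_bracket R s t) k =
    lie_bracket R (lie_bracket R s k) t \<oplus> lie_bracket R s (lie_bracket R t k)"
  unfolding lie_bracket_def using assms by algebra

lemma (in ring) lie_bracket_zero_iff:
  assumes "x \<in> carrier R" "y \<in> carrier R"
  shows "lie_bracket R x y = \<zero> \<longleftrightarrow> x \<otimes> y = y \<otimes> x"
  unfolding lie_bracket_def using assms by simp

lemma (in ring) lie_bracket_product_zero:
  assumes "x \<in> carrier R" "y \<in> carrier R" "z \<in> carrier R"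
    and "lie_bracket R x y = \<zero>" "lie_bracket R x z = \<zero>"
  shows "lie_bracket R x (y \<otimes> z \<oplus> z \<otimes> y) = \<zero>"
proof -
  have "lie_bracket R x (y \<otimes> z \<oplus> z \<otimes> y) =
    lie_bracket R x y \<otimes> z \<oplus> y \<otimes> lie_bracket R x z \<oplus> (lie_bracket R x z \<otimes> y \<oplus> z \<otimes> lie_bracket R x y)"
    unfolding lie_bracket_def using assms(1-3) by algebra
  then show ?thesis using assms by simp
qed

text \<open>From 2 k l = (k l + l k) + [k, l]; the double is kept because 2 need not be
  invertible.\<close>

lemma (in ring) lie_bracket_double_product:
  assumes "k \<in> carrier R" "l \<in> carrier R" "s \<in> carrier R"
  shows "lie_bracket R (k \<otimes> l) s \<oplus> lie_bracket R (k \<otimes> l) s =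
    lie_bracket R (k \<otimes> l \<oplus> l \<otimes> k) s \<ominus> lie_bracket R s (lie_bracket R k l)"
  unfolding lie_bracket_def using assms by algebra

text \<open>The last summand is the commutator of a and x b, so a trace does not see it, and under
  the trace a moves out of the bracket to x.\<close>

lemma (in ring) mult_lie_bracket:
  assumes "x \<in> carrier R" "a \<in> carrier R" "b \<in> carrier R"
  shows "x \<otimes> lie_bracket R a b = lie_bracket R x a \<otimes> b \<oplus> (a \<otimes> (x \<otimes> b) \<ominus> (x \<otimes> b) \<otimes> a)"
  unfolding lie_bracket_def using assms by algebra

context cring begin

definition of_integer :: "int \<Rightarrow> 'a" where "of_integer n = add_pow R n \<one>"

lemma of_integer_closed [simp]: "of_integer n \<in> carrier R"
  unfolding of_integer_def add_pow_def using group.int_pow_closed[OF a_group] by simp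

lemma of_integer_add: "of_integer (m + n) = of_integer m \<oplus> of_integer n"
  unfolding of_integer_def add_pow_def using group.int_pow_mult[OF a_group, of \<one> m n] by simp

lemma of_integer_0 [simp]: "of_integer 0 = \<zero>"
  unfolding of_integer_def add_pow_def by simp

lemma of_integer_1 [simp]: "of_integer 1 = \<one>"
  unfolding of_integer_def add_pow_def using group.int_pow_1[OF a_group, of \<one>] by simp

lemma of_integer_minus: "of_integer (- n) = \<ominus> of_integer n"
proof -
  have "of_integer (- n) \<oplus> of_integer n = \<zero>" using of_integer_add[of "- n" n] by simp
  then show ?thesis by (intro minus_equality[symmetric]) simp_all
qed

lemma of_integer_diff: "of_integer (m - n) = of_integer m \<ominus> of_integer n"
  using of_integer_add[of m "- n"] by (simp add: of_integer_minus minus_eq)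

lemma of_integer_mult: "of_integer (m * n) = of_integer m \<otimes> of_integer n"
proof -
  have nat: "of_integer (int k * n) = of_integer (int k) \<otimes> of_integer n" for k
    by (induction k) (simp_all add: of_integer_add distrib_right l_distr)
  show ?thesis
  proof (cases "m \<ge> 0")
    case True then show ?thesis using nat[of "nat m"] by simp
  next
    case False
    then have "of_integer (- m * n) = of_integer (- m) \<otimes> of_integer n" using nat[of "nat (- m)"] by simp
    then have "\<ominus> of_integer (m * n) = \<ominus> (of_integer m \<otimes> of_integer n)"
      using of_integer_minus[of "m * n"] by (simp add: of_integer_minus l_minus)
    then have "\<ominus> (\<ominus> of_integer (m * n)) = \<ominus> (\<ominus> (of_integer m \<otimes> of_integer n))" by (rule arg_cong)
    then show ?thesis by (simp only: minus_minus of_integer_closed m_closed)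
  qed
qed

lemma of_integer_eq_0_iff:
  assumes "char_zero R"
  shows "of_integer n = \<zero> \<longleftrightarrow> n = 0"
proof
  have pos: "of_integer (int k) \<noteq> \<zero>" if "k > 0" for k
    using assms that unfolding char_zero_def of_integer_def add_pow_def by (simp add: int_pow_int)
  assume z: "of_integer n = \<zero>"
  show "n = 0"
  proof (rule ccontr)
    assume "n \<noteq> 0"
    then consider "n > 0" | "- n > 0" by linarith
    then show False
    proof cases
      case 1 then show ?thesis using pos[of "nat n"] z by simp
    next
      case 2 then show ?thesis using pos[of "nat (- n)"] z by (simp add: of_integer_minus)
    qed
  qed
qed simp

lemma finsum_of_integer:
  assumes "finite A" "\<And>a. a \<in> A \<Longrightarrow> h a = of_integer (n a)"
  shows "finsum R h A = of_integer (\<Sum>a\<in>A. n a)"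
  using assms by (induction A rule: finite_induct) (simp_all add: of_integer_add Pi_def)

end

section \<open>Coefficients of products in group rings\<close>

context group_ring_setup begin

sublocale RG: ring RG
  by (rule ring_group_ring)

abbreviation gmult (infixl "\<bullet>" 70) where "x \<bullet> y \<equiv> x \<otimes>\<^bsub>G\<^esub> y"
abbreviation ginv ("_\<acute>" [1000] 999) where "x\<acute> \<equiv> inv\<^bsub>G\<^esub> x"

abbreviation rmult (infixl "\<star>" 70) where "f \<star> g \<equiv> f \<otimes>\<^bsub>RG\<^esub> g"

text \<open>The restriction to W lets one part of a coefficient cancel or be rearranged by a
  bijection of its own.\<close>

definition partial_product where
  "partial_product f h W x = (\<Oplus>y\<in>supp R G f \<inter> W. f y \<otimes> h (y\<acute> \<bullet> x))"

lemma partial_product_closed: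
  "f \<in> carrier RG \<Longrightarrow> h \<in> carrier RG \<Longrightarrow> x \<in> carrier G \<Longrightarrow> partial_product f h W x \<in> carrier R"
  unfolding partial_product_def by (intro R.finsum_closed) (auto simp: supp_def RG_closed)

lemma mult_eq_partial_product:
  "f \<in> carrier RG \<Longrightarrow> h \<in> carrier RG \<Longrightarrow> x \<in> carrier G \<Longrightarrow> (f \<star> h) x = partial_product f h (carrier G) x"
proof -
  assume a: "f \<in> carrier RG" "h \<in> carrier RG" "x \<in> carrier G"
  have "supp R G f \<subseteq> carrier G" by (auto simp: supp_def)
  then show ?thesis using mult_coeff[OF a RG_finite[OF a(1)]] by (simp add: partial_product_def Int_absorb2)
qed

lemma mult_split:
  assumes f: "f \<in> carrier RG" and h: "h \<in> carrier RG" and x: "x \<in> carrier G"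
  shows "(f \<star> h) x = partial_product f h W x \<oplus> partial_product f h (carrier G - W) x"
proof -
  let ?t = "\<lambda>y. f y \<otimes> h (y\<acute> \<bullet> x)"
  have e: "supp R G f = (supp R G f \<inter> W) \<union> (supp R G f \<inter> (carrier G - W))" by (auto simp: supp_def)
  have "(f \<star> h) x = (\<Oplus>y\<in>supp R G f. ?t y)"
    using mult_coeff[OF f h x RG_finite[OF f]] by (simp add: supp_def)
  also have "\<dots> = (\<Oplus>y\<in>(supp R G f \<inter> W) \<union> (supp R G f \<inter> (carrier G - W)). ?t y)" using e by simp
  also have "\<dots> = (\<Oplus>y\<in>supp R G f \<inter> W. ?t y) \<oplus> (\<Oplus>y\<in>supp R G f \<inter> (carrier G - W). ?t y)"
    using RG_finite[OF f] x RG_closed[OF f] RG_closed[OF h]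
    by (intro R.finsum_Un_disjoint) (auto simp: supp_def)
  finally show ?thesis by (simp add: partial_product_def)
qed

text \<open>The engine behind all coefficient comparisons: terms are matched by a bijection of
  possibly infinite index sets.\<close>

lemma partial_product_reindex:
  assumes f: "f \<in> carrier RG" and g: "g \<in> carrier RG" and h: "h \<in> carrier RG" and k: "k \<in> carrier RG"
    and x: "x \<in> carrier G" "u \<in> carrier G" and W: "W \<subseteq> carrier G" "V \<subseteq> carrier G" and bij: "bij_betw \<sigma> W V"
    and eq: "\<And>y. y \<in> W \<Longrightarrow> f y \<otimes> g (y\<acute> \<bullet> x) = h (\<sigma> y) \<otimes> k ((\<sigma> y)\<acute> \<bullet> u)"
  shows "partial_product f g W x = partial_product h k V u"
proof -
  note cl = RG_closed[OF f] RG_closed[OF g] RG_closed[OF h] RG_closed[OF k]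
  let ?t = "\<lambda>y. f y \<otimes> g (y\<acute> \<bullet> x)" and ?s = "\<lambda>z. h z \<otimes> k (z\<acute> \<bullet> u)"
  \<comment> \<open>The bijection need not match the supports of f and h, so both sums are extended
    by zeros to the finite set where either left factor is nonzero.\<close>
  let ?A = "{y \<in> W. f y \<noteq> \<zero> \<or> h (\<sigma> y) \<noteq> \<zero>}"
  have inj: "inj_on \<sigma> W" and im: "\<sigma> ` W = V" using bij by (auto simp: bij_betw_def)
  have sV: "\<sigma> y \<in> carrier G" if "y \<in> W" for y using im that W by blast
  have "\<sigma> ` {y \<in> W. h (\<sigma> y) \<noteq> \<zero>} \<subseteq> supp R G h" using sV by (auto simp: supp_def)
  then have "finite {y \<in> W. h (\<sigma> y) \<noteq> \<zero>}"
    by (rule finite_imageD[OF finite_subset[OF _ RG_finite[OF h]]]) (rule inj_on_subset[OF inj], blast)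
  moreover have "finite {y \<in> W. f y \<noteq> \<zero>}"
    using finite_subset[OF _ RG_finite[OF f], of "{y \<in> W. f y \<noteq> \<zero>}"] W by (auto simp: supp_def)
  moreover have "?A = {y \<in> W. f y \<noteq> \<zero>} \<union> {y \<in> W. h (\<sigma> y) \<noteq> \<zero>}" by blast
  ultimately have fin: "finite ?A" by simp
  have "partial_product f g W x = (\<Oplus>y\<in>?A. ?t y)"
    unfolding partial_product_def using fin W x cl
    by (intro R.add.finprod_mono_neutral_cong_left) (auto simp: supp_def subset_iff)
  also have "\<dots> = (\<Oplus>y\<in>?A. ?s (\<sigma> y))"
    using eq sV x cl by (intro R.finsum_cong') auto
  also have "\<dots> = (\<Oplus>z\<in>\<sigma> ` ?A. ?s z)"
    using inj sV x cl by (intro R.finsum_reindex[symmetric]) (auto intro: inj_on_subset)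
  also have "\<dots> = partial_product h k V u"
    unfolding partial_product_def
  proof (rule R.add.finprod_mono_neutral_cong_left[symmetric])
    show "finite (\<sigma> ` ?A)" using fin by simp
    show "supp R G h \<inter> V \<subseteq> \<sigma> ` ?A" using im by (auto simp: supp_def)
    show "?s z = \<zero>" if z: "z \<in> \<sigma> ` ?A - supp R G h \<inter> V" for z
    proof -
      have "z \<in> V" using z im by blast
      then have "z \<in> carrier G" "h z = \<zero>" using z W by (auto simp: supp_def)
      then show "?s z = \<zero>" using x cl by simp
    qed
  qed (use sV x cl in auto)
  finally show ?thesis .
qed

lemma mult_reindex:
  assumes "f \<in> carrier RG" "g \<in> carrier RG" "h \<in> carrier RG" "k \<in> carrier RG"
    and "x \<in> carrier G" "u \<in> carrier G" and "bij_betw \<sigma> (carrier G) (carrier G)"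
    and "\<And>y. y \<in> carrier G \<Longrightarrow> f y \<otimes> g (y\<acute> \<bullet> x) = h (\<sigma> y) \<otimes> k ((\<sigma> y)\<acute> \<bullet> u)"
  shows "(f \<star> g) x = (h \<star> k) u"
  using partial_product_reindex[of f g h k x u "carrier G" "carrier G" \<sigma>] assms mult_eq_partial_product by simp

lemma neg_coeff:
  assumes f: "f \<in> carrier RG" and x: "x \<in> carrier G"
  shows "(\<ominus>\<^bsub>RG\<^esub> f) x = \<ominus> f x"
proof -
  have "(\<ominus>\<^bsub>RG\<^esub> f \<oplus>\<^bsub>RG\<^esub> f) x = \<zero>" using f x by (simp add: RG.l_neg zero_coeff)
  then have "(\<ominus>\<^bsub>RG\<^esub> f) x \<oplus> f x = \<zero>" using x by (simp add: add_coeff)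
  then show ?thesis using f x by (intro R.minus_equality[symmetric]) (auto intro: RG_closed)
qed

lemma bracket_coeff:
  assumes "f \<in> carrier RG" "h \<in> carrier RG" "x \<in> carrier G"
  shows "lie_bracket RG f h x = (f \<star> h) x \<ominus> (h \<star> f) x"
  using assms by (simp add: lie_bracket_def a_minus_def add_coeff neg_coeff mult_closed)

lemma bracket_zeroI:
  assumes "f \<in> carrier RG" "h \<in> carrier RG" "x \<in> carrier G" "(f \<star> h) x = (h \<star> f) x"
  shows "lie_bracket RG f h x = \<zero>"
  using assms by (simp add: bracket_coeff RG_closed mult_closed a_minus_def R.r_neg)

lemma symmetric_closed: "f \<in> symmetric_elements R G \<Longrightarrow> f \<in> carrier RG"
  by (simp add: symmetric_elements_def)

lemma symmetric_inv: "f \<in> symmetric_elements R G \<Longrightarrow> x \<in> carrier G \<Longrightarrow> f (x\<acute>) = f x"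
  unfolding symmetric_elements_def classical_involution_def by (metis (mono_tags, lifting) mem_Collect_eq restrict_apply')

text \<open>\<open>D\<close> records what is remembered of a commutator of symmetric elements; each
  argument below chooses its own.\<close>

lemma lie_metabelianI:
  assumes "\<And>f g. f \<in> symmetric_elements R G \<Longrightarrow> g \<in> symmetric_elements R G \<Longrightarrow> D (lie_bracket RG f g)"
    and "\<And>d e. d \<in> carrier RG \<Longrightarrow> e \<in> carrier RG \<Longrightarrow> D d \<Longrightarrow> D e \<Longrightarrow> d \<star> e = e \<star> d"
  shows "lie_metabelian RG (symmetric_elements R G)"
  unfolding lie_metabelian_def
proof (intro ballI)
  fix a b c d assume s: "a \<in> symmetric_elements R G" "b \<in> symmetric_elements R G" "c \<in> symmetric_elements R G" "d \<in> symmetric_elements R G"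
  let ?p = "lie_bracket RG a b" and ?q = "lie_bracket RG c d"
  have cl: "?p \<in> carrier RG" "?q \<in> carrier RG" using s symmetric_closed by auto
  have "?p \<star> ?q = ?q \<star> ?p" by (rule assms(2)[OF cl]) (use assms(1) s in auto)
  then show "lie_bracket RG ?p ?q = \<zero>\<^bsub>RG\<^esub>" using cl unfolding lie_bracket_def[of RG ?p ?q] by (simp add: RG.minus_eq RG.r_neg)
qed

subsection \<open>Sufficiency of the four conditions\<close>

lemma bij_mult_left: "x \<in> carrier G \<Longrightarrow> bij_betw (\<lambda>y. x \<bullet> y) (carrier G) (carrier G)"
  by (rule bij_betw_byWitness[of _ "\<lambda>y. x\<acute> \<bullet> y"]) auto

lemma bij_inv_mult: "x \<in> carrier G \<Longrightarrow> bij_betw (\<lambda>y. y\<acute> \<bullet> x) (carrier G) (carrier G)"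
  by (rule bij_betw_byWitness[of _ "\<lambda>y. x \<bullet> y\<acute>"]) (auto simp: G.inv_mult_group G.m_assoc)

text \<open>The involution reverses products and fixes f and g, so it sends f g to g f; here this is
  read off coefficientwise.\<close>

lemma mult_symmetric_inv:
  assumes f: "f \<in> symmetric_elements R G" and g: "g \<in> symmetric_elements R G" and x: "x \<in> carrier G"
  shows "(f \<star> g) (x\<acute>) = (g \<star> f) x"
proof (rule mult_reindex[where \<sigma> = "\<lambda>y. x \<bullet> y"])
  fix y assume y: "y \<in> carrier G"
  have "g (y\<acute> \<bullet> x\<acute>) = g (x \<bullet> y)" using symmetric_inv[OF g, of "x \<bullet> y"] x y by (simp add: G.inv_mult_group)
  moreover have "f ((x \<bullet> y)\<acute> \<bullet> x) = f y" using symmetric_inv[OF f, of y] x y by (simp add: G.inv_mult_group G.m_assoc)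
  ultimately show "f y \<otimes> g (y\<acute> \<bullet> x\<acute>) = g (x \<bullet> y) \<otimes> f ((x \<bullet> y)\<acute> \<bullet> x)"
    using f g x y symmetric_closed by (simp add: R.m_comm RG_closed)
qed (use assms symmetric_closed bij_mult_left in auto)

lemma bracket_symmetric_inv:
  assumes f: "f \<in> symmetric_elements R G" and g: "g \<in> symmetric_elements R G" and x: "x \<in> carrier G"
  shows "lie_bracket RG f g (x\<acute>) = \<ominus> lie_bracket RG f g x"
proof -
  note cl = symmetric_closed[OF f] symmetric_closed[OF g]
  have "lie_bracket RG f g (x\<acute>) = (g \<star> f) x \<ominus> (f \<star> g) x"
    using bracket_coeff[OF cl, of "x\<acute>"] mult_symmetric_inv[OF f g x] mult_symmetric_inv[OF g f x] x by simp
  also have "\<dots> = \<ominus> ((f \<star> g) x \<ominus> (g \<star> f) x)"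
    using cl x by (intro R.minus_swap RG_closed mult_closed)
  finally show ?thesis using bracket_coeff[OF cl x] by simp
qed

lemma inverting_lie_metabelian:
  assumes B: "G.inverting_subgroup B"
  shows "lie_metabelian RG (symmetric_elements R G)"
proof (rule lie_metabelianI[where D = "\<lambda>d. \<forall>x\<in>carrier G - B. d x = \<zero>"])
  note sB = G.inverting_subgroupD(1)[OF B] and ab = G.inverting_subgroupD(2)[OF B]
    and i2 = G.inverting_subgroupD(3)[OF B] and iv = G.inverting_subgroupD(4)[OF B]
  note mem = G.mult_mem_iff[OF sB] G.inv_mem_iff[OF sB]
  {
    fix f g assume fg: "f \<in> symmetric_elements R G" "g \<in> symmetric_elements R G"
    show "\<forall>x\<in>carrier G - B. lie_bracket RG f g x = \<zero>"
    proof
      fix x assume x: "x \<in> carrier G - B"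
      then have [simp]: "x \<in> carrier G" "x \<notin> B" by auto
      \<comment> \<open>For y in B the factors are exchanged because x inverts y. For y outside B,
        x^-1 y and y^-1 x are mutually inverse, and y^-1 x lies in B, hence is inverted by
        x.\<close>
      let ?s = "\<lambda>y. if y \<in> B then y\<acute> \<bullet> x else x\<acute> \<bullet> y"
      have out: "x\<acute> \<bullet> y \<in> B" "y\<acute> \<bullet> x \<in> B" if "y \<in> carrier G" "y \<notin> B" for y
        using i2[of "x\<acute>" y] i2[of "y\<acute>" x] that mem by simp_all
      have "bij_betw ?s (carrier G) (carrier G)"
      proof (rule bij_betw_byWitness[of _ "\<lambda>z. if z \<in> B then x \<bullet> z else x \<bullet> z\<acute>"])
        show "\<forall>y\<in>carrier G. (if ?s y \<in> B then x \<bullet> ?s y else x \<bullet> (?s y)\<acute>) = y"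
          using out by (auto simp: mem G.inv_mult_group)
        show "\<forall>z\<in>carrier G. ?s (if z \<in> B then x \<bullet> z else x \<bullet> z\<acute>) = z"
        proof
          fix z assume z: "z \<in> carrier G"
          show "?s (if z \<in> B then x \<bullet> z else x \<bullet> z\<acute>) = z"
          proof (cases "z \<in> B")
            case True then show ?thesis using z by (simp add: mem)
          next
            case False
            then have "x \<bullet> z\<acute> \<in> B" using i2[of x "z\<acute>"] z mem by simp
            then show ?thesis using False z by (simp add: G.inv_mult_group G.m_assoc)
          qed
        qed
      qed auto
      then have "(f \<star> g) x = (g \<star> f) x"
      proof (rule mult_reindex[rotated 6])
        fix y assume y [simp]: "y \<in> carrier G"
        show "f y \<otimes> g (y\<acute> \<bullet> x) = g (?s y) \<otimes> f ((?s y)\<acute> \<bullet> x)"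
        proof (cases "y \<in> B")
          case True
          have "(y\<acute> \<bullet> x)\<acute> \<bullet> x = y\<acute>" using G.inverting_subgroup_conj[OF B True x] by (simp add: G.inv_mult_group)
          then have "f ((y\<acute> \<bullet> x)\<acute> \<bullet> x) = f y" using symmetric_inv fg by simp
          then show ?thesis using True fg symmetric_closed by (simp add: RG_closed R.m_comm)
        next
          case False
          have "g (x\<acute> \<bullet> y) = g (y\<acute> \<bullet> x)" using symmetric_inv[OF fg(2), of "y\<acute> \<bullet> x"] by (simp add: G.inv_mult_group)
          moreover have "(x\<acute> \<bullet> y)\<acute> \<bullet> x = y"
          proof -
            have "(x\<acute> \<bullet> y)\<acute> \<bullet> x = (y\<acute> \<bullet> x) \<bullet> x" by (simp add: G.inv_mult_group)
            also have "\<dots> = x \<bullet> (y\<acute> \<bullet> x)\<acute>" using iv out(2)[OF y False] x by blast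
            finally show ?thesis by (simp add: G.inv_mult_group)
          qed
          ultimately show ?thesis using False fg symmetric_closed by (simp add: RG_closed R.m_comm)
        qed
      qed (use fg symmetric_closed in auto)
      then show "lie_bracket RG f g x = \<zero>" using fg symmetric_closed by (intro bracket_zeroI) auto
    qed
  next
    fix d e assume de: "d \<in> carrier RG" "e \<in> carrier RG" and z: "\<forall>x\<in>carrier G - B. d x = \<zero>" "\<forall>x\<in>carrier G - B. e x = \<zero>"
    show "d \<star> e = e \<star> d"
    proof (rule RG_ext)
      fix x assume x [simp]: "x \<in> carrier G"
      show "(d \<star> e) x = (e \<star> d) x"
      proof (rule mult_reindex[where \<sigma> = "\<lambda>y. y\<acute> \<bullet> x"])
        fix y assume y [simp]: "y \<in> carrier G"
        \<comment> \<open>The substitution exchanges the factors up to conjugating y by x. The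
          conjugation is trivial if x and y both lie in the abelian B, and otherwise both sides
          vanish.\<close>
        have eq: "(y\<acute> \<bullet> x)\<acute> \<bullet> x = x\<acute> \<bullet> y \<bullet> x" by (simp add: G.inv_mult_group)
        consider "y \<in> B" "x \<in> B" | "y \<in> B" "x \<notin> B" | "y \<notin> B" by blast
        then show "d y \<otimes> e (y\<acute> \<bullet> x) = e (y\<acute> \<bullet> x) \<otimes> d ((y\<acute> \<bullet> x)\<acute> \<bullet> x)"
        proof cases
          case 1
          have "x\<acute> \<bullet> y \<bullet> x = x\<acute> \<bullet> (y \<bullet> x)" by (simp add: G.m_assoc)
          also have "y \<bullet> x = x \<bullet> y" using ab 1 by blast
          finally have "x\<acute> \<bullet> y \<bullet> x = y" by simp
          then show ?thesis using de eq by (simp add: RG_closed R.m_comm)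
        next
          case 2
          then have "e (y\<acute> \<bullet> x) = \<zero>" using z by (simp add: mem)
          then show ?thesis using de by (simp add: RG_closed)
        next
          case 3
          have "x\<acute> \<bullet> y \<bullet> x \<notin> B"
          proof (cases "x \<in> B")
            case True then show ?thesis using 3 by (simp add: mem)
          next
            case False
            then have "x\<acute> \<bullet> y \<in> B" using i2[of "x\<acute>" y] 3 by (simp add: mem)
            then show ?thesis using False by (simp add: mem)
          qed
          then show ?thesis using z 3 de eq by (simp add: RG_closed)
        qed
      qed (use de bij_inv_mult in auto)
    qed (use de mult_closed in auto)
  }
qed

lemma elementary_abelian_lie_metabelian:
  assumes H: "elementary_abelian_2_subgroup H G" and ind: "subgroup_index G H = 2"
  shows "lie_metabelian RG (symmetric_elements R G)"
proof (rule lie_metabelianI[where D = "\<lambda>d. \<forall>x\<in>carrier G. d (x\<acute>) = \<ominus> d x \<and> (x \<in> H \<longrightarrow> d x = \<zero>)"])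
  have sH: "subgroup H G" using H by (simp add: elementary_abelian_2_subgroup_def)
  have hc: "h \<in> carrier G" if "h \<in> H" for h using subgroup.mem_carrier[OF sH that] .
  have sq: "h \<bullet> h = \<one>\<^bsub>G\<^esub>" if "h \<in> H" for h using that H hc[OF that] G.pow_2[of h] by (simp add: elementary_abelian_2_subgroup_def)
  have ivh: "h\<acute> = h" if "h \<in> H" for h using sq[OF that] hc[OF that] by (intro G.inv_equality)
  have i2: "g \<bullet> h \<in> H" if "g \<in> carrier G - H" "h \<in> carrier G - H" for g h
    using ind that unfolding G.subgroup_index_2_iff[OF sH] by blast
  note mem = G.mult_mem_iff[OF sH] G.inv_mem_iff[OF sH]
  {
    fix f g assume fg: "f \<in> symmetric_elements R G" "g \<in> symmetric_elements R G"
    have "lie_bracket RG f g x = \<zero>" if x: "x \<in> H" for x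
    proof -
      have xc [simp]: "x \<in> carrier G" using hc x .
      \<comment> \<open>For y in H, exponent two gives (y^-1 x)^-1 x = y; for y outside H, the
        symmetry of f and g exchanges the factors.\<close>
      let ?s = "\<lambda>y. if y \<in> H then y\<acute> \<bullet> x else x\<acute> \<bullet> y"
      have "bij_betw ?s (carrier G) (carrier G)"
        by (rule bij_betw_byWitness[of _ "\<lambda>z. if z \<in> H then x \<bullet> z\<acute> else x \<bullet> z"])
          (use x in \<open>auto simp: mem G.inv_mult_group G.m_assoc\<close>)
      then have "(f \<star> g) x = (g \<star> f) x"
      proof (rule mult_reindex[rotated 6])
        fix y assume y [simp]: "y \<in> carrier G"
        show "f y \<otimes> g (y\<acute> \<bullet> x) = g (?s y) \<otimes> f ((?s y)\<acute> \<bullet> x)"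
        proof (cases "y \<in> H")
          case True
          have "y\<acute> \<bullet> x \<in> H" using True x by (simp add: mem)
          then have "(y\<acute> \<bullet> x)\<acute> \<bullet> x = y\<acute> \<bullet> x \<bullet> x" using ivh by simp
          also have "\<dots> = y" using True x sq[OF x] ivh[OF True] by (simp add: G.m_assoc)
          finally show ?thesis using True fg symmetric_closed by (simp add: RG_closed R.m_comm)
        next
          case False
          have "g (x\<acute> \<bullet> y) = g (y\<acute> \<bullet> x)" using symmetric_inv[OF fg(2), of "y\<acute> \<bullet> x"] by (simp add: G.inv_mult_group)
          moreover have "(x\<acute> \<bullet> y)\<acute> \<bullet> x = y\<acute>" using sq[OF x] by (simp add: G.inv_mult_group G.m_assoc)
          ultimately show ?thesis using False fg symmetric_closed symmetric_inv[OF fg(1), of y] by (simp add: RG_closed R.m_comm)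
        qed
      qed (use fg symmetric_closed in auto)
      then show ?thesis using fg symmetric_closed by (intro bracket_zeroI) auto
    qed
    then show "\<forall>x\<in>carrier G. lie_bracket RG f g (x\<acute>) = \<ominus> lie_bracket RG f g x \<and> (x \<in> H \<longrightarrow> lie_bracket RG f g x = \<zero>)"
      using bracket_symmetric_inv[OF fg] by blast
  next
    fix d e assume de: "d \<in> carrier RG" "e \<in> carrier RG"
      and d: "\<forall>x\<in>carrier G. d (x\<acute>) = \<ominus> d x \<and> (x \<in> H \<longrightarrow> d x = \<zero>)"
      and e: "\<forall>x\<in>carrier G. e (x\<acute>) = \<ominus> e x \<and> (x \<in> H \<longrightarrow> e x = \<zero>)"
    show "d \<star> e = e \<star> d"
    proof (rule RG_ext)
      fix x assume x [simp]: "x \<in> carrier G"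
      show "(d \<star> e) x = (e \<star> d) x"
      proof (rule mult_reindex[where \<sigma> = "\<lambda>y. x\<acute> \<bullet> y"])
        fix y assume y [simp]: "y \<in> carrier G"
        \<comment> \<open>A nonzero term needs y and y^-1 x outside H, which forces x into H. Then
          x^2 = 1, and the two signs from skewness cancel.\<close>
        have xy: "(x\<acute> \<bullet> y)\<acute> = y\<acute> \<bullet> x" and s: "(x\<acute> \<bullet> y)\<acute> \<bullet> x = y\<acute> \<bullet> (x \<bullet> x)"
          by (simp_all add: G.inv_mult_group G.m_assoc)
        have xx: "x \<bullet> x \<in> H" using i2[of x x] by (cases "x \<in> H") (simp_all add: mem)
        show "d y \<otimes> e (y\<acute> \<bullet> x) = e (x\<acute> \<bullet> y) \<otimes> d ((x\<acute> \<bullet> y)\<acute> \<bullet> x)"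
        proof (cases "y \<in> H")
          case True
          then have "d (y\<acute> \<bullet> (x \<bullet> x)) = \<zero>" "d y = \<zero>" using d xx by (simp_all add: mem)
          then show ?thesis using de s by (simp add: RG_closed)
        next
          case nH: False
          show ?thesis
          proof (cases "x \<in> H")
            case True
            have "e (y\<acute> \<bullet> x) = \<ominus> e (x\<acute> \<bullet> y)" unfolding xy[symmetric] using e by simp
            moreover have "d (y\<acute> \<bullet> (x \<bullet> x)) = \<ominus> d y" using d sq[OF True] by simp
            ultimately show ?thesis using de s by (simp add: RG_closed R.r_minus R.l_minus R.m_comm)
          next
            case False
            have "y\<acute> \<bullet> x \<in> H" "x\<acute> \<bullet> y \<in> H" using i2[of "y\<acute>" x] i2[of "x\<acute>" y] nH False by (simp_all add: mem)
            then have "e (y\<acute> \<bullet> x) = \<zero>" "e (x\<acute> \<bullet> y) = \<zero>" using e by simp_all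
            then show ?thesis using de by (simp add: RG_closed)
          qed
        qed
      qed (use de bij_mult_left in auto)
    qed (use de mult_closed in auto)
  }
qed

end

section \<open>Groups whose center has index four and consists of the elements with trivial
  square\<close>

locale center_index_4_group = group +
  assumes center_involutions: "z \<in> carrier G \<Longrightarrow> z \<in> center G \<longleftrightarrow> z \<otimes> z = \<one>"
    and center_index: "subgroup_index G (center G) = 4"
begin

lemma center_commute: "z \<in> center G \<Longrightarrow> g \<in> carrier G \<Longrightarrow> z \<otimes> g = g \<otimes> z"
  by (simp add: center_def)

lemma center_carrier: "z \<in> center G \<Longrightarrow> z \<in> carrier G"
  by (simp add: center_def)

lemma commute_center_mult_iff:
  assumes z: "z \<in> center G" and [simp]: "b \<in> carrier G" "h \<in> carrier G"
  shows "z \<otimes> b \<otimes> h = h \<otimes> (z \<otimes> b) \<longleftrightarrow> b \<otimes> h = h \<otimes> b"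
proof -
  have [simp]: "z \<in> carrier G" by (rule center_carrier[OF z])
  have "h \<otimes> (z \<otimes> b) = (h \<otimes> z) \<otimes> b" by (simp add: m_assoc)
  also have "h \<otimes> z = z \<otimes> h" using center_commute[OF z, of h] by simp
  finally have "h \<otimes> (z \<otimes> b) = z \<otimes> (h \<otimes> b)" by (simp add: m_assoc)
  then have "z \<otimes> b \<otimes> h = h \<otimes> (z \<otimes> b) \<longleftrightarrow> z \<otimes> (b \<otimes> h) = z \<otimes> (h \<otimes> b)" by (simp add: m_assoc)
  then show ?thesis by simp
qed

text \<open>Cosets of the center are told apart by which elements they commute with. Thus
  noncommuting x and y make the cosets of 1, x, y and x y distinct, and index four leaves no
  others.\<close>

lemma coset_cases:
  assumes [simp]: "x \<in> carrier G" "y \<in> carrier G" and w: "w \<in> carrier G" and xy: "x \<otimes> y \<noteq> y \<otimes> x"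
  obtains z where "z \<in> center G" "w = z" | z where "z \<in> center G" "w = z \<otimes> x"
    | z where "z \<in> center G" "w = z \<otimes> y" | z where "z \<in> center G" "w = z \<otimes> (x \<otimes> y)"
proof -
  let ?Z = "center G"
  have neq: "?Z #> a \<noteq> ?Z #> b" if [simp]: "a \<in> carrier G" "b \<in> carrier G" "h \<in> carrier G"
    and ne: "(a \<otimes> h = h \<otimes> a) \<noteq> (b \<otimes> h = h \<otimes> b)" for a b h
  proof
    assume "?Z #> a = ?Z #> b"
    then have "a \<in> ?Z #> b" using rcos_self[of a ?Z] subgroup_center by simp
    then obtain z where z: "z \<in> ?Z" "a = z \<otimes> b" unfolding r_coset_def by blast
    show False using ne commute_center_mult_iff[OF z(1), of b h] z(2) by simp
  qed
  have n1: "x \<otimes> y \<otimes> x \<noteq> x \<otimes> (x \<otimes> y)" using xy by (simp add: m_assoc)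
  have n2: "x \<otimes> y \<otimes> y \<noteq> y \<otimes> (x \<otimes> y)"
  proof
    assume "x \<otimes> y \<otimes> y = y \<otimes> (x \<otimes> y)"
    then have "x \<otimes> y \<otimes> y = y \<otimes> x \<otimes> y" by (simp add: m_assoc)
    then show False using xy r_cancel[of "x \<otimes> y" y "y \<otimes> x"] by simp
  qed
  let ?C = "{?Z #> \<one>, ?Z #> x, ?Z #> y, ?Z #> (x \<otimes> y)}"
  have d: "?Z #> \<one> \<noteq> ?Z #> x" by (rule neq[of _ _ y]) (simp_all add: xy)
  have e: "?Z #> \<one> \<noteq> ?Z #> y" by (rule neq[of _ _ x]) (simp_all add: xy[symmetric])
  have f: "?Z #> \<one> \<noteq> ?Z #> (x \<otimes> y)" by (rule neq[of _ _ x]) (simp_all add: n1)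
  have g: "?Z #> x \<noteq> ?Z #> y" by (rule neq[of _ _ y]) (simp_all add: xy)
  have h: "?Z #> x \<noteq> ?Z #> (x \<otimes> y)" by (rule neq[of _ _ x]) (simp_all add: n1)
  have i: "?Z #> y \<noteq> ?Z #> (x \<otimes> y)" by (rule neq[of _ _ y]) (simp_all add: n2)
  have "card ?C = 4" using d e f g h i by simp
  moreover have "?C \<subseteq> rcosets ?Z" using rcosetsI[OF subgroup.subset[OF subgroup_center]] by simp
  moreover have "card (rcosets ?Z) = 4" using center_index by (simp add: subgroup_index_def)
  moreover from this have "finite (rcosets ?Z)" by (intro card_ge_0_finite) simp
  ultimately have C: "rcosets ?Z = ?C" using card_subset_eq[of "rcosets ?Z" ?C] by simp
  have "?Z #> w \<in> ?C" unfolding C[symmetric] by (rule rcosetsI[OF subgroup.subset[OF subgroup_center] w])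
  moreover have "w \<in> ?Z #> w" using w subgroup_center by (rule rcos_self)
  ultimately have "w \<in> ?Z #> \<one> \<or> w \<in> ?Z #> x \<or> w \<in> ?Z #> y \<or> w \<in> ?Z #> (x \<otimes> y)" by blast
  then consider z where "z \<in> ?Z" "w = z \<otimes> \<one>" | z where "z \<in> ?Z" "w = z \<otimes> x"
    | z where "z \<in> ?Z" "w = z \<otimes> y" | z where "z \<in> ?Z" "w = z \<otimes> (x \<otimes> y)"
    unfolding r_coset_def by blast
  then show ?thesis using that center_carrier by cases auto
qed

text \<open>For noncentral g choose h not commuting with g. As g^2 commutes with g, it is not in the
  coset of h or g h; and in the coset of g it would make g central.\<close>

lemma sq_in_center:
  assumes g: "g \<in> carrier G" shows "g \<otimes> g \<in> center G"
proof (cases "g \<in> center G")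
  case True then show ?thesis using center_involutions[OF g] subgroup.one_closed[OF subgroup_center] by simp
next
  case False
  then obtain h where h: "h \<in> carrier G" "g \<otimes> h \<noteq> h \<otimes> g" using g unfolding center_def by blast
  have gg: "g \<otimes> g \<otimes> g = g \<otimes> (g \<otimes> g)" using g by (simp add: m_assoc)
  have gg': "g \<otimes> g \<in> carrier G" using g by simp
  show ?thesis
  proof (rule coset_cases[OF g h(1) gg' h(2)])
    fix z assume "z \<in> center G" "g \<otimes> g = z" then show ?thesis by simp
  next
    fix z assume z: "z \<in> center G" "g \<otimes> g = z \<otimes> g"
    then show ?thesis using False g center_carrier[OF z(1)] by simp
  next
    fix z assume z: "z \<in> center G" "g \<otimes> g = z \<otimes> h"
    then show ?thesis using commute_center_mult_iff[OF z(1) h(1) g] gg h(2) by simp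
  next
    fix z assume z: "z \<in> center G" "g \<otimes> g = z \<otimes> (g \<otimes> h)"
    have "g \<otimes> h \<otimes> g = g \<otimes> (g \<otimes> h)" using commute_center_mult_iff[OF z(1) _ g, of "g \<otimes> h"] gg h(1) g z(2) by simp
    then show ?thesis using h g by (simp add: m_assoc)
  qed
qed

sublocale central_square_group G
proof
  fix x assume x: "x \<in> carrier G"
  show "x \<otimes> x \<otimes> (x \<otimes> x) = \<one>" using center_involutions[of "x \<otimes> x"] sq_in_center[OF x] x by simp
  show "x \<otimes> x \<otimes> g = g \<otimes> (x \<otimes> x)" if "g \<in> carrier G" for g using center_commute[OF sq_in_center[OF x] that] .
qed

lemma center_Om: "z \<in> center G \<Longrightarrow> z \<in> Om"
  using center_involutions[of z] center_carrier[of z] center_commute[of z] unfolding Om_def by blast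

lemma com_coset_cases:
  assumes x: "x \<in> carrier G" and y: "y \<in> carrier G" and w: "w \<in> carrier G" and xy: "com x y \<noteq> \<one>"
  obtains z where "z \<in> Om" "w = z" | z where "z \<in> Om" "w = z \<otimes> x"
    | z where "z \<in> Om" "w = z \<otimes> y" | z where "z \<in> Om" "w = z \<otimes> (x \<otimes> y)"
proof -
  have ne: "x \<otimes> y \<noteq> y \<otimes> x" using xy com_one_iff[OF x y] by simp
  show ?thesis
    by (rule coset_cases[OF x y w ne])
      (erule that(1)[OF center_Om], assumption, erule that(2)[OF center_Om], assumption,
       erule that(3)[OF center_Om], assumption, erule that(4)[OF center_Om], assumption)
qed

text \<open>In the cosets of 1, p, y and p y, the commutator with y takes only the values 1 and
  \<open>com p y\<close>.\<close>

lemma com_unique: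
  assumes [simp]: "v \<in> carrier G" "y \<in> carrier G" "p \<in> carrier G" and py: "com p y \<noteq> \<one>" and vy: "com v y \<noteq> \<one>"
  shows "com v y = com p y"
proof (rule com_coset_cases[of p y v])
  fix z assume "z \<in> Om" "v = z" then show ?thesis using vy com_Om_left by simp
qed (use vy py in \<open>simp_all add: com_mult_left com_Om_left Om_carrier\<close>)

text \<open>Only the coset of p commutes with p but not with y, so u is p times a central involution
  or 1.\<close>

lemma same_coset_sq:
  assumes [simp]: "u \<in> carrier G" "y \<in> carrier G" "p \<in> carrier G" and py: "com p y \<noteq> \<one>"
    and up: "com u p = \<one>" and uy: "com u y \<noteq> \<one>"
  shows "u \<otimes> u = p \<otimes> p"
proof (rule com_coset_cases[of p y u])
  have yp: "com y p \<noteq> \<one>" using py com_sym[of p y] by simp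
  fix z assume z: "z \<in> Om"
  note s = com_mult_left com_Om_left[OF z] Om_carrier[OF z]
  show ?thesis if "u = z" using that uy s by simp
  show ?thesis if "u = z \<otimes> y" using that up yp by (simp add: s)
  show ?thesis if "u = z \<otimes> (p \<otimes> y)" using that up yp by (simp add: s)
  show ?thesis if "u = z \<otimes> p" using that Om_sq[OF z] by (simp add: sq_mult[of z p] s)
qed (simp_all add: py)

end

context group_ring_setup begin

text \<open>In \<open>[f, g] (y)\<close> the terms of \<open>f g\<close> and \<open>g f\<close> indexed by \<open>v\<close> commuting with \<open>y\<close> cancel; \<open>T\<close> collects the others.\<close>

lemma center_index_4_lie_metabelian:
  assumes "center_index_4_group G"
  shows "lie_metabelian RG (symmetric_elements R G)"
proof -
  interpret Q: center_index_4_group G by fact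
  let ?W = "\<lambda>y. {v \<in> carrier G. Q.com v y \<noteq> \<one>\<^bsub>G\<^esub>}"
  define T where "T f g y = partial_product f g (?W y) y" for f g y
  have bracket: "lie_bracket RG f g y = T f g y \<ominus> T g f y"
    if f: "f \<in> carrier RG" and g: "g \<in> carrier RG" and y: "y \<in> carrier G" for f g y
  proof -
    let ?V = "carrier G - ?W y"
    have "partial_product f g ?V y = partial_product g f ?V y"
    proof (rule partial_product_reindex[OF f g g f y y])
      have V: "v\<acute> \<bullet> y \<in> ?V" "y \<bullet> v\<acute> \<in> ?V" if "v \<in> ?V" for v using that y by (simp_all add: Q.com_mult_left Q.com_inv_left)
      show "bij_betw (\<lambda>v. v\<acute> \<bullet> y) ?V ?V"
        by (rule bij_betw_byWitness[of _ "\<lambda>v. y \<bullet> v\<acute>"]) (use y V in \<open>auto simp: G.inv_mult_group G.m_assoc\<close>)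
      fix v assume v: "v \<in> ?V"
      then have vc: "v \<in> carrier G" and "Q.com v y = \<one>\<^bsub>G\<^esub>" by auto
      then have vy: "v \<bullet> y = y \<bullet> v" using Q.com_one_iff[OF vc y] by simp
      have "(v\<acute> \<bullet> y)\<acute> \<bullet> y = y\<acute> \<bullet> (v \<bullet> y)" using vc y by (simp add: G.inv_mult_group G.m_assoc)
      also have "\<dots> = v" unfolding vy using vc y by simp
      finally show "f v \<otimes> g (v\<acute> \<bullet> y) = g (v\<acute> \<bullet> y) \<otimes> f ((v\<acute> \<bullet> y)\<acute> \<bullet> y)"
        using f g vc y by (simp add: RG_closed R.m_comm)
    qed auto
    then have "(f \<star> g) y = T f g y \<oplus> partial_product f g ?V y" "(g \<star> f) y = T g f y \<oplus> partial_product f g ?V y"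
      using mult_split[OF f g y, of "?W y"] mult_split[OF g f y, of "?W y"] by (simp_all add: T_def)
    moreover have "a \<oplus> c \<ominus> (b \<oplus> c) = a \<ominus> b" if [simp]: "a \<in> carrier R" "b \<in> carrier R" "c \<in> carrier R" for a b c
    proof -
      have "a \<oplus> c \<ominus> (b \<oplus> c) = a \<oplus> c \<oplus> (\<ominus> c \<oplus> \<ominus> b)" by (simp add: R.minus_eq R.minus_add R.a_comm)
      also have "\<dots> = a \<oplus> (c \<oplus> \<ominus> c) \<oplus> \<ominus> b" by (simp only: R.a_assoc R.add.m_closed R.a_inv_closed that)
      finally show ?thesis by (simp add: R.minus_eq R.r_neg)
    qed
    ultimately show ?thesis using bracket_coeff[OF f g y] partial_product_closed[OF f g y] partial_product_closed[OF g f y]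
      by (simp add: T_def)
  qed
  have Tcl: "T f g y \<in> carrier R" if "f \<in> carrier RG" "g \<in> carrier RG" "y \<in> carrier G" for f g y
    unfolding T_def using that by (rule partial_product_closed)
  have shift: "T f g (y \<bullet> (p \<bullet> p)) = T f g y"
    if f: "f \<in> symmetric_elements R G" and g: "g \<in> symmetric_elements R G"
      and y [simp]: "y \<in> carrier G" and p [simp]: "p \<in> carrier G" and py: "Q.com p y \<noteq> \<one>\<^bsub>G\<^esub>" for f g y p
    unfolding T_def
  proof (rule partial_product_reindex)
    \<comment> \<open>If v is in the coset of p, then v^2 = p^2 and inverting v absorbs the factor
      p^2. Otherwise v^-1 y is in that coset, and multiplying it by p^2 inverts it. The symmetry of
      f or g hides the inversion.\<close>
    let ?s = "\<lambda>v. if Q.com v p = \<one>\<^bsub>G\<^esub> then v\<acute> else v"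
    have W: "?W (y \<bullet> (p \<bullet> p)) = ?W y"
      using Q.com_Om_right[OF Q.sq_Om[OF p]] by (auto simp: Q.com_mult_right)
    have "bij_betw ?s (?W y) (?W y)"
      by (rule bij_betw_byWitness[of _ ?s]) (auto simp: Q.com_inv_left)
    then show "bij_betw ?s (?W (y \<bullet> (p \<bullet> p))) (?W y)" unfolding W .
    fix v assume "v \<in> ?W (y \<bullet> (p \<bullet> p))"
    then have v [simp]: "v \<in> carrier G" and vy: "Q.com v y \<noteq> \<one>\<^bsub>G\<^esub>" unfolding W by auto
    show "f v \<otimes> g (v\<acute> \<bullet> (y \<bullet> (p \<bullet> p))) = f (?s v) \<otimes> g ((?s v)\<acute> \<bullet> y)"
    proof (cases "Q.com v p = \<one>\<^bsub>G\<^esub>")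
      case True
      have vv: "v \<bullet> v = p \<bullet> p" using Q.same_coset_sq[OF v y p py True vy] .
      have "v\<acute> \<bullet> (y \<bullet> (p \<bullet> p)) = v \<bullet> ((v \<bullet> v) \<bullet> (y \<bullet> (p \<bullet> p)))" by (simp add: Q.inv_exp4 G.m_assoc)
      also have "(v \<bullet> v) \<bullet> (y \<bullet> (p \<bullet> p)) = y \<bullet> ((p \<bullet> p) \<bullet> (p \<bullet> p))" unfolding vv
        using Q.Om_lcomm[OF Q.sq_Om[OF p] y, of "p \<bullet> p"] by simp
      also have "\<dots> = y" using Q.exp4[OF p] by simp
      finally show ?thesis using True symmetric_inv[OF f v] by simp
    next
      case False
      let ?u = "v\<acute> \<bullet> y"
      have yp: "Q.com y p \<noteq> \<one>\<^bsub>G\<^esub>" using py Q.com_sym[OF p y] by simp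
      have "Q.com v p = Q.com y p" using Q.com_unique[OF v p y yp False] .
      then have "Q.com ?u p = \<one>\<^bsub>G\<^esub>" using Q.Om_sq[OF Q.com_Om[OF y p]] by (simp add: Q.com_mult_left Q.com_inv_left)
      moreover have "Q.com ?u y \<noteq> \<one>\<^bsub>G\<^esub>" using vy by (simp add: Q.com_mult_left Q.com_inv_left)
      ultimately have uu: "?u \<bullet> ?u = p \<bullet> p" using Q.same_coset_sq[of ?u y p] py by simp
      have "v\<acute> \<bullet> (y \<bullet> (p \<bullet> p)) = ?u \<bullet> (p \<bullet> p)" by (simp add: G.m_assoc)
      also have "\<dots> = ?u\<acute>" using Q.inv_exp4[of ?u] uu by simp
      finally show ?thesis using False symmetric_inv[OF g, of ?u] by simp
    qed
  qed (use that symmetric_closed in auto)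
  \<comment> \<open>By \<open>com_unique\<close>, y times \<open>com y p\<close> is the conjugate
    v^-1 y v for every v in the index set; squares being central, v^-2 y v = y v^-1.\<close>
  have twist: "T f g (y \<bullet> Q.com y p) = T g f y"
    if f: "f \<in> symmetric_elements R G" and g: "g \<in> symmetric_elements R G"
      and y [simp]: "y \<in> carrier G" and p [simp]: "p \<in> carrier G" and py: "Q.com p y \<noteq> \<one>\<^bsub>G\<^esub>" for f g y p
    unfolding T_def
  proof (rule partial_product_reindex)
    have W: "?W (y \<bullet> Q.com y p) = ?W y"
      using Q.com_Om_right[OF Q.com_Om[OF y p]] by (auto simp: Q.com_mult_right)
    have "bij_betw (\<lambda>v. y \<bullet> v\<acute>) (?W y) (?W y)"
      by (rule bij_betw_byWitness[of _ "\<lambda>v. v\<acute> \<bullet> y"]) (auto simp: Q.com_inv_left Q.com_mult_left G.inv_mult_group G.m_assoc)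
    then show "bij_betw (\<lambda>v. y \<bullet> v\<acute>) (?W (y \<bullet> Q.com y p)) (?W y)" unfolding W .
    fix v assume "v \<in> ?W (y \<bullet> Q.com y p)"
    then have v [simp]: "v \<in> carrier G" and vy: "Q.com v y \<noteq> \<one>\<^bsub>G\<^esub>" unfolding W by auto
    have "Q.com y p = Q.com y v"
      using Q.com_unique[OF v y p py vy] Q.com_sym[OF v y] Q.com_sym[OF p y] by simp
    then have "v\<acute> \<bullet> (y \<bullet> Q.com y p) = v\<acute> \<bullet> (v\<acute> \<bullet> (v \<bullet> y \<bullet> Q.com y v))" by (simp add: G.m_assoc)
    also have "v \<bullet> y \<bullet> Q.com y v = y \<bullet> v" by (rule Q.com_swap[symmetric]) simp_all
    also have "v\<acute> \<bullet> (v\<acute> \<bullet> (y \<bullet> v)) = (v\<acute> \<bullet> v\<acute>) \<bullet> (y \<bullet> v)" by (simp add: G.m_assoc)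
    also have "\<dots> = y \<bullet> v \<bullet> (v\<acute> \<bullet> v\<acute>)" by (rule Q.sq_central) simp_all
    also have "\<dots> = y \<bullet> v\<acute>" by (simp add: G.m_assoc)
    finally have 1: "v\<acute> \<bullet> (y \<bullet> Q.com y p) = y \<bullet> v\<acute>" .
    have 2: "(y \<bullet> v\<acute>)\<acute> \<bullet> y = v" by (simp add: G.inv_mult_group G.m_assoc)
    show "f v \<otimes> g (v\<acute> \<bullet> (y \<bullet> Q.com y p)) = g (y \<bullet> v\<acute>) \<otimes> f ((y \<bullet> v\<acute>)\<acute> \<bullet> y)"
      unfolding 1 2 using f g symmetric_closed by (simp add: RG_closed R.m_comm)
  qed (use that symmetric_closed in auto)
  \<comment> \<open>\<open>twist\<close> interchanges the two terms of a commutator, which accounts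
    for the sign in the last identity.\<close>
  define D where "D d \<longleftrightarrow> (\<forall>y\<in>carrier G. d (y\<acute>) = \<ominus> d y) \<and>
      (\<forall>y\<in>carrier G. \<forall>p\<in>carrier G. Q.com p y \<noteq> \<one>\<^bsub>G\<^esub> \<longrightarrow> d (y \<bullet> (p \<bullet> p)) = d y \<and> d (y \<bullet> Q.com y p) = \<ominus> d y)" for d
  show ?thesis
  proof (rule lie_metabelianI[where D = D])
    fix f g assume fg: "f \<in> symmetric_elements R G" "g \<in> symmetric_elements R G"
    note cl = symmetric_closed[OF fg(1)] symmetric_closed[OF fg(2)]
    have "lie_bracket RG f g (y \<bullet> (p \<bullet> p)) = lie_bracket RG f g y \<and> lie_bracket RG f g (y \<bullet> Q.com y p) = \<ominus> lie_bracket RG f g y"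
      if y: "y \<in> carrier G" and p: "p \<in> carrier G" and py: "Q.com p y \<noteq> \<one>\<^bsub>G\<^esub>" for y p
      using bracket[OF cl] y p shift[OF fg y p py] shift[OF fg(2,1) y p py] twist[OF fg y p py] twist[OF fg(2,1) y p py]
        R.minus_swap[OF Tcl[OF cl y] Tcl[OF cl(2,1) y]] by simp
    then show "D (lie_bracket RG f g)"
      unfolding D_def using bracket_symmetric_inv[OF fg] by blast
  next
    fix d e assume de: "d \<in> carrier RG" "e \<in> carrier RG"
      and D: "D d" "D e"
    note d = D(1)[unfolded D_def] and e = D(2)[unfolded D_def]
    show "d \<star> e = e \<star> d"
    proof (rule RG_ext)
      fix x assume x [simp]: "x \<in> carrier G"
      \<comment> \<open>If x and y do not commute, y x = (y^-1 x) y^2, a translation that leaves e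
        unchanged, while (y x)^-1 x is a conjugate of y^-1, for which the signs of d from
        conjugation and inversion cancel.\<close>
      let ?s = "\<lambda>y. if Q.com y x = \<one>\<^bsub>G\<^esub> then y\<acute> \<bullet> x else y \<bullet> x"
      have "bij_betw ?s (carrier G) (carrier G)"
        by (rule bij_betw_byWitness[of _ "\<lambda>z. if Q.com z x = \<one>\<^bsub>G\<^esub> then x \<bullet> z\<acute> else z \<bullet> x\<acute>"])
          (auto simp: Q.com_inv_left Q.com_mult_left G.inv_mult_group G.m_assoc)
      then show "(d \<star> e) x = (e \<star> d) x"
      proof (rule mult_reindex[rotated 6])
        fix y assume y [simp]: "y \<in> carrier G"
        show "d y \<otimes> e (y\<acute> \<bullet> x) = e (?s y) \<otimes> d ((?s y)\<acute> \<bullet> x)"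
        proof (cases "Q.com y x = \<one>\<^bsub>G\<^esub>")
          case True
          then have yx: "y \<bullet> x = x \<bullet> y" using Q.com_one_iff[OF y x] by simp
          have "(y\<acute> \<bullet> x)\<acute> \<bullet> x = x\<acute> \<bullet> (y \<bullet> x)" by (simp add: G.inv_mult_group G.m_assoc)
          also have "\<dots> = y" unfolding yx by simp
          finally show ?thesis using True de by (simp add: RG_closed R.m_comm)
        next
          case False
          have "y \<bullet> x = y\<acute> \<bullet> (y \<bullet> y \<bullet> x)" by (simp add: G.m_assoc)
          also have "y \<bullet> y \<bullet> x = x \<bullet> (y \<bullet> y)" by (rule Q.sq_central[OF y x])
          finally have "y \<bullet> x = y\<acute> \<bullet> x \<bullet> (y \<bullet> y)" by (simp add: G.m_assoc)
          moreover have "Q.com y (y\<acute> \<bullet> x) \<noteq> \<one>\<^bsub>G\<^esub>" using False Q.com_sym[of "y\<acute>" y]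
            by (simp add: Q.com_mult_right Q.com_inv_left)
          ultimately have 1: "e (y \<bullet> x) = e (y\<acute> \<bullet> x)" using e by simp
          have "(y \<bullet> x)\<acute> \<bullet> x = y\<acute> \<bullet> Q.com (y\<acute>) x"
          proof -
            have "(y \<bullet> x)\<acute> \<bullet> x = x\<acute> \<bullet> (y\<acute> \<bullet> x)" by (simp add: G.inv_mult_group G.m_assoc)
            also have "y\<acute> \<bullet> x = x \<bullet> y\<acute> \<bullet> Q.com (y\<acute>) x" by (rule Q.com_swap) simp_all
            also have "x\<acute> \<bullet> (x \<bullet> y\<acute> \<bullet> Q.com (y\<acute>) x) = y\<acute> \<bullet> Q.com (y\<acute>) x" by (simp add: G.m_assoc)
            finally show ?thesis .
          qed
          moreover have "Q.com x (y\<acute>) \<noteq> \<one>\<^bsub>G\<^esub>" using False Q.com_sym[of "y\<acute>" x] by (simp add: Q.com_inv_left)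
          ultimately have "d ((y \<bullet> x)\<acute> \<bullet> x) = \<ominus> (\<ominus> d y)" using d by simp
          then have 2: "d ((y \<bullet> x)\<acute> \<bullet> x) = d y" using de by (simp add: RG_closed)
          show ?thesis using False de 1 2 by (simp add: RG_closed R.m_comm)
        qed
      qed (use de in auto)
    qed (use de mult_closed in auto)
  qed
qed

theorem lie_metabelian_of_type:
  assumes "G.lie_metabelian_type"
  shows "lie_metabelian RG (symmetric_elements R G)"
  using assms unfolding G.lie_metabelian_type_def
proof (elim disjE exE conjE)
  assume "comm_group (G\<lparr>carrier := generate G {g \<in> carrier G. g [^]\<^bsub>G\<^esub> (2::nat) \<noteq> \<one>\<^bsub>G\<^esub>}\<rparr>)"
  then obtain B where "G.inverting_subgroup B" using G.inverting_subgroup_of_generated by blast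
  then show ?thesis by (rule inverting_lie_metabelian)
next
  fix H assume "elementary_abelian_2_subgroup H G" "subgroup_index G H = 2"
  then show ?thesis by (rule elementary_abelian_lie_metabelian)
next
  fix B x assume "subgroup B G" "comm_group (G\<lparr>carrier := B\<rparr>)" "subgroup_index G B = 2" "x \<in> carrier G" "G.ord x = 4"
    "\<forall>b\<in>B. x\<acute> \<bullet> b \<bullet> x = b\<acute>"
  then show ?thesis by (intro inverting_lie_metabelian G.inverting_subgroup_of_order_4)
next
  assume c: "center G = {g \<in> carrier G. g [^]\<^bsub>G\<^esub> (2::nat) = \<one>\<^bsub>G\<^esub>}" and i: "subgroup_index G (center G) = 4"
  have "center_index_4_group G"
    by unfold_locales (use i in \<open>simp_all add: c G.pow_2\<close>)
  then show ?thesis by (rule center_index_4_lie_metabelian)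
qed

subsection \<open>Positivity of the trace\<close>

definition integral :: "('g \<Rightarrow> 'r) set" where
  "integral = {f \<in> carrier RG. \<forall>x\<in>carrier G. f x \<in> range R.of_integer}"

lemma integral_closed: "f \<in> integral \<Longrightarrow> f \<in> carrier RG"
  by (simp add: integral_def)

lemma integral_coeff:
  assumes "f \<in> integral" obtains n where "\<And>x. x \<in> carrier G \<Longrightarrow> f x = R.of_integer (n x)"
proof -
  have "\<forall>x\<in>carrier G. \<exists>n. f x = R.of_integer n" using assms unfolding integral_def by blast
  then show ?thesis using that by metis
qed

lemma integralI:
  assumes "f \<in> carrier RG" "\<And>x. x \<in> carrier G \<Longrightarrow> \<exists>n. f x = R.of_integer n" shows "f \<in> integral"
  using assms unfolding integral_def by blast

lemma integral_add:
  assumes f: "f \<in> integral" and g: "g \<in> integral" shows "f \<oplus>\<^bsub>RG\<^esub> g \<in> integral"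
proof -
  obtain m n where "\<And>x. x \<in> carrier G \<Longrightarrow> f x = R.of_integer (m x)" "\<And>x. x \<in> carrier G \<Longrightarrow> g x = R.of_integer (n x)"
    using integral_coeff f g by metis
  then have "(f \<oplus>\<^bsub>RG\<^esub> g) x = R.of_integer (m x + n x)" if "x \<in> carrier G" for x
    using that by (simp add: add_coeff R.of_integer_add)
  then show ?thesis using f g integral_closed by (intro integralI) auto
qed

lemma integral_neg:
  assumes f: "f \<in> integral" shows "\<ominus>\<^bsub>RG\<^esub> f \<in> integral"
proof -
  obtain m where "\<And>x. x \<in> carrier G \<Longrightarrow> f x = R.of_integer (m x)" using integral_coeff f by metis
  then have "(\<ominus>\<^bsub>RG\<^esub> f) x = R.of_integer (- m x)" if "x \<in> carrier G" for x
    using that integral_closed[OF f] by (simp add: neg_coeff R.of_integer_minus)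
  then show ?thesis using f integral_closed by (intro integralI) auto
qed

lemma integral_mult:
  assumes f: "f \<in> integral" and g: "g \<in> integral" shows "f \<star> g \<in> integral"
proof -
  obtain m where m: "\<And>x. x \<in> carrier G \<Longrightarrow> f x = R.of_integer (m x)" using integral_coeff f by metis
  obtain n where n: "\<And>x. x \<in> carrier G \<Longrightarrow> g x = R.of_integer (n x)" using integral_coeff g by metis
  note cl = integral_closed[OF f] integral_closed[OF g]
  have sc: "y \<in> carrier G" if "y \<in> supp R G f" for y using that by (simp add: supp_def)
  have "(f \<star> g) x = R.of_integer (\<Sum>y\<in>supp R G f. m y * n (y\<acute> \<bullet> x))" if x: "x \<in> carrier G" for x
  proof -
    have "(f \<star> g) x = (\<Oplus>y\<in>supp R G f. f y \<otimes> g (y\<acute> \<bullet> x))"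
      using mult_coeff[OF cl x RG_finite[OF cl(1)]] by (simp add: supp_def)
    also have "\<dots> = R.of_integer (\<Sum>y\<in>supp R G f. m y * n (y\<acute> \<bullet> x))"
      using x sc by (intro R.finsum_of_integer RG_finite cl) (simp add: m n R.of_integer_mult)
    finally show ?thesis .
  qed
  then show ?thesis using mult_closed[OF cl] by (intro integralI) auto
qed

lemma integral_bracket: "f \<in> integral \<Longrightarrow> g \<in> integral \<Longrightarrow> lie_bracket RG f g \<in> integral"
  unfolding lie_bracket_def RG.minus_eq by (intro integral_add integral_mult integral_neg)

section \<open>The involution and the grading by symmetric and skew elements\<close>

abbreviation star where "star \<equiv> classical_involution G"

lemma star_coeff: "x \<in> carrier G \<Longrightarrow> star f x = f (x\<acute>)"
  by (simp add: classical_involution_def)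

lemma star_add:
  assumes "f \<in> carrier RG" "g \<in> carrier RG" shows "star (f \<oplus>\<^bsub>RG\<^esub> g) = star f \<oplus>\<^bsub>RG\<^esub> star g"
  by (rule RG_ext) (use assms in \<open>simp_all add: involution_closed star_coeff add_coeff\<close>)

lemma star_neg:
  assumes "f \<in> carrier RG" shows "star (\<ominus>\<^bsub>RG\<^esub> f) = \<ominus>\<^bsub>RG\<^esub> star f"
  by (rule RG_ext) (use assms in \<open>simp_all add: involution_closed star_coeff neg_coeff\<close>)

lemma star_mult:
  assumes f: "f \<in> carrier RG" and g: "g \<in> carrier RG" shows "star (f \<star> g) = star g \<star> star f"
proof (rule RG_ext)
  fix x assume x: "x \<in> carrier G"
  have "(f \<star> g) (x\<acute>) = (star g \<star> star f) x"
  proof (rule mult_reindex[where \<sigma> = "\<lambda>y. x \<bullet> y"])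
    fix y assume y: "y \<in> carrier G"
    show "f y \<otimes> g (y\<acute> \<bullet> x\<acute>) = star g (x \<bullet> y) \<otimes> star f ((x \<bullet> y)\<acute> \<bullet> x)"
      using x y f g by (simp add: star_coeff G.inv_mult_group G.m_assoc RG_closed R.m_comm)
  qed (use f g x involution_closed bij_mult_left in auto)
  then show "star (f \<star> g) x = (star g \<star> star f) x" using x by (simp add: star_coeff)
qed (use f g involution_closed mult_closed in auto)

text \<open>Integer coefficients are built in, so this is in general smaller than
  \<open>symmetric_elements R G\<close>.\<close>

definition symm where "symm = {f \<in> integral. star f = f}"
definition skew where "skew = {f \<in> integral. star f = \<ominus>\<^bsub>RG\<^esub> f}"

lemma symm_closed: "f \<in> symm \<Longrightarrow> f \<in> carrier RG" by (simp add: symm_def integral_closed)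
lemma skew_closed: "f \<in> skew \<Longrightarrow> f \<in> carrier RG" by (simp add: skew_def integral_closed)
lemma symm_symmetric: "f \<in> symm \<Longrightarrow> f \<in> symmetric_elements R G"
  by (simp add: symm_def symmetric_elements_def integral_closed)

lemma star_bracket:
  assumes "f \<in> carrier RG" "g \<in> carrier RG"
  shows "star (lie_bracket RG f g) = lie_bracket RG (star g) (star f)"
  using assms by (simp add: lie_bracket_def RG.minus_eq star_add star_neg star_mult)

lemma bracket_symm_symm: "s \<in> symm \<Longrightarrow> t \<in> symm \<Longrightarrow> lie_bracket RG s t \<in> skew"
proof -
  assume st: "s \<in> symm" "t \<in> symm"
  have "lie_bracket RG t s = \<ominus>\<^bsub>RG\<^esub> lie_bracket RG s t"
    using symm_closed[OF st(1)] symm_closed[OF st(2)] unfolding lie_bracket_def by algebra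
  then show ?thesis using st symm_closed by (simp add: skew_def integral_bracket symm_def star_bracket)
qed

lemma bracket_symm_skew: "s \<in> symm \<Longrightarrow> k \<in> skew \<Longrightarrow> lie_bracket RG s k \<in> symm"
proof -
  assume st: "s \<in> symm" "k \<in> skew"
  have "lie_bracket RG (\<ominus>\<^bsub>RG\<^esub> k) s = lie_bracket RG s k"
    using symm_closed[OF st(1)] skew_closed[OF st(2)] unfolding lie_bracket_def by algebra
  then show ?thesis using st symm_closed skew_closed by (simp add: symm_def integral_bracket skew_def star_bracket)
qed

lemma bracket_skew_skew: "k \<in> skew \<Longrightarrow> l \<in> skew \<Longrightarrow> lie_bracket RG k l \<in> skew"
proof -
  assume st: "k \<in> skew" "l \<in> skew"
  have "lie_bracket RG (\<ominus>\<^bsub>RG\<^esub> l) (\<ominus>\<^bsub>RG\<^esub> k) = \<ominus>\<^bsub>RG\<^esub> lie_bracket RG k l"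
    using skew_closed[OF st(1)] skew_closed[OF st(2)] unfolding lie_bracket_def by algebra
  then show ?thesis using st skew_closed by (simp add: integral_bracket skew_def star_bracket)
qed

lemma jordan_skew_skew: "k \<in> skew \<Longrightarrow> l \<in> skew \<Longrightarrow> k \<star> l \<oplus>\<^bsub>RG\<^esub> l \<star> k \<in> symm"
proof -
  assume st: "k \<in> skew" "l \<in> skew"
  note cl = skew_closed[OF st(1)] skew_closed[OF st(2)]
  have "star (k \<star> l \<oplus>\<^bsub>RG\<^esub> l \<star> k) =
    (\<ominus>\<^bsub>RG\<^esub> l) \<star> (\<ominus>\<^bsub>RG\<^esub> k) \<oplus>\<^bsub>RG\<^esub> (\<ominus>\<^bsub>RG\<^esub> k) \<star> (\<ominus>\<^bsub>RG\<^esub> l)"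
    using st cl by (simp add: skew_def star_add star_mult mult_closed)
  also have "\<dots> = k \<star> l \<oplus>\<^bsub>RG\<^esub> l \<star> k" using cl by algebra
  finally show ?thesis using st by (simp add: symm_def integral_add integral_mult skew_def)
qed

definition trace where "trace f = f \<one>\<^bsub>G\<^esub>"

lemma trace_add: "trace (f \<oplus>\<^bsub>RG\<^esub> g) = trace f \<oplus> trace g"
  by (simp add: trace_def add_coeff)

lemma trace_closed: "f \<in> carrier RG \<Longrightarrow> trace f \<in> carrier R"
  by (simp add: trace_def RG_closed)

lemma trace_minus: "f \<in> carrier RG \<Longrightarrow> g \<in> carrier RG \<Longrightarrow> trace (f \<ominus>\<^bsub>RG\<^esub> g) = trace f \<ominus> trace g"
  by (simp add: trace_def RG.minus_eq R.minus_eq add_coeff neg_coeff)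

lemma trace_commute:
  assumes f: "f \<in> carrier RG" and g: "g \<in> carrier RG" shows "trace (f \<star> g) = trace (g \<star> f)"
  unfolding trace_def
proof (rule mult_reindex[where \<sigma> = "\<lambda>y. y\<acute>"])
  show "bij_betw (\<lambda>y. y\<acute>) (carrier G) (carrier G)"
    by (rule bij_betw_byWitness[of _ "\<lambda>y. y\<acute>"]) auto
  fix y assume "y \<in> carrier G"
  then show "f y \<otimes> g (y\<acute> \<bullet> \<one>\<^bsub>G\<^esub>) = g (y\<acute>) \<otimes> f ((y\<acute>)\<acute> \<bullet> \<one>\<^bsub>G\<^esub>)" using f g by (simp add: RG_closed R.m_comm)
qed (use f g in auto)

lemma trace_mult_bracket:
  assumes "x \<in> carrier RG" "a \<in> carrier RG" "b \<in> carrier RG"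
  shows "trace (x \<star> lie_bracket RG a b) = trace (lie_bracket RG x a \<star> b)"
proof -
  have "trace (a \<star> (x \<star> b) \<ominus>\<^bsub>RG\<^esub> (x \<star> b) \<star> a) = \<zero>"
    using assms trace_commute[of a "x \<star> b"] by (simp add: trace_minus trace_closed R.minus_eq R.r_neg)
  then show ?thesis using assms by (simp add: RG.mult_lie_bracket trace_add trace_closed)
qed

text \<open>The trace is the image of an integer, namely a sign times a sum of squares of integers;
  characteristic zero carries its vanishing back to the integers.\<close>

lemma trace_square_zero:
  assumes char: "char_zero R" and f: "f \<in> symm \<union> skew" and tr: "trace (f \<star> f) = \<zero>"
  shows "f = \<zero>\<^bsub>RG\<^esub>"
proof -
  have fi: "f \<in> integral" using f by (auto simp: symm_def skew_def)
  note fc = integral_closed[OF fi]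
  obtain n where n: "\<And>x. x \<in> carrier G \<Longrightarrow> f x = R.of_integer (n x)" using integral_coeff fi by metis
  have "\<exists>e. (e = 1 \<or> e = - 1) \<and> (\<forall>x\<in>carrier G. f (x\<acute>) = R.of_integer (e * n x))"
  proof (cases "f \<in> symm")
    case True
    then have "f (x\<acute>) = f x" if "x \<in> carrier G" for x using star_coeff[OF that, of f] by (simp add: symm_def)
    then show ?thesis using n by (intro exI[of _ 1]) simp
  next
    case False
    then have "star f = \<ominus>\<^bsub>RG\<^esub> f" using f by (simp add: skew_def)
    then have "f (x\<acute>) = \<ominus> f x" if "x \<in> carrier G" for x using star_coeff[OF that, of f] neg_coeff[OF fc that] by simp
    then show ?thesis using n by (intro exI[of _ "- 1"]) (simp add: R.of_integer_minus)
  qed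
  then obtain e :: int where e: "e = 1 \<or> e = - 1" and fe: "\<And>x. x \<in> carrier G \<Longrightarrow> f (x\<acute>) = R.of_integer (e * n x)" by blast
  let ?A = "supp R G f"
  have Ac: "x \<in> carrier G" if "x \<in> ?A" for x using that by (simp add: supp_def)
  have "trace (f \<star> f) = (\<Oplus>y\<in>?A. f y \<otimes> f (y\<acute> \<bullet> \<one>\<^bsub>G\<^esub>))"
    unfolding trace_def using mult_coeff[OF fc fc _ RG_finite[OF fc]] by (simp add: supp_def)
  also have "\<dots> = R.of_integer (\<Sum>y\<in>?A. n y * (e * n y))"
  proof (intro R.finsum_of_integer RG_finite fc)
    fix y assume "y \<in> ?A"
    then show "f y \<otimes> f (y\<acute> \<bullet> \<one>\<^bsub>G\<^esub>) = R.of_integer (n y * (e * n y))"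
      using n[of y] fe[of y] Ac[of y] by (simp add: R.of_integer_mult)
  qed
  finally have tq: "trace (f \<star> f) = R.of_integer (\<Sum>y\<in>?A. n y * (e * n y))" .
  have "(\<Sum>y\<in>?A. n y * (e * n y)) = 0"
    using tr unfolding tq R.of_integer_eq_0_iff[OF char] .
  moreover have "(\<Sum>y\<in>?A. n y * (e * n y)) = e * (\<Sum>y\<in>?A. n y * n y)"
    unfolding sum_distrib_left by (rule sum.cong) (simp_all add: mult.left_commute)
  ultimately have "e * (\<Sum>y\<in>?A. n y * n y) = 0" by simp
  then have "(\<Sum>y\<in>?A. n y * n y) = 0" using e by auto
  then have "\<forall>y\<in>?A. n y * n y = 0" using RG_finite[OF fc] by (subst (asm) sum_nonneg_eq_0_iff) auto
  then have "\<forall>y\<in>?A. f y = \<zero>" using n Ac by simp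
  then have "?A = {}" by (auto simp: supp_def)
  then have "f x = \<zero>\<^bsub>RG\<^esub> x" if "x \<in> carrier G" for x using that by (auto simp: supp_def zero_coeff)
  then show ?thesis using fc by (intro RG_ext) auto
qed

text \<open>Characteristic zero does not prevent 2 from being a zero divisor in R, but integer
  coefficients can be halved.\<close>

lemma integral_double_zero:
  assumes char: "char_zero R" and f: "f \<in> integral" and z: "f \<oplus>\<^bsub>RG\<^esub> f = \<zero>\<^bsub>RG\<^esub>"
  shows "f = \<zero>\<^bsub>RG\<^esub>"
proof (rule RG_ext)
  fix x assume x: "x \<in> carrier G"
  obtain n where n: "\<And>x. x \<in> carrier G \<Longrightarrow> f x = R.of_integer (n x)" using integral_coeff f by metis
  have "(f \<oplus>\<^bsub>RG\<^esub> f) x = R.of_integer (n x) \<oplus> R.of_integer (n x)" using x n by (simp add: add_coeff)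
  also have "\<dots> = R.of_integer (n x + n x)" by (rule R.of_integer_add[symmetric])
  finally have "(f \<oplus>\<^bsub>RG\<^esub> f) x = R.of_integer (n x + n x)" .
  then have "R.of_integer (n x + n x) = \<zero>" unfolding z zero_coeff[OF x] by (rule sym)
  then have "n x + n x = 0" unfolding R.of_integer_eq_0_iff[OF char] .
  then show "f x = \<zero>\<^bsub>RG\<^esub> x" using n[OF x] x by (simp add: zero_coeff)
qed (use f integral_closed in auto)

section \<open>Consequences of the Lie metabelian identity for skew elements\<close>

context
  assumes char: "char_zero R" and lm: "lie_metabelian RG (symmetric_elements R G)"
begin

lemma metabelian_symm:
  "a \<in> symm \<Longrightarrow> b \<in> symm \<Longrightarrow> c \<in> symm \<Longrightarrow> d \<in> symm \<Longrightarrow>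
    lie_bracket RG (lie_bracket RG a b) (lie_bracket RG c d) = \<zero>\<^bsub>RG\<^esub>"
  using lm symm_symmetric unfolding lie_metabelian_def by blast

text \<open>The trace is positive definite, so an element of the form \<open>y = [p, q]\<close> vanishes as soon as it
  commutes with \<open>p\<close>: then \<open>tr (y y) = tr ([y, p] q) = 0\<close>.\<close>

lemma commutator_zeroI:
  assumes cl: "p \<in> carrier RG" "q \<in> carrier RG" and y: "lie_bracket RG p q \<in> symm \<union> skew"
    and z: "lie_bracket RG (lie_bracket RG p q) p = \<zero>\<^bsub>RG\<^esub>"
  shows "lie_bracket RG p q = \<zero>\<^bsub>RG\<^esub>"
  using trace_mult_bracket[of "lie_bracket RG p q" p q] cl z
  by (intro trace_square_zero[OF char y]) (simp add: trace_def zero_coeff)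

text \<open>Write d = [s, t]. By the Jacobi identity [d, k] is a sum of two commutators of symmetric
  elements, because [s, k] and [t, k] are symmetric. So it commutes with d by hypothesis, and
  \<open>commutator_zeroI\<close> applies.\<close>

lemma bracket_symm_commutes_skew:
  assumes s: "s \<in> symm" and t: "t \<in> symm" and k: "k \<in> skew"
  shows "lie_bracket RG (lie_bracket RG s t) k = \<zero>\<^bsub>RG\<^esub>"
proof (rule commutator_zeroI)
  let ?d = "lie_bracket RG s t"
  note cl = symm_closed[OF s] symm_closed[OF t] skew_closed[OF k]
  show "?d \<in> carrier RG" "k \<in> carrier RG" using cl by auto
  show "lie_bracket RG ?d k \<in> symm \<union> skew" using bracket_skew_skew[OF bracket_symm_symm[OF s t] k] by blast
  let ?x = "lie_bracket RG (lie_bracket RG s k) t" and ?y = "lie_bracket RG s (lie_bracket RG t k)"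
  have "lie_bracket RG ?x ?d = \<zero>\<^bsub>RG\<^esub>" "lie_bracket RG ?y ?d = \<zero>\<^bsub>RG\<^esub>"
    using metabelian_symm bracket_symm_skew s t k by blast+
  moreover have "lie_bracket RG (?x \<oplus>\<^bsub>RG\<^esub> ?y) ?d = lie_bracket RG ?x ?d \<oplus>\<^bsub>RG\<^esub> lie_bracket RG ?y ?d"
    using cl by (intro RG.add_commutators[symmetric]) auto
  ultimately show "lie_bracket RG (lie_bracket RG ?d k) ?d = \<zero>\<^bsub>RG\<^esub>"
    unfolding RG.lie_bracket_jacobi[OF cl] by simp
qed

text \<open>For y = [t, [k, l]], moving brackets under the trace turns tr (y y) into tr ([[y, t], k]
  l). Here y and t are symmetric, so the preceding lemma makes the double bracket zero.\<close>

lemma symm_commutes_bracket_skew: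
  assumes t: "t \<in> symm" and k: "k \<in> skew" and l: "l \<in> skew"
  shows "lie_bracket RG t (lie_bracket RG k l) = \<zero>\<^bsub>RG\<^esub>"
proof (rule trace_square_zero[OF char])
  let ?y = "lie_bracket RG t (lie_bracket RG k l)"
  note cl = symm_closed[OF t] skew_closed[OF k] skew_closed[OF l]
  have y: "?y \<in> symm" using bracket_symm_skew[OF t bracket_skew_skew[OF k l]] .
  then show "?y \<in> symm \<union> skew" by blast
  have "trace (?y \<star> ?y) = trace (lie_bracket RG ?y t \<star> lie_bracket RG k l)"
    using cl by (intro trace_mult_bracket) auto
  also have "\<dots> = trace (lie_bracket RG (lie_bracket RG ?y t) k \<star> l)"
    using cl by (intro trace_mult_bracket) auto
  also have "lie_bracket RG (lie_bracket RG ?y t) k = \<zero>\<^bsub>RG\<^esub>" by (rule bracket_symm_commutes_skew[OF y t k])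
  finally show "trace (?y \<star> ?y) = \<zero>" using cl by (simp add: trace_def zero_coeff)
qed

text \<open>With p = k l + l k symmetric, [p, s] commutes with k and l, hence with p, and so
  vanishes. The other half of 2 k l is [k, l], which commutes with s by the preceding lemma.\<close>

lemma product_skew_commutes_symm:
  assumes k: "k \<in> skew" and l: "l \<in> skew" and s: "s \<in> symm"
  shows "lie_bracket RG (k \<star> l) s = \<zero>\<^bsub>RG\<^esub>"
proof (rule integral_double_zero[OF char])
  note cl = skew_closed[OF k] skew_closed[OF l] symm_closed[OF s]
  let ?p = "k \<star> l \<oplus>\<^bsub>RG\<^esub> l \<star> k"
  have p: "?p \<in> symm" by (rule jordan_skew_skew[OF k l])
  let ?u = "lie_bracket RG ?p s"
  have u: "lie_bracket RG ?u k = \<zero>\<^bsub>RG\<^esub>" "lie_bracket RG ?u l = \<zero>\<^bsub>RG\<^esub>"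
    using bracket_symm_commutes_skew[OF p s] k l by blast+
  have "?u = \<zero>\<^bsub>RG\<^esub>"
  proof (rule commutator_zeroI)
    show "lie_bracket RG ?u ?p = \<zero>\<^bsub>RG\<^esub>"
      using cl u by (intro RG.lie_bracket_product_zero) auto
    show "?u \<in> symm \<union> skew" using bracket_symm_symm[OF p s] by blast
  qed (use cl in auto)
  then show "lie_bracket RG (k \<star> l) s \<oplus>\<^bsub>RG\<^esub> lie_bracket RG (k \<star> l) s = \<zero>\<^bsub>RG\<^esub>"
    unfolding RG.lie_bracket_double_product[OF cl] using symm_commutes_bracket_skew[OF s k l] by (simp add: RG.minus_eq)
  show "lie_bracket RG (k \<star> l) s \<in> integral"
    using k l s by (simp add: integral_bracket integral_mult symm_def skew_def)
qed

end

section \<open>Group elements inside the group ring and the six words\<close>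

definition delta where "delta a = (\<lambda>x\<in>carrier G. if x = a then \<one> else \<zero>)"

lemma delta_coeff: "x \<in> carrier G \<Longrightarrow> delta a x = (if x = a then \<one> else \<zero>)"
  by (simp add: delta_def)

lemma supp_delta: "supp R G (delta a) \<subseteq> {a}"
  by (auto simp: supp_def delta_coeff split: if_splits)

lemma delta_closed: "delta a \<in> carrier RG"
  using finite_subset[OF supp_delta, of a] by (auto simp: group_ring_def delta_def)

lemma delta_integral: "delta a \<in> integral"
proof (rule integralI[OF delta_closed])
  fix x assume "x \<in> carrier G"
  then show "\<exists>n. delta a x = R.of_integer n"
    by (intro exI[of _ "if x = a then 1 else 0"]) (simp add: delta_coeff)
qed

lemma star_delta: "a \<in> carrier G \<Longrightarrow> star (delta a) = delta (a\<acute>)"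
  by (rule RG_ext) (auto simp: involution_closed delta_closed star_coeff delta_coeff)

lemma delta_mult:
  assumes f: "f \<in> carrier RG" and a: "a \<in> carrier G" and x: "x \<in> carrier G"
  shows "(delta a \<star> f) x = f (a\<acute> \<bullet> x)"
proof -
  have "(delta a \<star> f) x = (\<Oplus>y\<in>{a}. delta a y \<otimes> f (y\<acute> \<bullet> x))"
    using f a x supp_delta by (intro mult_coeff delta_closed) auto
  also have "\<dots> = f (a\<acute> \<bullet> x)" using f a x by (simp add: R.finsum_insert delta_coeff RG_closed)
  finally show ?thesis .
qed

lemma mult_delta:
  assumes f: "f \<in> carrier RG" and a: "a \<in> carrier G" and x: "x \<in> carrier G"
  shows "(f \<star> delta a) x = f (x \<bullet> a\<acute>)"
proof -
  have s: "star (delta (a\<acute>)) = delta a" using star_delta[of "a\<acute>"] a by simp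
  \<comment> \<open>Right multiplication is obtained from left multiplication by conjugating with
    the involution.\<close>
  have "f \<star> delta a = star (delta (a\<acute>) \<star> star f)"
    using f by (simp add: star_mult delta_closed involution_closed s) (rule arg_cong2[where f = "(\<otimes>\<^bsub>RG\<^esub>)"], rule RG_ext, auto simp: involution_closed star_coeff)
  then have "(f \<star> delta a) x = (delta (a\<acute>) \<star> star f) (x\<acute>)" using x by (simp add: star_coeff)
  also have "\<dots> = f (x \<bullet> a\<acute>)" using f a x by (simp add: delta_mult involution_closed star_coeff G.inv_mult_group)
  finally show ?thesis .
qed

text \<open>Compare the coefficients of p s and s p at a b c, where p = (a - a^-1)(b - b^-1) and s =
  c + c^-1. The positive contribution from a b in p s must be offset at one of the other three
  positions, and each position allows two words.\<close>

lemma six_terms: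
  assumes char: "char_zero R" and lm: "lie_metabelian RG (symmetric_elements R G)"
    and [simp]: "a \<in> carrier G" "b \<in> carrier G" "c \<in> carrier G" and na: "a \<bullet> a \<noteq> \<one>\<^bsub>G\<^esub>" and nb: "b \<bullet> b \<noteq> \<one>\<^bsub>G\<^esub>"
  shows "a \<bullet> b \<bullet> c = c \<bullet> a \<bullet> b \<or> a \<bullet> b \<bullet> c = c\<acute> \<bullet> a \<bullet> b \<or>
    a \<bullet> b \<bullet> c = c \<bullet> a\<acute> \<bullet> b\<acute> \<or> a \<bullet> b \<bullet> c = c\<acute> \<bullet> a\<acute> \<bullet> b\<acute> \<or>
    a \<bullet> b \<bullet> c = a \<bullet> b\<acute> \<bullet> c\<acute> \<or> a \<bullet> b \<bullet> c = a\<acute> \<bullet> b \<bullet> c\<acute>"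
proof -
  let ?k = "\<lambda>a. delta a \<ominus>\<^bsub>RG\<^esub> delta (a\<acute>)" and ?s = "delta c \<oplus>\<^bsub>RG\<^esub> delta (c\<acute>)"
  note dc = delta_closed
  have sk: "?k d \<in> skew" if "d \<in> carrier G" for d
  proof -
    have "star (?k d) = \<ominus>\<^bsub>RG\<^esub> ?k d"
      using that dc[of d] dc[of "d\<acute>"] by (simp add: star_add star_neg star_delta RG.minus_eq RG.minus_add RG.a_comm)
    then show ?thesis unfolding skew_def RG.minus_eq using integral_add integral_neg delta_integral by simp
  qed
  have sy: "?s \<in> symm"
    using dc by (simp add: symm_def integral_add delta_integral star_add star_delta RG.a_comm)
  define p where "p = ?k a \<star> ?k b"
  have pc: "p \<in> carrier RG" using dc by (simp add: p_def)
  have "lie_bracket RG p ?s = \<zero>\<^bsub>RG\<^esub>"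
    unfolding p_def by (rule product_skew_commutes_symm[OF char lm]) (simp_all add: sk sy)
  then have comm: "p \<star> ?s = ?s \<star> p" using pc dc by (simp add: RG.lie_bracket_zero_iff)
  \<comment> \<open>Integer coefficients of p, so that signs make sense: they are positive at most
    at a b and a^-1 b^-1, negative at most at a b^-1 and a^-1 b.\<close>
  define N where "N w = (of_bool (w = a \<bullet> b) - of_bool (w = a \<bullet> b\<acute>) - of_bool (w = a\<acute> \<bullet> b) + of_bool (w = a\<acute> \<bullet> b\<acute>) :: int)" for w
  have pN: "p w = R.of_integer (N w)" if [simp]: "w \<in> carrier G" for w
  proof -
    have ob: "(if P then \<one> else \<zero>) = R.of_integer (of_bool P)" for P by simp
    have "p w = ?k b (a\<acute> \<bullet> w) \<ominus> ?k b (a \<bullet> w)"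
      unfolding p_def using dc
      by (simp add: RG.minus_eq RG.l_distr RG.l_minus add_coeff neg_coeff delta_mult R.minus_eq mult_closed add_closed)
    also have "\<dots> = R.of_integer (of_bool (a\<acute> \<bullet> w = b) - of_bool (a\<acute> \<bullet> w = b\<acute>) - (of_bool (a \<bullet> w = b) - of_bool (a \<bullet> w = b\<acute>)))"
      using dc by (simp only: RG.minus_eq add_coeff neg_coeff delta_coeff ob R.of_integer_diff R.minus_eq that G.m_closed G.inv_closed assms)
    also have "of_bool (a\<acute> \<bullet> w = b) - of_bool (a\<acute> \<bullet> w = b\<acute>) - (of_bool (a \<bullet> w = b) - of_bool (a \<bullet> w = b\<acute>)) = N w"
    proof -
      have "a\<acute> \<bullet> w = v \<longleftrightarrow> w = a \<bullet> v" "a \<bullet> w = v \<longleftrightarrow> w = a\<acute> \<bullet> v" if "v \<in> carrier G" for v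
        using that by auto
      then show ?thesis by (simp add: N_def)
    qed
    finally show ?thesis .
  qed
  let ?x = "a \<bullet> b \<bullet> c"
  have "(p \<star> ?s) ?x = p (?x \<bullet> c\<acute>) \<oplus> p (?x \<bullet> c)"
    using pc dc by (simp add: RG.r_distr add_coeff mult_delta)
  moreover have "(?s \<star> p) ?x = p (c\<acute> \<bullet> ?x) \<oplus> p (c \<bullet> ?x)"
    using pc dc by (simp add: RG.l_distr add_coeff delta_mult)
  ultimately have "p (?x \<bullet> c\<acute>) \<oplus> p (?x \<bullet> c) = p (c\<acute> \<bullet> ?x) \<oplus> p (c \<bullet> ?x)" using comm by simp
  then have "R.of_integer (N (?x \<bullet> c\<acute>) + N (?x \<bullet> c)) = R.of_integer (N (c\<acute> \<bullet> ?x) + N (c \<bullet> ?x))"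
    by (simp add: pN R.of_integer_add)
  then have "R.of_integer (N (?x \<bullet> c\<acute>) + N (?x \<bullet> c) - (N (c\<acute> \<bullet> ?x) + N (c \<bullet> ?x))) = \<zero>"
    unfolding R.of_integer_diff by (simp add: R.minus_eq R.r_neg)
  then have eq: "N (?x \<bullet> c\<acute>) + N (?x \<bullet> c) = N (c\<acute> \<bullet> ?x) + N (c \<bullet> ?x)"
    unfolding R.of_integer_eq_0_iff[OF char] by simp
  have inv_ne: "d \<noteq> d\<acute>" if "d \<in> carrier G" "d \<bullet> d \<noteq> \<one>\<^bsub>G\<^esub>" for d
  proof
    assume "d = d\<acute>"
    then have "d \<bullet> d = d \<bullet> d\<acute>" by simp
    then show False using that by simp
  qed
  have "?x \<bullet> c\<acute> = a \<bullet> b" by (simp add: G.m_assoc)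
  \<comment> \<open>Nontrivial squares separate a b from a b^-1 and a^-1 b. It may coincide with
    a^-1 b^-1, and then the coefficient is 2.\<close>
  moreover have "N (a \<bullet> b) \<ge> 1" using inv_ne[of a] inv_ne[of b] na nb by (simp add: N_def)
  ultimately have "N (?x \<bullet> c\<acute>) \<ge> 1" by simp
  with eq have "N (?x \<bullet> c) < 0 \<or> N (c\<acute> \<bullet> ?x) > 0 \<or> N (c \<bullet> ?x) > 0" by linarith
  moreover have "w = a \<bullet> b \<or> w = a\<acute> \<bullet> b\<acute>" if "N w > 0" for w
    using that unfolding N_def by (simp add: of_bool_def split: if_splits)
  moreover have "w = a \<bullet> b\<acute> \<or> w = a\<acute> \<bullet> b" if "N w < 0" for w
    using that unfolding N_def by (simp add: of_bool_def split: if_splits)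
  ultimately consider "?x \<bullet> c = a \<bullet> b\<acute>" | "?x \<bullet> c = a\<acute> \<bullet> b" | "c\<acute> \<bullet> ?x = a \<bullet> b" | "c\<acute> \<bullet> ?x = a\<acute> \<bullet> b\<acute>"
    | "c \<bullet> ?x = a \<bullet> b" | "c \<bullet> ?x = a\<acute> \<bullet> b\<acute>" by blast
  moreover have "?x = v \<bullet> c\<acute>" if "?x \<bullet> c = v" for v using that[symmetric] by (simp add: G.m_assoc)
  moreover have "?x = c \<bullet> v" if "c\<acute> \<bullet> ?x = v" for v using that[symmetric] by simp
  moreover have "?x = c\<acute> \<bullet> v" if "c \<bullet> ?x = v" for v using that[symmetric] by simp
  ultimately have "?x = a \<bullet> b\<acute> \<bullet> c\<acute> \<or> ?x = a\<acute> \<bullet> b \<bullet> c\<acute> \<or> ?x = c \<bullet> (a \<bullet> b) \<or> ?x = c \<bullet> (a\<acute> \<bullet> b\<acute>) \<or>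
    ?x = c\<acute> \<bullet> (a \<bullet> b) \<or> ?x = c\<acute> \<bullet> (a\<acute> \<bullet> b\<acute>)" by metis
  moreover have "u \<bullet> (v \<bullet> w) = u \<bullet> v \<bullet> w" if "u \<in> carrier G" "v \<in> carrier G" "w \<in> carrier G" for u v w
    using that by (simp add: G.m_assoc)
  ultimately show ?thesis by simp argo
qed

lemma type_of_lie_metabelian:
  assumes "char_zero R" and "lie_metabelian RG (symmetric_elements R G)"
  shows "G.lie_metabelian_type"
proof -
  interpret six_group G
    by unfold_locales (rule six_terms[OF assms])
  show ?thesis by (rule six_group_type)
qed

end

theorem theorem1:
  fixes R :: "('r, 'm) ring_scheme" and G :: "('g, 'n) monoid_scheme"
  assumes "cring R" and "char_zero R" and "group G"
  shows "lie_metabelian (group_ring R G) (symmetric_elements R G) \<longleftrightarrow>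
      comm_group (G\<lparr>carrier := generate G {g \<in> carrier G. g [^]\<^bsub>G\<^esub> (2::nat) \<noteq> \<one>\<^bsub>G\<^esub>}\<rparr>)
    \<or> (\<exists>H. elementary_abelian_2_subgroup H G \<and> subgroup_index G H = 2)
    \<or> (\<exists>B x. subgroup B G \<and> comm_group (G\<lparr>carrier := B\<rparr>) \<and> subgroup_index G B = 2 \<and>
          x \<in> carrier G \<and> group.ord G x = 4 \<and>
          (\<forall>b\<in>B. inv\<^bsub>G\<^esub> x \<otimes>\<^bsub>G\<^esub> b \<otimes>\<^bsub>G\<^esub> x = inv\<^bsub>G\<^esub> b))
    \<or> (center G = {g \<in> carrier G. g [^]\<^bsub>G\<^esub> (2::nat) = \<one>\<^bsub>G\<^esub>} \<and>
          subgroup_index G (center G) = 4)"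
proof -
  interpret group_ring_setup R G using assms by (simp add: group_ring_setup_def)
  show ?thesis
    using type_of_lie_metabelian[OF assms(2)] lie_metabelian_of_type unfolding G.lie_metabelian_type_def by argo
qed

end
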